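(* Let $e\ge 2$ and $0\le m\le e-1$. Let $\lambda\otimes\mu\in B(\Lambda_0)\otimes B(\Lambda_m)$, i.e. $\lambda$ and $\mu$ are $e$-restricted partitions, $\lambda$ being regarded with charge $0$ and $\mu$ with charge $m$. Then $\lambda\otimes\mu\in B(\Lambda_0+\Lambda_m)$ if and only if $$\tau_m(\mathrm{base}(\lambda))\supset \mathrm{roof}(\mu).$$
   Context: Fix $e\ge2$; $\mathfrak g=\mathfrak g(A^{(1)}_{e-1})$ with fundamental weights $\Lambda_i$, $i\in\mathbb Z/e\mathbb Z$. Partitions. A partition is $\lambda=(\lambda_0\ge\lambda_1\ge\cdots)$, nonnegative integers, finitely many nonzero; it is $e$-restricted if $\lambda_k-\lambda_{k+1}<e$ for all $k\ge0$. $\lambda\subset\mu$ means $\lambda_k\le\mu_k$ for all $k$. For an integer $c$, the set of beta numbers of charge $c$ of $\lambda$ is $J=\{j_0>j_1>\cdots\}$, $j_k=\lambda_k+c-k$. For fixed $c$, $\lambda$ and $J$ determine each other, and operations on one are transported to the other. Crystals. $B(\Lambda_m)$ is realized as the set of $e$-restricted partitions (with charge $m$); the node in row $a$, column $b$ (counted from $0$) has residue $m-a+b \bmod e$. For a partition, read its addable $i$-nodes (recorded $A$) and removable $i$-nodes (recorded $R$) from the first row to the last row. On $B(\Lambda_0)\otimes B(\Lambda_m)$ the Kashiwara operators $\tilde e_i,\tilde f_i$ are given as follows: for $\lambda\otimes\mu$, write first the $A/R$ sequence of $\mu$ and then that of $\lambda$; repeatedly delete pairs $R\,A$ ($R$ to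 the left of $A$, with nothing undeleted between them) until the sequence has the form $A\cdots AR\cdots R$; $\tilde f_i$ adds the node of the rightmost remaining $A$ (and gives $0$ if there is none), $\tilde e_i$ removes the node of the leftmost remaining $R$ (and gives $0$ if there is none). $B(\Lambda_0+\Lambda_m)$ denotes the connected component of $B(\Lambda_0)\otimes B(\Lambda_m)$ containing $\emptyset\otimes\emptyset$ (equivalently, all nonzero elements obtained from $\emptyset\otimes\emptyset$ by applying the $\tilde f_i$). Roof and base. Let $\lambda$ be $e$-restricted with beta set $J$ (any charge; the results do not depend on it). Put $U(J)=\{x\in J\mid x-e\notin J\}$; $\lambda$ is an $e$-core iff $U(J)=\emptyset$. $\mathrm{up}$: if $U(J)=\emptyset$, $\mathrm{up}(J)=J$. Otherwise let $p=\max U(J)$, $V(J)=\{x>p\mid x\notin p+e\mathbb Z,\ x-e\in J,\ x\notin J\}$, $q=\min V(J)$, and $\mathrm{up}(J)=(J\setminus\{p\})\cup\{q\}$. $\mathrm{down}$: if $U(J)=\emptyset$, $\mathrm{down}(J)=J$. Otherwise let $p'=\min U(J)$, $W(J)=\{x>p'-e\mid x\in J,\ x+e\notin J\}\cup\{p'\}$, $q'=\min W(J)$, and $\mathrm{down}(J)=(J\setminus\{q'\})\cup\{p'-e\}$. Both operations preserve $e$-restrictedness, and iterating either one reaches an $e$-core after finitely many steps; $\mathrm{roof}(\lambda)$ is the $e$-core obtained by iterating $\mathrm{up}$, $\mathrm{base}(\lambda)$ the $e$-core obtained by iterating $\mathrm{down}$. The map $\tau_m$. Let $\lambda$ be an $e$-core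 with beta set $J$ of charge $0$, and $M_i(\lambda)=\max\{x\in J\mid x+e\mathbb Z=i\}$ for $i\in\mathbb Z/e\mathbb Z$. Order them as $M_{i_1}(\lambda)>\cdots>M_{i_e}(\lambda)$. Then $\tau_m(\lambda)$ is the partition whose beta set of charge $m$ is $J\cup\{M_{i_k}(\lambda)+e\mid 1\le k\le m\}$ (so $\tau_0(\lambda)=\lambda$). *)

theory Defs
  imports Main
begin

section \<open>Partitions and beta sets\<close>

type_synonym part = "nat \<Rightarrow> nat"

definition is_partition :: "part \<Rightarrow> bool" where
  "is_partition lam \<longleftrightarrow> antimono lam \<and> finite {k. lam k \<noteq> 0}"

definition e_restricted :: "nat \<Rightarrow> part \<Rightarrow> bool" where
  "e_restricted e lam \<longleftrightarrow> is_partition lam \<and> (\<forall>k. lam k - lam (Suc k) < e)"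

definition empty_part :: part where
  "empty_part = (\<lambda>_. 0)"

definition beta_set :: "int \<Rightarrow> part \<Rightarrow> int set" where
  "beta_set c lam = range (\<lambda>k. int (lam k) + c - int k)"

definition part_of_beta :: "int \<Rightarrow> int set \<Rightarrow> part" where
  "part_of_beta c J = (THE lam. is_partition lam \<and> beta_set c lam = J)"


section \<open>Crystals\<close>

text \<open>Elements of \<open>\<int>/e\<int>\<close> are represented by the integers \<open>0 \<le> i < e\<close>.\<close>

definition residue :: "nat \<Rightarrow> int \<Rightarrow> nat \<Rightarrow> nat \<Rightarrow> int" where
  "residue e c a b = (c - int a + int b) mod int e"

definition addable :: "nat \<Rightarrow> int \<Rightarrow> int \<Rightarrow> part \<Rightarrow> nat \<Rightarrow> bool" where
  "addable e c i lam a \<longleftrightarrow> (a = 0 \<or> lam a < lam (a - 1)) \<and> residue e c a (lam a) = i"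

definition removable :: "nat \<Rightarrow> int \<Rightarrow> int \<Rightarrow> part \<Rightarrow> nat \<Rightarrow> bool" where
  "removable e c i lam a \<longleftrightarrow> lam (Suc a) < lam a \<and> residue e c a (lam a - 1) = i"

datatype node_kind = Addable | Removable

text \<open>
  Only the rows up to and including the first empty row, whose index is the number of nonzero
  parts, can carry an addable or removable node.  For \<open>e \<ge> 2\<close> no row carries
  both an addable and a removable \<open>i\<close>-node, so the order within a row is irrelevant.
\<close>
definition signature :: "nat \<Rightarrow> int \<Rightarrow> int \<Rightarrow> part \<Rightarrow> (node_kind \<times> nat) list" where
  "signature e c i lam = concat (map (\<lambda>a.
       (if addable e c i lam a then [(Addable, a)] else []) @
       (if removable e c i lam a then [(Removable, a)] else []))
     [0..<Suc (card {k. lam k \<noteq> 0})])"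

text \<open>In a tensor product, \<open>Inl a\<close> and \<open>Inr a\<close> are row \<open>a\<close> of the left and of the right factor.\<close>
definition tensor_signature ::
    "nat \<Rightarrow> nat \<Rightarrow> int \<Rightarrow> part \<times> part \<Rightarrow> (node_kind \<times> (nat + nat)) list" where
  "tensor_signature e m i = (\<lambda>(lam, \<mu>).
     map (map_prod id Inr) (signature e (int m) i \<mu>) @
     map (map_prod id Inl) (signature e 0 i lam))"

fun push_entry :: "node_kind \<times> 'a \<Rightarrow> (node_kind \<times> 'a) list \<Rightarrow> (node_kind \<times> 'a) list" where
  "push_entry (Removable, x) ((Addable, y) # s) = s"
| "push_entry p s = p # s"

text \<open>
  The result of deleting adjacent pairs \<open>Removable, Addable\<close> as long as possible;
  the lemmas below show that every order of deletions leads to this sequence.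
\<close>
definition reduced :: "(node_kind \<times> 'a) list \<Rightarrow> (node_kind \<times> 'a) list" where
  "reduced s = foldr push_entry s []"

inductive delete_RA :: "(node_kind \<times> 'a) list \<Rightarrow> (node_kind \<times> 'a) list \<Rightarrow> bool" where
  "delete_RA (s @ (Removable, x) # (Addable, y) # t) (s @ t)"

lemma delete_RA_Nil: "delete_RA ((Removable, x) # (Addable, y) # t) t"
  by (metis append_Nil delete_RA.intros)

lemma delete_RA_Cons: "delete_RA s t \<Longrightarrow> delete_RA (p # s) (p # t)"
  by (metis append_Cons delete_RA.simps)

lemma delete_RA_reduced: "delete_RA\<^sup>*\<^sup>* s (reduced s)"
proof (induction s)
  case Nil
  then show ?case by (simp add: reduced_def)
next
  case (Cons p s)
  have "delete_RA\<^sup>*\<^sup>* (p # s) (p # reduced s)"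
    using Cons.IH by induction (auto intro: rtranclp.rtrancl_into_rtrancl delete_RA_Cons)
  moreover have "delete_RA\<^sup>*\<^sup>* (p # reduced s) (reduced (p # s))"
  proof -
    have "delete_RA\<^sup>*\<^sup>* (p # t) (push_entry p t)" for t :: "(node_kind \<times> 'a) list"
      by (cases "(p, t)" rule: push_entry.cases)
         (auto intro: r_into_rtranclp delete_RA_Nil)
    then show ?thesis by (simp add: reduced_def)
  qed
  ultimately show ?case by (rule rtranclp_trans)
qed

lemma reduced_delete_RA: "delete_RA s t \<Longrightarrow> reduced s = reduced t"
  by (induction rule: delete_RA.induct) (simp add: reduced_def)

lemma reduced_shape:
  "\<exists>a r. map fst (reduced s) = replicate a Addable @ replicate r Removable"
proof (induction s)
  case Nil
  then show ?case by (simp add: reduced_def)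
next
  case (Cons p s)
  then obtain a r where ar: "map fst (reduced s) = replicate a Addable @ replicate r Removable"
    by blast
  obtain k x where p: "p = (k, x)" by fastforce
  have Suc_a: "\<exists>a' r'. Addable # replicate a Addable @ replicate r Removable =
      replicate a' Addable @ replicate r' Removable"
    by (rule exI[of _ "Suc a"]) auto
  show ?case
  proof (cases k)
    case Addable
    then show ?thesis using ar p Suc_a by (simp add: reduced_def)
  next
    case Removable
    show ?thesis
    proof (cases a)
      case 0
      then have "reduced (p # s) = p # reduced s"
        using ar p Removable
        by (cases "(p, reduced s)" rule: push_entry.cases) (auto simp: reduced_def Cons_replicate_eq)
      then show ?thesis
        using ar p Removable 0 by (intro exI[of _ 0] exI[of _ "Suc r"]) simp
    next
      case (Suc n)
      then obtain y t where "reduced s = (Addable, y) # t"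
        "map fst t = replicate n Addable @ replicate r Removable"
        using ar by (cases "reduced s") auto
      then show ?thesis using p Removable by (auto simp: reduced_def)
    qed
  qed
qed

fun add_node :: "nat + nat \<Rightarrow> part \<times> part \<Rightarrow> part \<times> part" where
  "add_node (Inl a) (lam, \<mu>) = (lam(a := lam a + 1), \<mu>)"
| "add_node (Inr a) (lam, \<mu>) = (lam, \<mu>(a := \<mu> a + 1))"

fun remove_node :: "nat + nat \<Rightarrow> part \<times> part \<Rightarrow> part \<times> part" where
  "remove_node (Inl a) (lam, \<mu>) = (lam(a := lam a - 1), \<mu>)"
| "remove_node (Inr a) (lam, \<mu>) = (lam, \<mu>(a := \<mu> a - 1))"

text \<open>The Kashiwara operators; \<open>None\<close> is the value \<open>0\<close>.\<close>

definition f_op :: "nat \<Rightarrow> nat \<Rightarrow> int \<Rightarrow> part \<times> part \<Rightarrow> (part \<times> part) option" where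
  "f_op e m i b =
     (let as = filter (\<lambda>p. fst p = Addable) (reduced (tensor_signature e m i b))
      in if as = [] then None else Some (add_node (snd (last as)) b))"

definition e_op :: "nat \<Rightarrow> nat \<Rightarrow> int \<Rightarrow> part \<times> part \<Rightarrow> (part \<times> part) option" where
  "e_op e m i b =
     (let rs = filter (\<lambda>p. fst p = Removable) (reduced (tensor_signature e m i b))
      in if rs = [] then None else Some (remove_node (snd (hd rs)) b))"

text \<open>
  The crystals \<open>B(\<Lambda>\<^sub>m)\<close> have the same underlying set for all \<open>m\<close>; the charge only enters the
  operators.
\<close>
definition B_fund :: "nat \<Rightarrow> part set" where
  "B_fund e = {lam. e_restricted e lam}"

definition crystal_edge :: "nat \<Rightarrow> nat \<Rightarrow> part \<times> part \<Rightarrow> part \<times> part \<Rightarrow> bool" where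
  "crystal_edge e m b b' \<longleftrightarrow>
     b \<in> B_fund e \<times> B_fund e \<and> b' \<in> B_fund e \<times> B_fund e \<and>
     (\<exists>i\<in>{0..<int e}. f_op e m i b = Some b' \<or> e_op e m i b = Some b')"

text \<open>\<open>B(\<Lambda>\<^sub>0 + \<Lambda>\<^sub>m)\<close>\<close>
definition B_sum :: "nat \<Rightarrow> nat \<Rightarrow> (part \<times> part) set" where
  "B_sum e m = {b. equivclp (crystal_edge e m) (empty_part, empty_part) b}"


section \<open>Roof and base\<close>

definition U_set :: "nat \<Rightarrow> int set \<Rightarrow> int set" where
  "U_set e J = {x \<in> J. x - int e \<notin> J}"

definition V_set :: "nat \<Rightarrow> int set \<Rightarrow> int set" where
  "V_set e J = (let p = Max (U_set e J) in
     {x. x > p \<and> \<not> int e dvd (x - p) \<and> x - int e \<in> J \<and> x \<notin> J})"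

definition W_set :: "nat \<Rightarrow> int set \<Rightarrow> int set" where
  "W_set e J = (let p' = Min (U_set e J) in
     {x. x > p' - int e \<and> x \<in> J \<and> x + int e \<notin> J} \<union> {p'})"

definition up_beta :: "nat \<Rightarrow> int set \<Rightarrow> int set" where
  "up_beta e J = (if U_set e J = {} then J
     else (J - {Max (U_set e J)}) \<union> {Min (V_set e J)})"

definition down_beta :: "nat \<Rightarrow> int set \<Rightarrow> int set" where
  "down_beta e J = (if U_set e J = {} then J
     else (J - {Min (W_set e J)}) \<union> {Min (U_set e J) - int e})"

text \<open>
  The notions below do not depend on the charge (a change of charge translates all beta sets);
  charge \<open>0\<close> is used.
\<close>

definition e_core :: "nat \<Rightarrow> part \<Rightarrow> bool" where
  "e_core e lam \<longleftrightarrow> is_partition lam \<and> U_set e (beta_set 0 lam) = {}"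

definition up :: "nat \<Rightarrow> part \<Rightarrow> part" where
  "up e lam = part_of_beta 0 (up_beta e (beta_set 0 lam))"

definition down :: "nat \<Rightarrow> part \<Rightarrow> part" where
  "down e lam = part_of_beta 0 (down_beta e (beta_set 0 lam))"

definition roof :: "nat \<Rightarrow> part \<Rightarrow> part" where
  "roof e lam = (THE \<rho>. e_core e \<rho> \<and> (\<exists>n. \<rho> = (up e ^^ n) lam))"

definition base :: "nat \<Rightarrow> part \<Rightarrow> part" where
  "base e lam = (THE \<rho>. e_core e \<rho> \<and> (\<exists>n. \<rho> = (down e ^^ n) lam))"


section \<open>The map \<open>\<tau>\<^sub>m\<close>\<close>

text \<open>The set is infinite (unbounded below), so \<open>Max\<close> cannot be used here.\<close>
definition M_beta :: "nat \<Rightarrow> int set \<Rightarrow> int \<Rightarrow> int" where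
  "M_beta e J i = (GREATEST x. x \<in> J \<and> x mod int e = i)"

text \<open>\<open>M_list e J ! (k - 1)\<close> is \<open>M\<^sub>i\<close> for \<open>i = i\<^sub>k\<close>.\<close>
definition M_list :: "nat \<Rightarrow> int set \<Rightarrow> int list" where
  "M_list e J = rev (sorted_list_of_set (M_beta e J ` {0..<int e}))"

definition tau :: "nat \<Rightarrow> nat \<Rightarrow> part \<Rightarrow> part" where
  "tau e m lam = (let J = beta_set 0 lam in
     part_of_beta (int m) (J \<union> (\<lambda>x. x + int e) ` set (take m (M_list e J))))"


definition sub_diagram :: "part \<Rightarrow> part \<Rightarrow> bool" where
  "sub_diagram lam \<mu> \<longleftrightarrow> (\<forall>k. lam k \<le> \<mu> k)"

end

theory Submission
  imports Defs
begin

text \<open>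
  The inclusion is compared along the edges of the crystal. A node is added or removed by moving a
  bead between positions \<open>x\<close> and \<open>x + 1\<close>, and the signature rule says that, among the levels
  \<open>x + k e\<close> of the factor in which this happens, the nearest non-neutral one above \<open>x\<close> is addable and the
  nearest one below \<open>x\<close> is removable. Under these conditions the base (roof) of that factor either does
  not change or changes by adding nodes of residue \<open>i\<close>. In the second case all levels above (below) \<open>x\<close>
  are neutral, so the signature rule also restricts the other factor: \<open>roof \<mu>\<close> has no removable
  \<open>i\<close>-node, respectively \<open>base \<lambda>\<close>, and hence \<open>\<tau>\<^sub>m (base \<lambda>)\<close>, has no addable one. Either way
  the inclusion is not affected. It holds for \<open>\<emptyset> \<otimes> \<emptyset>\<close>. Conversely, if all \<open>e\<^sub>i\<close> vanish on
  \<open>\<lambda> \<otimes> \<mu>\<close>, then \<open>\<lambda> = \<emptyset>\<close>, and \<open>\<mu> \<subseteq> roof \<mu>\<close> is contained in \<open>\<tau>\<^sub>m \<emptyset>\<close>, the rectangle with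
  \<open>m\<close> rows of length \<open>e - m\<close>, where the last removable node cannot have residue \<open>0\<close>.
\<close>

text \<open>Moving one bead can change the whole course of \<open>down\<close> or \<open>up\<close>,
  so the runs from \<open>J\<close> and from \<open>J - {x} \<union> {x + 1}\<close> cannot be
  matched step by step. The base is therefore given a description without choices: insert the beads
  in increasing order. Two such runs that differ in one bead stay comparable, and their difference
  is confined to blocks of length \<open>d\<close>. General \<open>d\<close> serves to show that
  \<open>down\<close> does not change the outcome of the insertions; the crystal edges are the case
  \<open>d = 1\<close>. For the roof, the runs are compared only at checkpoints: once no element of
  \<open>U\<close> from \<open>z\<close> upwards is left, the set is given in closed form by a
  bracket count (\<open>drain\<close>), which depends on the two positions of a level mainly through
  the number of their beads. Beta sets are in charge 0 until the final comparison, so residue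
  \<open>i\<close> for \<mu> means the class of \<open>i - int m\<close>. Inclusion of diagrams is
  tested by counting the beads \<ge> \<open>y\<close>; adding nodes of one residue changes this
  count by at most one.\<close>

section \<open>Insertion\<close>

text \<open>The largest position below \<open>x\<close> that is congruent to \<open>t\<close>.\<close>
definition prev_pos :: "int \<Rightarrow> int \<Rightarrow> int \<Rightarrow> int" where
  "prev_pos E t x = x - 1 - (x - 1 - t) mod E"

text \<open>
  For a core \<open>S\<close> all of whose beads lie below \<open>t\<close>, this is the base of \<open>S \<union> {t}\<close>. The base of any \<open>J\<close>
  is obtained by inserting its beads in increasing order.
\<close>
definition ins :: "int \<Rightarrow> int set \<Rightarrow> int \<Rightarrow> int set" where
  "ins E S t = {x. (\<exists>s\<in>S. prev_pos E t x \<le> s \<and> s < x) \<and> (if E dvd (x - t) then x \<le> t else x \<in> S)}"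

definition flush :: "int \<Rightarrow> int set \<Rightarrow> bool" where
  "flush E S \<longleftrightarrow> (\<forall>x\<in>S. x - E \<in> S)"

text \<open>An infinite set has no first bead to insert. The run starts from the core
  \<open>{..N}\<close>, which stands for the filled part at the bottom of \<open>J\<close>.\<close>

fun ins_upto :: "int \<Rightarrow> int set \<Rightarrow> int \<Rightarrow> nat \<Rightarrow> int set" where
  "ins_upto E J N 0 = {..N}"
| "ins_upto E J N (Suc n) = (let t = N + 1 + int n in
     if t \<in> J then ins E (ins_upto E J N n) t else ins_upto E J N n)"

section \<open>Congruences modulo \<open>E\<close> and the windows they cut out\<close>

lemma cong_sym: "E dvd (a - b :: int) \<Longrightarrow> E dvd (b - a)"
  by (simp add: dvd_diff_commute)

lemma cong_trans: "E dvd (a - b :: int) \<Longrightarrow> E dvd (b - c) \<Longrightarrow> E dvd (a - c)"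
  using dvd_add[of E "a - b" "b - c"] by simp

lemma cong_shift [simp]: "E dvd (x - E - t :: int) \<longleftrightarrow> E dvd (x - t)"
  "E dvd (x + E - t) \<longleftrightarrow> E dvd (x - t)"
  "E dvd (x - (t - E)) \<longleftrightarrow> E dvd (x - t)"
  "E dvd (x - (t + E)) \<longleftrightarrow> E dvd (x - t)"
  "E dvd (E + x - t) \<longleftrightarrow> E dvd (x - t)"
  "E dvd (x - (E + t)) \<longleftrightarrow> E dvd (x - t)"
proof -
  have *: "x - E - t = (x - t) + (-1) * E" "x + E - t = (x - t) + 1 * E"
    "x - (t - E) = (x - t) + 1 * E" "x - (t + E) = (x - t) + (-1) * E"
    "E + x - t = (x - t) + 1 * E" "x - (E + t) = (x - t) + (-1) * E" by simp_all
  show "E dvd (x - E - t) \<longleftrightarrow> E dvd (x - t)" "E dvd (x + E - t) \<longleftrightarrow> E dvd (x - t)"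
    "E dvd (x - (t - E)) \<longleftrightarrow> E dvd (x - t)" "E dvd (x - (t + E)) \<longleftrightarrow> E dvd (x - t)"
    "E dvd (E + x - t) \<longleftrightarrow> E dvd (x - t)" "E dvd (x - (E + t)) \<longleftrightarrow> E dvd (x - t)"
    unfolding * dvd_add_times_triv_right_iff by (rule refl)+
qed

lemma cong_gap: "E dvd (a - b :: int) \<Longrightarrow> a < b \<Longrightarrow> a \<le> b - E"
  using zdvd_imp_le[of E "b - a"] by (simp add: dvd_diff_commute)

lemma prev_pos_less: "E > 0 \<Longrightarrow> prev_pos E t x < x"
  by (smt (verit) prev_pos_def pos_mod_sign)

lemma prev_pos_ge: "E > 0 \<Longrightarrow> x - E \<le> prev_pos E t x"
  by (smt (verit) prev_pos_def pos_mod_bound)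

lemma prev_pos_dvd: "E dvd (prev_pos E t x - t)"
proof -
  have "prev_pos E t x - t = E * ((x - 1 - t) div E)"
    using minus_mod_eq_mult_div[of "x - 1 - t" E] by (simp add: prev_pos_def)
  thus ?thesis by simp
qed

lemma dvd_small: "E dvd (a - b :: int) \<Longrightarrow> \<bar>a - b\<bar> < E \<Longrightarrow> a = b"
  using zdvd_imp_le[of E "\<bar>a - b\<bar>"] by (cases "a = b") auto

lemma prev_pos_eq:
  assumes "E > 0" "E dvd (a - t)" "a < x" "x \<le> a + E"
  shows "prev_pos E t x = a"
proof (rule dvd_small)
  have "prev_pos E t x - a = (prev_pos E t x - t) - (a - t)" by simp
  thus "E dvd prev_pos E t x - a" using prev_pos_dvd assms(2) by (metis dvd_diff)
  show "\<bar>prev_pos E t x - a\<bar> < E"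
    using prev_pos_less[OF assms(1), of t x] prev_pos_ge[OF assms(1), of x t] assms by linarith
qed

lemma prev_pos_same: "E > 0 \<Longrightarrow> E dvd (x - t) \<Longrightarrow> prev_pos E t x = x - E"
  by (rule prev_pos_eq) auto

lemma prev_pos_shift: "E > 0 \<Longrightarrow> prev_pos E t (x - E) = prev_pos E t x - E"
proof -
  have "(x - E - 1 - t) mod E = (x - 1 - t) mod E"
    using minus_mod_self2[of "x - 1 - t" E] by (simp add: algebra_simps)
  thus ?thesis by (simp add: prev_pos_def)
qed

lemma ins_iff_same: "E > 0 \<Longrightarrow> E dvd (x - t) \<Longrightarrow>
  x \<in> ins E S t \<longleftrightarrow> x \<le> t \<and> (\<exists>s\<in>S. x - E \<le> s \<and> s < x)"
  by (auto simp: ins_def prev_pos_same)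

lemma ins_iff_other: "E > 0 \<Longrightarrow> \<not> E dvd (x - t) \<Longrightarrow>
  x \<in> ins E S t \<longleftrightarrow> x \<in> S \<and> (\<exists>s\<in>S. prev_pos E t x \<le> s \<and> s < x)"
  by (auto simp: ins_def)

section \<open>Insertion into flush sets\<close>

lemma flushD: "flush E S \<Longrightarrow> x \<in> S \<Longrightarrow> x - E \<in> S"
  by (simp add: flush_def)

lemma flush_down:
  assumes "flush E S" "y \<in> S" "E dvd (y - x)" "x \<le> y" "E > 0"
  shows "x \<in> S"
proof -
  obtain k where k: "y - x = E * k" using assms(3) by (auto elim: dvdE)
  have "0 \<le> E * k" using k assms(4) by simp
  hence k0: "k \<ge> 0" using assms(5) zero_le_mult_iff by force
  have "y - E * int j \<in> S" for j
  proof (induction j)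
    case (Suc j)
    have "y - E * int j - E \<in> S" using flushD[OF assms(1) Suc] .
    moreover have "y - E * int j - E = y - E * int (Suc j)" by (simp add: algebra_simps)
    ultimately show ?case by simp
  qed (use assms in simp)
  from this[of "nat k"] have "y - E * k \<in> S" using k0 by simp
  moreover have "y - E * k = x" using k by simp
  ultimately show ?thesis by simp
qed

text \<open>Everything that decides membership of \<open>x\<close> shifts by \<open>E\<close> along
  with \<open>x\<close>: the window, its witness (by flushness of \<open>S\<close>), and the test
  \<open>x \<le> t\<close>, which only gets easier.\<close>

lemma flush_ins:
  assumes E: "E > 0" and fl: "flush E S"
  shows "flush E (ins E S t)"
  unfolding flush_def
proof
  fix x assume x: "x \<in> ins E S t"
  then obtain s where s: "s \<in> S" "prev_pos E t x \<le> s" "s < x" by (auto simp: ins_def)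
  have "s - E \<in> S" using flushD[OF fl s(1)] .
  hence 1: "\<exists>s\<in>S. prev_pos E t (x - E) \<le> s \<and> s < x - E"
    using s by (auto simp: prev_pos_shift[OF E] intro!: bexI[of _ "s - E"])
  show "x - E \<in> ins E S t"
    using x 1 E flushD[OF fl, of x] unfolding ins_def by (auto split: if_splits)
qed

lemma ins_le:
  assumes "S \<subseteq> {..<t}" shows "ins E S t \<subseteq> {..t}"
  using assms by (auto simp: ins_def subset_iff split: if_splits)

text \<open>The runner of \<open>t\<close> is full below \<open>t\<close>, so every window below
  \<open>t\<close> has an occupied left end and the insertion deletes nothing.\<close>

lemma ins_contiguous:
  assumes E: "E > 0" and fl: "flush E S" and le: "S \<subseteq> {..<t}" and t: "t - E \<in> S"
  shows "ins E S t = insert t S"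
proof (rule set_eqI)
  fix x
  have low: "y \<in> S" if "E dvd (y - t)" "y < t" for y
  proof (rule flush_down[OF fl t])
    show "E dvd (t - E - y)" using that(1) by (simp add: dvd_diff_commute)
    show "y \<le> t - E" using cong_gap that by blast
  qed (rule E)
  show "x \<in> ins E S t \<longleftrightarrow> x \<in> insert t S"
  proof (cases "E dvd (x - t)")
    case True
    have "x - E \<in> S" if "x \<le> t"
      using low[of "x - E"] that E True by simp
    moreover have "x \<in> S" if "x \<le> t" "x \<noteq> t"
      using low[of x] that True by simp
    moreover have "x \<le> t" if "x \<in> S" using that le by auto
    ultimately show ?thesis using True E by (auto simp: ins_iff_same intro!: bexI[of _ "x - E"])
  next
    case False
    hence "x \<noteq> t" by auto
    have "prev_pos E t x \<in> S" if "x \<in> S"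
    proof -
      have "x < t" using that le by auto
      thus ?thesis using prev_pos_less[OF E, of t x] low[OF prev_pos_dvd] by simp
    qed
    thus ?thesis using False prev_pos_less[OF E, of t x] \<open>x \<noteq> t\<close> by (auto simp: ins_iff_other[OF E])
  qed
qed

lemma ins_upto_le: "ins_upto E J N n \<subseteq> {..N + int n}"
proof (induction n)
  case (Suc n)
  have "ins_upto E J N n \<subseteq> {..<N + 1 + int n}" using Suc by auto
  from ins_le[OF this, of E] Suc show ?case by (auto simp: Let_def)
qed simp

lemma ins_upto_less: "ins_upto E J N n \<subseteq> {..<N + 1 + int n}"
  using ins_upto_le[of E J N n] by auto

lemma ins_upto_flush: "E > 0 \<Longrightarrow> flush E (ins_upto E J N n)"
  by (induction n) (simp_all add: Let_def flush_ins, simp add: flush_def)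

text \<open>In a core the bead \<open>t - E\<close> is already present when \<open>t\<close> is
  inserted, so all insertions are of the contiguous kind and the core reproduces itself.\<close>

lemma ins_upto_core:
  assumes "E > 0" "flush E J" "{..N} \<subseteq> J"
  shows "ins_upto E J N n = J \<inter> {..N + int n}"
proof (induction n)
  case (Suc n)
  define t where "t = N + 1 + int n"
  have eq: "{..N + int (Suc n)} = insert t {..N + int n}" by (auto simp: t_def)
  have low: "ins_upto E J N n \<subseteq> {..<t}" unfolding t_def by (rule ins_upto_less)
  have step: "ins_upto E J N (Suc n) =
      (if t \<in> J then ins E (ins_upto E J N n) t else ins_upto E J N n)"
    by (simp add: t_def Let_def)
  show ?case
  proof (cases "t \<in> J")
    case True
    have "t - E \<in> ins_upto E J N n"
      unfolding Suc using flushD[OF assms(2) True] assms(1) by (simp add: t_def)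
    from ins_contiguous[OF assms(1) ins_upto_flush[OF assms(1)] low this]
    show ?thesis using True unfolding step eq by (simp add: Suc Int_insert_right)
  next
    case False
    thus ?thesis unfolding step eq by (simp add: Suc Int_insert_right)
  qed
next
  case 0
  show ?case using assms(3) by auto
qed

lemma ins_upto_cong:
  assumes "ins_upto E J N n0 = ins_upto E K N n0" "n0 \<le> n"
    and "\<And>t. N + int n0 < t \<Longrightarrow> t \<le> N + int n \<Longrightarrow> t \<in> J \<longleftrightarrow> t \<in> K"
  shows "ins_upto E J N n = ins_upto E K N n"
  using assms(2,3)
proof (induction n rule: dec_induct)
  case base then show ?case using assms(1) by simp
next
  case (step n)
  thus ?case by (simp add: Let_def)
qed

lemma ins_upto_agree:
  assumes "\<And>t. N < t \<Longrightarrow> t \<le> N + int n \<Longrightarrow> t \<in> J \<longleftrightarrow> t \<in> K"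
  shows "ins_upto E J N n = ins_upto E K N n"
  by (rule ins_upto_cong[of _ _ _ 0]) (use assms in auto)

lemma ins_upto_skip:
  assumes "n0 \<le> n" "\<And>t. N + int n0 < t \<Longrightarrow> t \<le> N + int n \<Longrightarrow> t \<notin> J"
  shows "ins_upto E J N n = ins_upto E J N n0"
  using assms
proof (induction n rule: dec_induct)
  case (step n)
  thus ?case by (simp add: Let_def)
qed simp

section \<open>Comparing insertions into two sets\<close>

definition in_block :: "int \<Rightarrow> int \<Rightarrow> int \<Rightarrow> int \<Rightarrow> bool" where
  "in_block E y d x \<longleftrightarrow> (\<exists>a. E dvd (a - y) \<and> a \<le> x \<and> x \<le> a + d)"

text \<open>
  On the block from \<open>a\<close> to \<open>a + d\<close>, \<open>S\<close> is \<open>T\<close> or arises from it by moving the least bead to the left end.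
\<close>
definition block_rel :: "int \<Rightarrow> int \<Rightarrow> int set \<Rightarrow> int set \<Rightarrow> bool" where
  "block_rel d a S T \<longleftrightarrow> (\<forall>x. a \<le> x \<and> x \<le> a + d \<longrightarrow> (x \<in> S \<longleftrightarrow> x \<in> T)) \<or>
     (\<exists>c. a < c \<and> c \<le> a + d \<and> a \<in> S \<and> c \<in> T \<and> (\<forall>x. a \<le> x \<and> x < c \<longrightarrow> x \<notin> T) \<and>
        (\<forall>x. a < x \<and> x \<le> c \<longrightarrow> x \<notin> S) \<and> (\<forall>x. c < x \<and> x \<le> a + d \<longrightarrow> (x \<in> S \<longleftrightarrow> x \<in> T)))"

definition block_wise :: "int \<Rightarrow> int \<Rightarrow> int \<Rightarrow> int set \<Rightarrow> int set \<Rightarrow> bool" where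
  "block_wise E y d S T \<longleftrightarrow> (\<forall>x. \<not> in_block E y d x \<longrightarrow> (x \<in> S \<longleftrightarrow> x \<in> T)) \<and>
     (\<forall>a. E dvd (a - y) \<longrightarrow> block_rel d a S T)"

lemma block_relE:
  assumes "block_rel d a S T"
  obtains "\<And>x. a \<le> x \<Longrightarrow> x \<le> a + d \<Longrightarrow> x \<in> S \<longleftrightarrow> x \<in> T"
  | c where "a < c" "c \<le> a + d" "a \<in> S" "c \<in> T" "\<And>x. a \<le> x \<Longrightarrow> x < c \<Longrightarrow> x \<notin> T"
     "\<And>x. a < x \<Longrightarrow> x \<le> c \<Longrightarrow> x \<notin> S" "\<And>x. c < x \<Longrightarrow> x \<le> a + d \<Longrightarrow> x \<in> S \<longleftrightarrow> x \<in> T"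
  using assms unfolding block_rel_def by blast

lemma not_in_blockD:
  assumes "\<not> in_block E y d x" "E dvd (a - y)"
  shows "a \<le> x \<Longrightarrow> a + d < x" "x \<le> a + d \<Longrightarrow> x < a"
  using assms unfolding in_block_def by (meson linorder_not_le)+

lemma in_block_right: "E > 0 \<Longrightarrow> 0 \<le> d \<Longrightarrow> E dvd (a - y) \<Longrightarrow> a \<le> x \<Longrightarrow> x < a + E \<Longrightarrow> in_block E y d x \<Longrightarrow> d < E \<Longrightarrow> x \<le> a + d"
proof -
  assume A: "E > 0" "E dvd (a - y)" "a \<le> x" "x < a + E" "in_block E y d x" "d < E"
  then obtain b where b: "E dvd (b - y)" "b \<le> x" "x \<le> b + d" by (auto simp: in_block_def)
  have d: "E dvd (b - a)" using cong_trans[OF b(1) cong_sym[OF A(2)]] .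
  have "b \<le> a" using cong_gap[OF cong_sym[OF d]] A b by linarith
  moreover have "a \<le> b" using cong_gap[OF d] A b by linarith
  ultimately show "x \<le> a + d" using b by simp
qed

text \<open>Related blocks are both occupied or both empty. The conditions \<open>l\<close> and
  \<open>u\<close> keep the ends of the interval from cutting through a block, so the interval is
  occupied for both sets or for neither.\<close>

lemma block_wise_interval:
  assumes "block_wise E y d S T" "0 \<le> d"
    and l: "\<And>a. E dvd (a - y) \<Longrightarrow> l \<le> a + d \<Longrightarrow> l \<le> a"
    and u: "\<And>a. E dvd (a - y) \<Longrightarrow> a < u \<Longrightarrow> a + d < u"
  shows "(\<exists>s\<in>S. l \<le> s \<and> s < u) \<longleftrightarrow> (\<exists>s\<in>T. l \<le> s \<and> s < u)"
proof -
  have *: "\<exists>s\<in>B. l \<le> s \<and> s < u" if s: "s \<in> A" "l \<le> s" "s < u"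
    and AB: "\<And>x. \<not> in_block E y d x \<Longrightarrow> x \<in> A \<Longrightarrow> x \<in> B"
    and bl: "\<And>a x. E dvd (a - y) \<Longrightarrow> a \<le> x \<Longrightarrow> x \<le> a + d \<Longrightarrow> x \<in> A \<Longrightarrow> \<exists>z\<in>B. a \<le> z \<and> z \<le> a + d"
    for A B s
  proof (cases "in_block E y d s")
    case True
    then obtain a where a: "E dvd (a - y)" "a \<le> s" "s \<le> a + d" by (auto simp: in_block_def)
    obtain z where z: "z \<in> B" "a \<le> z" "z \<le> a + d" using bl[OF a s(1)] by blast
    have "l \<le> a" using l[OF a(1)] s a by linarith
    moreover have "a + d < u" using u[OF a(1)] s a by linarith
    ultimately show ?thesis using z by (intro bexI[of _ z]) auto
  qed (use s AB in blast)
  have 1: "\<exists>z\<in>T. a \<le> z \<and> z \<le> a + d" if "E dvd (a - y)" "a \<le> x" "x \<le> a + d" "x \<in> S" for a x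
  proof -
    have "block_rel d a S T" using that assms(1) by (simp add: block_wise_def)
    thus ?thesis by (cases rule: block_relE) (use that in \<open>auto intro: less_imp_le\<close>)
  qed
  have 2: "\<exists>z\<in>S. a \<le> z \<and> z \<le> a + d" if "E dvd (a - y)" "a \<le> x" "x \<le> a + d" "x \<in> T" for a x
  proof -
    have "block_rel d a S T" using that assms(1) by (simp add: block_wise_def)
    thus ?thesis by (cases rule: block_relE) (use that assms(2) in \<open>auto intro: less_imp_le\<close>)
  qed
  show ?thesis
  proof
    assume "\<exists>s\<in>S. l \<le> s \<and> s < u"
    then obtain s where "s \<in> S" "l \<le> s" "s < u" by blast
    thus "\<exists>s\<in>T. l \<le> s \<and> s < u"
      by (rule *[of s S T]) (use assms(1) 1 in \<open>auto simp: block_wise_def\<close>)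
  next
    assume "\<exists>s\<in>T. l \<le> s \<and> s < u"
    then obtain s where "s \<in> T" "l \<le> s" "s < u" by blast
    thus "\<exists>s\<in>S. l \<le> s \<and> s < u"
      by (rule *[of s T S]) (use assms(1) 2 in \<open>auto simp: block_wise_def\<close>)
  qed
qed

text \<open>A position congruent to \<open>u\<close> that separates \<open>a\<close> from
  \<open>x\<close> would lie in the block, and then \<open>u\<close> would lie in a translate of
  it.\<close>

lemma prev_pos_block:
  assumes E: "E > 0" and u: "\<not> in_block E y d u" and a: "E dvd (a - y)" "a \<le> x" "x \<le> a + d"
  shows "prev_pos E u x = prev_pos E u a"
proof (rule prev_pos_eq[OF E prev_pos_dvd])
  show "prev_pos E u a < x" using prev_pos_less[OF E, of u a] a by simp
  show "x \<le> prev_pos E u a + E"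
  proof (rule ccontr)
    let ?g = "prev_pos E u a + E"
    assume "\<not> x \<le> ?g"
    moreover have "a \<le> ?g" using prev_pos_ge[OF E, of a u] by simp
    ultimately have g: "a \<le> ?g" "?g \<le> a + d" using a by auto
    have "E dvd (u - ?g)" using cong_sym[OF prev_pos_dvd[of E u a]] by simp
    from dvd_add[OF a(1) this] have "E dvd (a + (u - ?g) - y)"
      by (simp only: diff_add_eq add_diff_eq add.commute add.left_commute diff_diff_add)
    hence "in_block E y d u" unfolding in_block_def using g by (intro exI[of _ "a + (u - ?g)"]) auto
    thus False using u by simp
  qed
qed

lemma not_in_block_cong:
  assumes "\<not> in_block E y d u" "E dvd (v - u)" shows "\<not> in_block E y d v"
proof
  assume "in_block E y d v"
  then obtain a where a: "E dvd (a - y)" "a \<le> v" "v \<le> a + d" by (auto simp: in_block_def)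
  have "E dvd (a + (u - v) - y)"
    using dvd_add[OF a(1) cong_sym[OF assms(2)]] by (simp add: algebra_simps)
  hence "in_block E y d u" unfolding in_block_def using a by (intro exI[of _ "a + (u - v)"]) auto
  thus False using assms(1) by simp
qed

lemma ex_interval_split:
  fixes g a x :: int
  assumes "g \<le> a" "a \<le> x"
  shows "(\<exists>s\<in>S. g \<le> s \<and> s < x) \<longleftrightarrow> (\<exists>s\<in>S. g \<le> s \<and> s < a) \<or> (\<exists>s\<in>S. a \<le> s \<and> s < x)"
proof -
  have "g \<le> s \<and> s < x \<longleftrightarrow> (g \<le> s \<and> s < a) \<or> (a \<le> s \<and> s < x)" for s
    using assms by linarith
  thus ?thesis by blast
qed

lemma ex_interval_cong:
  assumes "\<And>s. l \<le> s \<Longrightarrow> s < u \<Longrightarrow> s \<in> S \<longleftrightarrow> s \<in> T"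
  shows "(\<exists>s\<in>S. l \<le> s \<and> s < u) \<longleftrightarrow> (\<exists>s\<in>T. l \<le> s \<and> s < (u :: int))"
  using assms by blast

text \<open>All windows of positions in one block start at the same point left of it. If a bead lies
  between that point and the block, neither block changes; if not, insertion deletes the first bead
  of the block from both sets, and with it any difference between them.\<close>

lemma block_wise_ins_outside:
  assumes E: "E > 0" and d: "0 \<le> d" and rel: "block_wise E y d S T" and u: "\<not> in_block E y d u"
  shows "block_wise E y d (ins E S u) (ins E T u)"
proof -
  have lo: "prev_pos E u x \<le> a" if "E dvd (a - y)" "prev_pos E u x \<le> a + d" for a x
    using not_in_block_cong[OF u prev_pos_dvd, of x] that unfolding in_block_def by (meson linear)
  have out: "x \<in> ins E S u \<longleftrightarrow> x \<in> ins E T u" if x: "\<not> in_block E y d x" for x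
  proof -
    have "a + d < x" if "E dvd (a - y)" "a < x" for a using not_in_blockD(1)[OF x that(1)] that by simp
    from block_wise_interval[OF rel d lo this] show ?thesis
      using rel x unfolding ins_def block_wise_def by auto
  qed
  have "block_rel d a (ins E S u) (ins E T u)" if a: "E dvd (a - y)" for a
  proof -
    have nc: "\<not> E dvd (x - u)" if "a \<le> x" "x \<le> a + d" for x
      using not_in_block_cong[OF u, of x] that a unfolding in_block_def by blast
    have hi: "b + d < a" if "E dvd (b - y)" "b < a" "d < E" for b
      using cong_gap[OF cong_trans[OF that(1) cong_sym[OF a]]] that by linarith
    \<comment> \<open>Blocks with \<open>d \<ge> E\<close> would cover all integers and leave no
      room for \<open>u\<close>.\<close>
    have dE: "d < E"
    proof (rule ccontr)
      assume "\<not> d < E"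
      moreover have "u - (u - y) mod E - y = E * ((u - y) div E)"
        using minus_mod_eq_mult_div[of "u - y" E] by simp
      ultimately have "in_block E y d u" unfolding in_block_def
        using pos_mod_bound[OF E, of "u - y"] pos_mod_sign[OF E, of "u - y"]
        by (intro exI[of _ "u - (u - y) mod E"]) auto
      thus False using u by simp
    qed
    define P where "P \<longleftrightarrow> (\<exists>s\<in>S. prev_pos E u a \<le> s \<and> s < a)"
    have PT: "P \<longleftrightarrow> (\<exists>s\<in>T. prev_pos E u a \<le> s \<and> s < a)"
      unfolding P_def by (rule block_wise_interval[OF rel d lo hi]) (use dE in auto)
    have pa: "prev_pos E u a < a" by (rule prev_pos_less[OF E])
    have inS: "x \<in> ins E S u \<longleftrightarrow> x \<in> S \<and> (P \<or> (\<exists>s\<in>S. a \<le> s \<and> s < x))"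
      if x: "a \<le> x" "x \<le> a + d" for x
      unfolding ins_iff_other[OF E nc[OF x]] prev_pos_block[OF E u a x] P_def
      using ex_interval_split[OF less_imp_le[OF pa] x(1), of S] by simp
    have inT: "x \<in> ins E T u \<longleftrightarrow> x \<in> T \<and> (P \<or> (\<exists>s\<in>T. a \<le> s \<and> s < x))"
      if x: "a \<le> x" "x \<le> a + d" for x
      unfolding ins_iff_other[OF E nc[OF x]] prev_pos_block[OF E u a x] PT
      using ex_interval_split[OF less_imp_le[OF pa] x(1), of T] by simp
    have "block_rel d a S T" using rel a by (simp add: block_wise_def)
    thus ?thesis
    proof (cases rule: block_relE)
      case 1
      have "x \<in> ins E S u \<longleftrightarrow> x \<in> ins E T u" if x: "a \<le> x" "x \<le> a + d" for x
      proof -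
        have "(\<exists>s\<in>S. a \<le> s \<and> s < x) \<longleftrightarrow> (\<exists>s\<in>T. a \<le> s \<and> s < x)"
          by (rule ex_interval_cong) (use 1 x in simp)
        thus ?thesis using inS[OF x] inT[OF x] 1[OF x] by simp
      qed
      thus ?thesis unfolding block_rel_def by blast
    next
      case (2 c)
      show ?thesis
      proof (cases P)
        case True
        have eq: "x \<in> ins E S u \<longleftrightarrow> x \<in> S" "x \<in> ins E T u \<longleftrightarrow> x \<in> T" if "a \<le> x" "x \<le> a + d" for x
          using inS[OF that] inT[OF that] True by simp_all
        show ?thesis unfolding block_rel_def
          by (intro disjI2 exI[of _ c]) (use 2 d in \<open>simp add: eq\<close>)
      next
        case False
        have "x \<in> ins E S u \<longleftrightarrow> x \<in> ins E T u" if x: "a \<le> x" "x \<le> a + d" for x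
        proof (cases "x \<le> c")
          case True
          have "x \<notin> ins E S u"
          proof (cases "x = a")
            case False
            hence "x \<notin> S" using 2(6)[of x] x True by simp
            thus ?thesis using inS[OF x] by simp
          qed (use inS[OF x] False in auto)
          moreover have "\<not> (\<exists>s\<in>T. a \<le> s \<and> s < x)" using 2(5) True by fastforce
          hence "x \<notin> ins E T u" using inT[OF x] False by simp
          ultimately show ?thesis by simp
        next
          case c: False
          have "\<exists>s\<in>S. a \<le> s \<and> s < x" using 2(1,3) c by (intro bexI[of _ a]) auto
          moreover have "\<exists>s\<in>T. a \<le> s \<and> s < x" using 2(1,4) c by (intro bexI[of _ c]) auto
          moreover have "x \<in> S \<longleftrightarrow> x \<in> T" using 2(7) c x by simp
          ultimately show ?thesis using inS[OF x] inT[OF x] by simp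
        qed
        thus ?thesis unfolding block_rel_def by blast
      qed
    qed
  qed
  thus ?thesis unfolding block_wise_def using out by blast
qed

text \<open>With \<open>u\<close> on the runner of the left ends, position \<open>a\<close> is
  decided by the beads before the block alone, and a bead further right in the block survives only
  behind another bead of that block. So the displaced bead is forgotten in both sets.\<close>

lemma block_wise_ins_merge:
  assumes E: "E > 0" and d: "0 < d" "d < E" and rel: "block_wise E y d S T" and u: "E dvd (u - y)"
  shows "ins E S u = ins E T u"
proof (rule set_eqI)
  fix x
  have cu: "E dvd (a - y)" if "E dvd (a - u)" for a using cong_trans[OF that u] .
  have gap: "a + d < b" if "E dvd (a - y)" "E dvd (b - y)" "a < b" for a b
    using cong_gap[OF cong_trans[OF that(1) cong_sym[OF that(2)]] that(3)] d by linarith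
  have lo: "b \<le> a" if "E dvd (a - y)" "E dvd (b - y)" "b \<le> a + d" for a b
    using gap[OF that(1,2)] that by force
  show "x \<in> ins E S u \<longleftrightarrow> x \<in> ins E T u"
  proof (cases "E dvd (x - u)")
    case True
    have xe: "E dvd (x - E - y)" using cu[OF True] by simp
    have "(\<exists>s\<in>S. x - E \<le> s \<and> s < x) \<longleftrightarrow> (\<exists>s\<in>T. x - E \<le> s \<and> s < x)"
      by (rule block_wise_interval[OF rel])
        (use d lo[OF _ xe] gap[OF _ cu[OF True]] in auto)
    thus ?thesis using True E by (simp add: ins_iff_same)
  next
    case False
    define a where "a = prev_pos E u x"
    have a: "E dvd (a - y)" "a < x" "x \<le> a + E"
      using cu[OF prev_pos_dvd] prev_pos_less[OF E, of u x] prev_pos_ge[OF E, of x u] by (auto simp: a_def)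
    have "x \<noteq> a + E" using False prev_pos_dvd[of E u x] cong_shift(2)[of E a u] unfolding a_def by metis
    hence ax: "x < a + E" using a by simp
    have bl: "block_rel d a S T" using rel a by (simp add: block_wise_def)
    have "(x \<in> S \<and> (\<exists>s\<in>S. a \<le> s \<and> s < x)) \<longleftrightarrow> (x \<in> T \<and> (\<exists>s\<in>T. a \<le> s \<and> s < x))"
    proof (cases "x \<le> a + d")
      case True
      show ?thesis using bl
      proof (cases rule: block_relE)
        case 1
        have "(\<exists>s\<in>S. a \<le> s \<and> s < x) \<longleftrightarrow> (\<exists>s\<in>T. a \<le> s \<and> s < x)"
          by (rule ex_interval_cong) (use 1 True in simp)
        thus ?thesis using 1[of x] a True by simp
      next
        case (2 c)
        show ?thesis
        proof (cases "x \<le> c")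
          case True
          moreover have "x \<notin> S" using 2(6)[of x] a True by simp
          moreover have "\<not> (\<exists>s\<in>T. a \<le> s \<and> s < x)" using 2(5) True by fastforce
          ultimately show ?thesis by simp
        next
          case False
          have "\<exists>s\<in>S. a \<le> s \<and> s < x" using 2(1,3) False by (intro bexI[of _ a]) auto
          moreover have "\<exists>s\<in>T. a \<le> s \<and> s < x" using 2(1,4) False by (intro bexI[of _ c]) auto
          ultimately show ?thesis using 2(7)[of x] False True by simp
        qed
      qed
    next
      case False
      hence nx: "\<not> in_block E y d x" using in_block_right[OF E _ a(1)] a ax d by fastforce
      have hi: "b + d < x" if "E dvd (b - y)" "b < x" for b using not_in_blockD(1)[OF nx that(1)] that by simp
      have "(\<exists>s\<in>S. a \<le> s \<and> s < x) \<longleftrightarrow> (\<exists>s\<in>T. a \<le> s \<and> s < x)"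
        by (rule block_wise_interval[OF rel]) (use d lo[OF _ a(1)] hi in auto)
      thus ?thesis using rel nx by (simp add: block_wise_def)
    qed
    thus ?thesis using False by (simp add: ins_iff_other[OF E] a_def)
  qed
qed

section \<open>Blocks with occupied right end, and runs that differ in one bead\<close>

definition right_closed :: "int \<Rightarrow> int \<Rightarrow> int \<Rightarrow> int set \<Rightarrow> bool" where
  "right_closed E y d S \<longleftrightarrow> (\<forall>a x. E dvd (a - y) \<longrightarrow> x \<in> S \<longrightarrow> a \<le> x \<longrightarrow> x \<le> a + d \<longrightarrow> a + d \<in> S)"

lemma right_closedD: "right_closed E y d S \<Longrightarrow> E dvd (a - y) \<Longrightarrow> x \<in> S \<Longrightarrow> a \<le> x \<Longrightarrow> x \<le> a + d \<Longrightarrow> a + d \<in> S"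
  unfolding right_closed_def by blast

lemma least_int_in:
  assumes "s \<in> S" "a \<le> s" "s \<le> (b :: int)"
  obtains c where "c \<in> S" "a \<le> c" "c \<le> b" "\<And>x. a \<le> x \<Longrightarrow> x < c \<Longrightarrow> x \<notin> S"
proof -
  let ?F = "{x \<in> S. a \<le> x \<and> x \<le> b}"
  have fin: "finite ?F" by (rule finite_subset[of _ "{a..b}"]) auto
  have "?F \<noteq> {}" using assms by blast
  hence m: "Min ?F \<in> ?F" by (rule Min_in[OF fin])
  have low: "x \<notin> S" if "a \<le> x" "x < Min ?F" for x
  proof
    assume "x \<in> S"
    hence "x \<in> ?F" using that m by simp
    from Min_le[OF fin this] show False using that by simp
  qed
  show thesis
  proof (rule that)
    show "Min ?F \<in> S" "a \<le> Min ?F" "Min ?F \<le> b" using m by simp_all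
  qed (rule low)
qed

text \<open>Where the block of \<open>S\<close> is empty, the insertions can only occupy its left or
  its right end, under equivalent conditions. Where it is occupied, \<open>a + d\<close> and by
  flushness \<open>a + d - E\<close> are beads, so inserting \<open>y + d\<close> leaves the block
  as it is, while inserting \<open>y\<close> occupies \<open>a\<close> and deletes the first bead if
  that lay right of \<open>a\<close>.\<close>

lemma block_wise_start:
  assumes E: "E > 0" and d: "0 < d" "d < E" and fl: "flush E S" and le: "S \<subseteq> {..<y}"
    and rc: "right_closed E y d S"
  shows "block_wise E y d (ins E S y) (ins E S (y + d))"
proof -
  have gap: "b \<le> a - E" if "E dvd (a - y)" "E dvd (b - y)" "b < a" for a b
    using cong_gap[OF cong_trans[OF that(2) cong_sym[OF that(1)]] that(3)] .
  have rd: "E dvd (a + d - (y + d)) \<longleftrightarrow> E dvd (a - y)" for a by simp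
  have out: "x \<in> ins E S y \<longleftrightarrow> x \<in> ins E S (y + d)" if x: "\<not> in_block E y d x" for x
  proof -
    define a where "a = prev_pos E y x"
    have a: "E dvd (a - y)" "a < x" "x \<le> a + E"
      using prev_pos_dvd prev_pos_less[OF E, of y x] prev_pos_ge[OF E, of x y] by (auto simp: a_def)
    have adx: "a + d < x" using not_in_blockD(1)[OF x a(1)] a by simp
    have n1: "\<not> E dvd (x - y)" using not_in_blockD(1)[OF x, of x] d by auto
    have n2: "\<not> E dvd (x - (y + d))"
      using not_in_blockD(2)[OF x, of "x - d"] d by (auto simp: algebra_simps)
    have p2: "prev_pos E (y + d) x = a + d"
      by (rule prev_pos_eq[OF E]) (use a adx d rd in auto)
    \<comment> \<open>The two windows start at the two ends of a block. A bead in this block counts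
      for both, since \<open>a + d\<close> is then occupied.\<close>
    have "(\<exists>s\<in>S. a \<le> s \<and> s < x) \<longleftrightarrow> (\<exists>s\<in>S. a + d \<le> s \<and> s < x)"
    proof
      assume "\<exists>s\<in>S. a \<le> s \<and> s < x"
      then obtain s where s: "s \<in> S" "a \<le> s" "s < x" by blast
      show "\<exists>s\<in>S. a + d \<le> s \<and> s < x"
      proof (cases "s \<le> a + d")
        case True
        thus ?thesis using right_closedD[OF rc a(1) s(1,2)] adx by blast
      qed (use s in \<open>auto intro!: bexI[of _ s]\<close>)
    next
      assume "\<exists>s\<in>S. a + d \<le> s \<and> s < x"
      then obtain s where "s \<in> S" "a + d \<le> s" "s < x" by blast
      thus "\<exists>s\<in>S. a \<le> s \<and> s < x" using d by (intro bexI[of _ s]) auto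
    qed
    thus ?thesis unfolding ins_iff_other[OF E n1] ins_iff_other[OF E n2] p2 a_def[symmetric] by simp
  qed
  have "block_rel d a (ins E S y) (ins E S (y + d))" if a: "E dvd (a - y)" for a
  proof -
    have nd: "\<not> E dvd (x - y)" if "a < x" "x \<le> a + d" for x
    proof
      assume "E dvd (x - y)"
      from gap[OF this a that(1)] show False using that d by simp
    qed
    have nd2: "\<not> E dvd (x - (y + d))" if "a \<le> x" "x < a + d" for x
    proof
      assume "E dvd (x - (y + d))"
      hence "E dvd (x - d - y)" by (simp add: diff_diff_add add.commute)
      from gap[OF a this] show False using that d by simp
    qed
    have px: "prev_pos E y x = a" if "a < x" "x \<le> a + d" for x
      by (rule prev_pos_eq[OF E]) (use a that d in auto)
    have px2: "prev_pos E (y + d) x = a + d - E" if "a \<le> x" "x < a + d" for x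
    proof (rule prev_pos_eq[OF E])
      show "E dvd (a + d - E - (y + d))" using a rd unfolding cong_shift by simp
    qed (use that d in auto)
    have A: "a \<in> ins E S y \<longleftrightarrow> a \<le> y \<and> (\<exists>s\<in>S. a - E \<le> s \<and> s < a)"
      by (rule ins_iff_same[OF E a])
    have B: "x \<in> ins E S y \<longleftrightarrow> x \<in> S \<and> (\<exists>s\<in>S. a \<le> s \<and> s < x)" if "a < x" "x \<le> a + d" for x
      using ins_iff_other[OF E nd[OF that], of S] px[OF that] by simp
    have C: "a + d \<in> ins E S (y + d) \<longleftrightarrow> a \<le> y \<and> (\<exists>s\<in>S. a + d - E \<le> s \<and> s < a + d)"
      using ins_iff_same[OF E, of "a + d" "y + d" S] rd a by simp
    have D: "x \<in> ins E S (y + d) \<longleftrightarrow> x \<in> S \<and> (\<exists>s\<in>S. a + d - E \<le> s \<and> s < x)" if "a \<le> x" "x < a + d" for x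
      using ins_iff_other[OF E nd2[OF that], of S] px2[OF that] by simp
    show ?thesis
    proof (cases "\<exists>x\<in>S. a \<le> x \<and> x \<le> a + d")
      case False
      have "(\<exists>s\<in>S. a - E \<le> s \<and> s < a) \<longleftrightarrow> (\<exists>s\<in>S. a + d - E \<le> s \<and> s < a + d)"
      proof
        assume "\<exists>s\<in>S. a - E \<le> s \<and> s < a"
        then obtain s where s: "s \<in> S" "a - E \<le> s" "s < a" by blast
        show "\<exists>s\<in>S. a + d - E \<le> s \<and> s < a + d"
        proof (cases "s \<le> a - E + d")
          case True
          have "a - E + d \<in> S" using right_closedD[OF rc _ s(1,2) True] a by simp
          thus ?thesis using E by (intro bexI[of _ "a - E + d"]) auto
        qed (use s d in \<open>auto intro!: bexI[of _ s]\<close>)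
      next
        assume "\<exists>s\<in>S. a + d - E \<le> s \<and> s < a + d"
        then obtain s where s: "s \<in> S" "a + d - E \<le> s" "s < a + d" by blast
        hence "s < a" using False by (meson linorder_not_le less_imp_le)
        thus "\<exists>s\<in>S. a - E \<le> s \<and> s < a" using s d by (intro bexI[of _ s]) auto
      qed
      hence AC: "a \<in> ins E S y \<longleftrightarrow> a + d \<in> ins E S (y + d)" using A C by simp
      have B0: "x \<notin> ins E S y" if "a < x" "x \<le> a + d" for x
        using B[OF that] False that by (meson less_imp_le)
      have D0: "x \<notin> ins E S (y + d)" if "a \<le> x" "x < a + d" for x
        using D[OF that] False that by (meson less_imp_le)
      show ?thesis
      proof (cases "a \<in> ins E S y")
        case True
        hence ad: "a + d \<in> ins E S (y + d)" using AC by simp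
        show ?thesis unfolding block_rel_def
        proof (intro disjI2 exI[of _ "a + d"] conjI allI impI)
          show "a \<in> ins E S y" by (rule True)
          show "a + d \<in> ins E S (y + d)" by (rule ad)
          show "x \<notin> ins E S (y + d)" if "a \<le> x \<and> x < a + d" for x using D0 that by simp
          show "x \<notin> ins E S y" if "a < x \<and> x \<le> a + d" for x using B0 that by simp
          show "x \<in> ins E S y \<longleftrightarrow> x \<in> ins E S (y + d)" if "a + d < x \<and> x \<le> a + d" for x
            using that by linarith
        qed (use d in simp_all)
      next
        case False
        have "x \<notin> ins E S y \<and> x \<notin> ins E S (y + d)" if "a \<le> x" "x \<le> a + d" for x
        proof
          show "x \<notin> ins E S y" using False B0[of x] that by (cases "x = a") simp_all
          show "x \<notin> ins E S (y + d)" using False AC D0[of x] that by (cases "x = a + d") simp_all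
        qed
        thus ?thesis unfolding block_rel_def by blast
      qed
    next
      case True
      then obtain x0 where x0: "x0 \<in> S" "a \<le> x0" "x0 \<le> a + d" by blast
      have ad: "a + d \<in> S" by (rule right_closedD[OF rc a x0])
      have ade: "a + d - E \<in> S" by (rule flushD[OF fl ad])
      have ay: "a \<le> y" using ad le d by auto
      have aS: "a \<in> ins E S y" unfolding A
        using ay d by (intro conjI bexI[OF _ ade]) simp_all
      have T: "x \<in> ins E S (y + d) \<longleftrightarrow> x \<in> S" if "a \<le> x" "x \<le> a + d" for x
      proof (cases "x = a + d")
        case True
        have "\<exists>s\<in>S. a + d - E \<le> s \<and> s < a + d" using E by (intro bexI[OF _ ade]) simp
        thus ?thesis using C ay ad True by simp
      next
        case False
        have "\<exists>s\<in>S. a + d - E \<le> s \<and> s < x" using that d by (intro bexI[OF _ ade]) simp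
        thus ?thesis using D[of x] that False by simp
      qed
      show ?thesis
      proof (cases "a \<in> S")
        case True
        have "x \<in> ins E S y \<longleftrightarrow> x \<in> ins E S (y + d)" if "a \<le> x" "x \<le> a + d" for x
        proof (cases "x = a")
          case True
          thus ?thesis using T[OF that] aS \<open>a \<in> S\<close> by simp
        next
          case False
          hence ax: "a < x" using that by simp
          have "\<exists>s\<in>S. a \<le> s \<and> s < x" using True ax by blast
          hence "x \<in> ins E S y \<longleftrightarrow> x \<in> S" using B[OF ax that(2)] by simp
          thus ?thesis using T[OF that] by simp
        qed
        thus ?thesis unfolding block_rel_def by blast
      next
        case False
        obtain c where c: "c \<in> S" "a \<le> c" "c \<le> a + d" "\<And>x. a \<le> x \<Longrightarrow> x < c \<Longrightarrow> x \<notin> S"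
          using least_int_in[OF x0] by metis
        have "c \<noteq> a" using c False by auto
        hence weak_above_ok: "a < c" using c by simp
        have B1: "x \<notin> ins E S y" if "a < x" "x \<le> c" for x
        proof -
          have "\<not> (\<exists>s\<in>S. a \<le> s \<and> s < x)" using c(4) that by fastforce
          thus ?thesis using B[of x] that c(3) by simp
        qed
        have B2: "x \<in> ins E S y \<longleftrightarrow> x \<in> ins E S (y + d)" if "c < x" "x \<le> a + d" for x
        proof -
          have "\<exists>s\<in>S. a \<le> s \<and> s < x" using that c(1,2) by blast
          hence "x \<in> ins E S y \<longleftrightarrow> x \<in> S" using B[of x] that weak_above_ok by simp
          thus ?thesis using T[of x] that weak_above_ok by simp
        qed
        show ?thesis unfolding block_rel_def
        proof (intro disjI2 exI[of _ c] conjI allI impI)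
          show "c \<in> ins E S (y + d)" using T c by simp
          show "x \<notin> ins E S (y + d)" if "a \<le> x \<and> x < c" for x using T[of x] c that by simp
          show "x \<notin> ins E S y" if "a < x \<and> x \<le> c" for x using B1 that by simp
          show "x \<in> ins E S y \<longleftrightarrow> x \<in> ins E S (y + d)" if "c < x \<and> x \<le> a + d" for x
            using B2 that by simp
        qed (use weak_above_ok c aS in simp_all)
      qed
    qed
  qed
  thus ?thesis unfolding block_wise_def using out by blast
qed

text \<open>A bead that survives in a block has a predecessor at or after \<open>a + d - E\<close>,
  which is just what position \<open>a + d\<close> needs to become occupied. So one insertion at a
  right end establishes the property for any \<open>S\<close> below \<open>u\<close>.\<close>

lemma right_closed_ins_right:
  assumes E: "E > 0" and d: "0 < d" "d < E" and le: "S \<subseteq> {..<u}" and u: "E dvd (u - (y + d))"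
  shows "right_closed E y d (ins E S u)"
  unfolding right_closed_def
proof (intro allI impI)
  fix a x assume a: "E dvd (a - y)" and x: "x \<in> ins E S u" "a \<le> x" "x \<le> a + d"
  have au: "E dvd (a + d - u)" using cong_trans[OF _ cong_sym[OF u], of "a + d"] a by simp
  show "a + d \<in> ins E S u"
  proof (cases "x = a + d")
    case False
    have nx: "\<not> E dvd (x - u)"
    proof
      assume "E dvd (x - u)"
      from cong_gap[OF cong_trans[OF this cong_sym[OF au]]] show False using x False d by simp
    qed
    have p: "prev_pos E u x = a + d - E"
      by (rule prev_pos_eq[OF E]) (use au x False d in auto)
    from x(1) obtain s where s: "x \<in> S" "s \<in> S" "a + d - E \<le> s" "s < x"
      unfolding ins_iff_other[OF E nx] p by blast
    have "a + d \<le> u" using cong_gap[OF cong_sym[OF au]] s(1) le x d by force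
    thus ?thesis using ins_iff_same[OF E au] s x by auto
  qed (use x in simp)
qed

lemma right_closed_ins_outside:
  assumes E: "E > 0" and d: "0 \<le> d" and rc: "right_closed E y d S" and u: "\<not> in_block E y d u"
  shows "right_closed E y d (ins E S u)"
  unfolding right_closed_def
proof (intro allI impI)
  fix a x assume a: "E dvd (a - y)" and x: "x \<in> ins E S u" "a \<le> x" "x \<le> a + d"
  have nc: "\<not> E dvd (z - u)" if "a \<le> z" "z \<le> a + d" for z
    using not_in_block_cong[OF u, of z] that a unfolding in_block_def by blast
  have p: "prev_pos E u x = prev_pos E u a" "prev_pos E u (a + d) = prev_pos E u a"
    by (rule prev_pos_block[OF E u a]; use x d in simp)+
  have nx: "\<not> E dvd (x - u)" "\<not> E dvd (a + d - u)" using nc x d by auto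
  show "a + d \<in> ins E S u"
  proof -
    obtain s where s: "x \<in> S" "s \<in> S" "prev_pos E u a \<le> s" "s < x"
      using x(1) unfolding ins_iff_other[OF E nx(1)] p by blast
    have "a + d \<in> S" by (rule right_closedD[OF rc a s(1) x(2,3)])
    moreover have "s < a + d" using s x by simp
    ultimately show ?thesis unfolding ins_iff_other[OF E nx(2)] p using s by blast
  qed
qed

lemma ins_upto_block_wise:
  assumes E: "E > 0" and d: "0 \<le> d" and rel: "block_wise E y d (ins_upto E J N n0) (ins_upto E K N n0)"
    and "n0 \<le> n" and eq: "\<And>t. N + int n0 < t \<Longrightarrow> t \<le> N + int n \<Longrightarrow> t \<in> J \<longleftrightarrow> t \<in> K"
    and out: "\<And>t. N + int n0 < t \<Longrightarrow> t \<le> N + int n \<Longrightarrow> t \<in> J \<Longrightarrow> \<not> in_block E y d t"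
  shows "block_wise E y d (ins_upto E J N n) (ins_upto E K N n)"
  using \<open>n0 \<le> n\<close> eq out
proof (induction n rule: dec_induct)
  case base then show ?case using rel by simp
next
  case (step n)
  have IH: "block_wise E y d (ins_upto E J N n) (ins_upto E K N n)"
    by (rule step.IH) (use step.prems in auto)
  show ?case using block_wise_ins_outside[OF E d IH] step.prems(1,2)[of "N + 1 + int n"] step.hyps IH
    by (auto simp: Let_def)
qed

text \<open>The last bead of \<open>J\<close> in a block decides: inserted at a right end it creates
  the property, and later insertions off the blocks keep it.\<close>

lemma ins_upto_right_closed:
  assumes E: "E > 0" and d: "0 < d" "d < E" and r: "r \<in> J" "E dvd (r - (y + d))" "N < r" "r \<le> N + int n"
    and out: "\<And>t. r < t \<Longrightarrow> t \<le> N + int n \<Longrightarrow> t \<in> J \<Longrightarrow> \<not> in_block E y d t"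
  shows "right_closed E y d (ins_upto E J N n)"
proof -
  define n0 where "n0 = nat (r - N - 1)"
  have n0: "N + 1 + int n0 = r" "Suc n0 \<le> n" using r by (auto simp: n0_def)
  from n0(2) out show ?thesis
  proof (induction n rule: dec_induct)
    case base
    have "ins_upto E J N n0 \<subseteq> {..<r}" using ins_upto_less[of E J N n0] n0 by simp
    thus ?case using right_closed_ins_right[OF E d _ r(2)] n0 r by (auto simp: Let_def)
  next
    case (step n)
    have IH: "right_closed E y d (ins_upto E J N n)"
      by (rule step.IH) (use step.prems in auto)
    show ?case using right_closed_ins_outside[OF E _ IH] step.prems[of "N + 1 + int n"] step.hyps IH d n0
      by (auto simp: Let_def)
  qed
qed

text \<open>The runs coincide up to \<open>y - 1\<close>, and no other bead lies between
  \<open>y\<close> and \<open>y + d\<close>. So they first part by inserting \<open>y\<close>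
  against \<open>y + d\<close>, and later insertions off the blocks keep the relation.\<close>

lemma ins_upto_shift:
  assumes E: "E > 0" and d: "0 < d" "d < E" and N: "N < y"
    and rc: "\<And>n. N + int n = y - 1 \<Longrightarrow> right_closed E y d (ins_upto E J N n)"
    and eq: "\<And>t. t \<noteq> y \<Longrightarrow> t \<noteq> y + d \<Longrightarrow> t \<in> J \<longleftrightarrow> t \<in> K"
    and yd: "y \<in> J" "y + d \<notin> J" "y \<notin> K" "y + d \<in> K"
    and emp: "\<And>t. y < t \<Longrightarrow> t < y + d \<Longrightarrow> t \<notin> J"
    and n: "y + d \<le> N + int n"
    and out: "\<And>t. y + d < t \<Longrightarrow> t \<le> N + int n \<Longrightarrow> t \<in> J \<Longrightarrow> \<not> in_block E y d t"
  shows "block_wise E y d (ins_upto E J N n) (ins_upto E K N n)"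
proof -
  define n0 where "n0 = nat (y - 1 - N)"
  define n1 where "n1 = nat (y + d - 1 - N)"
  have n0: "N + int n0 = y - 1" using N by (simp add: n0_def)
  have n1: "N + int n1 = y + d - 1" "n0 \<le> n1" "Suc n0 \<le> Suc n1" "Suc n1 \<le> n"
    using N d n by (auto simp: n1_def n0_def)
  let ?S = "ins_upto E J N n0"
  have SK: "ins_upto E K N n0 = ?S"
    by (rule ins_upto_agree) (use eq n0 d in auto)
  have empK: "t \<notin> K" if "y \<le> t" "t < y + d" for t
    using emp[of t] eq[of t] yd(3) that by (cases "t = y") auto
  have empJ: "t \<notin> J" if "y < t" "t \<le> y + d" for t
    using emp[of t] yd(2) that by (cases "t = y + d") auto
  have "ins_upto E J N (Suc n1) = ins_upto E J N (Suc n0)"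
    by (rule ins_upto_skip[OF n1(3)], rule empJ) (use n0 n1 in auto)
  also have "\<dots> = ins E ?S y" using n0 yd by (simp add: Let_def add.commute add.left_commute)
  finally have J1: "ins_upto E J N (Suc n1) = ins E ?S y" .
  have "ins_upto E K N n1 = ins_upto E K N n0"
    by (rule ins_upto_skip[OF n1(2)], rule empK) (use n0 n1 in auto)
  hence K1: "ins_upto E K N (Suc n1) = ins E ?S (y + d)" using n1 yd SK
    by (simp add: Let_def add.commute add.left_commute)
  have "?S \<subseteq> {..<y}" using ins_upto_le[of E J N n0] n0 by auto
  from block_wise_start[OF E d ins_upto_flush[OF E] this rc[OF n0]]
  have "block_wise E y d (ins_upto E J N (Suc n1)) (ins_upto E K N (Suc n1))"
    unfolding J1 K1 .
  thus ?thesis by (rule ins_upto_block_wise[OF E less_imp_le[OF d(1)] _ n1(4)]) (use n1 eq out d in auto)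
qed

text \<open>The first bead in a block after the move is \<open>z\<close>, at a left end. Its
  insertion wipes out the difference, and from there on both runs insert the same beads into the
  same set.\<close>

lemma ins_upto_merge:
  assumes E: "E > 0" and d: "0 < d" "d < E" and N: "N < y"
    and rc: "\<And>n. N + int n = y - 1 \<Longrightarrow> right_closed E y d (ins_upto E J N n)"
    and eq: "\<And>t. t \<noteq> y \<Longrightarrow> t \<noteq> y + d \<Longrightarrow> t \<in> J \<longleftrightarrow> t \<in> K"
    and yd: "y \<in> J" "y + d \<notin> J" "y \<notin> K" "y + d \<in> K"
    and emp: "\<And>t. y < t \<Longrightarrow> t < y + d \<Longrightarrow> t \<notin> J"
    and z: "E dvd (z - y)" "y < z" "z \<in> J" "z \<le> N + int n"
    and out: "\<And>t. y + d < t \<Longrightarrow> t < z \<Longrightarrow> t \<in> J \<Longrightarrow> \<not> in_block E y d t"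
  shows "ins_upto E J N n = ins_upto E K N n"
proof -
  define m where "m = nat (z - 1 - N)"
  have zy: "y + E \<le> z" using cong_gap[OF cong_sym[OF z(1)] z(2)] by simp
  have m: "N + int m = z - 1" "Suc m \<le> n" using N z by (auto simp: m_def)
  have "block_wise E y d (ins_upto E J N m) (ins_upto E K N m)"
    by (rule ins_upto_shift[OF E d N rc eq yd emp]) (use m zy d out in auto)
  from block_wise_ins_merge[OF E d this z(1)]
  have "ins_upto E J N (Suc m) = ins_upto E K N (Suc m)"
    using m z eq[of z] zy d by (simp add: Let_def add.commute add.left_commute)
  thus ?thesis by (rule ins_upto_cong[OF _ m(2)]) (use m eq zy d in auto)
qed

section \<open>The base\<close>

text \<open>The bead \<open>y + d - E\<close> at a right end prepares the move, and the bead
  \<open>y + E\<close> at the next left end absorbs it; no position between either of them and the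
  moved bead lies in a block.\<close>

lemma ins_upto_jump:
  assumes E: "E > 0" and d: "0 < d" "d < E"
    and eq: "\<And>t. t \<noteq> y \<Longrightarrow> t \<noteq> y + d \<Longrightarrow> t \<in> J \<longleftrightarrow> t \<in> K"
    and yd: "y \<in> J" "y + d \<notin> J" "y \<notin> K" "y + d \<in> K"
    and emp: "\<And>t. y < t \<Longrightarrow> t < y + d \<Longrightarrow> t \<notin> J"
    and up: "y + E \<in> J" "y + E \<le> N + int n" and dn: "y + d - E \<in> J" "N < y + d - E"
  shows "ins_upto E J N n = ins_upto E K N n"
proof (rule ins_upto_merge[OF E d _ _ eq yd emp _ _ up])
  have nb: "\<not> in_block E y d t" if "y + d < t" "t < y + E" for t
  proof
    assume "in_block E y d t"
    then obtain a where a: "E dvd (a - y)" "a \<le> t" "t \<le> a + d" by (auto simp: in_block_def)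
    hence "y < a" using that by simp
    thus False using cong_gap[OF cong_sym[OF a(1)]] a that by simp
  qed
  show "right_closed E y d (ins_upto E J N m)" if "N + int m = y - 1" for m
  proof (rule ins_upto_right_closed[OF E d dn(1) _ dn(2)])
    fix t assume t: "y + d - E < t" "t \<le> N + int m"
    show "\<not> in_block E y d t"
    proof
      assume "in_block E y d t"
      then obtain a where a: "E dvd (a - y)" "a \<le> t" "t \<le> a + d" by (auto simp: in_block_def)
      hence "a \<le> y - E" using t that by (intro cong_gap) auto
      thus False using a t by simp
    qed
  qed (use that d in auto)
  show "\<not> in_block E y d t" if "y + d < t" "t < y + E" for t using nb that .
qed (use d dn E in auto)

lemma prev_pos_cong: "prev_pos E (t - E) x = prev_pos E t x"
proof -
  have "(x - 1 - (t - E)) mod E = (x - 1 - t) mod E"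
    using mod_add_self2[of "x - 1 - t" E] by (simp add: algebra_simps)
  thus ?thesis by (simp add: prev_pos_def)
qed

text \<open>The windows depend only on the class of \<open>t\<close>, and \<open>t\<close> itself
  stays empty because no bead of \<open>S\<close> reaches its window.\<close>

lemma ins_slide:
  assumes E: "E > 0" and S: "S \<subseteq> {..<t - E}"
  shows "ins E S (t - E) = ins E S t"
proof (rule set_eqI)
  fix x
  show "x \<in> ins E S (t - E) \<longleftrightarrow> x \<in> ins E S t"
  proof (cases "E dvd (x - t)")
    case True
    have "x \<le> t - E" if "x \<le> t" "s \<in> S" "x - E \<le> s" for s
    proof (cases "x = t")
      case True thus ?thesis using that S by force
    qed (use cong_gap[OF True] that in simp)
    thus ?thesis using True E by (auto simp: ins_iff_same)
  next
    case False
    thus ?thesis using ins_iff_other[OF E, of x t S] ins_iff_other[OF E, of x "t - E" S]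
      by (simp add: prev_pos_cong)
  qed
qed

lemma ins_upto_slide:
  assumes E: "E > 0" and p: "p \<in> J" "N < p - E" "p \<le> N + int n"
    and emp: "\<And>t. p - E \<le> t \<Longrightarrow> t < p \<Longrightarrow> t \<notin> J"
  shows "ins_upto E (J - {p} \<union> {p - E}) N n = ins_upto E J N n"
proof -
  let ?K = "J - {p} \<union> {p - E}"
  define m where "m = nat (p - E - 1 - N)"
  define k where "k = nat (p - 1 - N)"
  have m: "N + int m = p - E - 1" using p by (simp add: m_def)
  have k: "N + int k = p - 1" "m \<le> k" "Suc m \<le> Suc k" "Suc k \<le> n" using p E by (auto simp: k_def m_def)
  let ?S = "ins_upto E J N m"
  have empK: "t \<notin> ?K" if "p - E < t" "t \<le> p" for t
    using emp[of t] that by (cases "t = p") auto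
  have "ins_upto E ?K N m = ?S" by (rule ins_upto_agree) (use m E in auto)
  moreover have "N + 1 + int m = p - E" using m by simp
  ultimately have "ins_upto E ?K N (Suc m) = ins E ?S (p - E)" by (simp add: Let_def)
  moreover have "ins_upto E ?K N (Suc k) = ins_upto E ?K N (Suc m)"
    by (rule ins_upto_skip[OF k(3)], rule empK) (use m k in auto)
  ultimately have 1: "ins_upto E ?K N (Suc k) = ins E ?S (p - E)" by simp
  have "ins_upto E J N k = ?S"
    by (rule ins_upto_skip[OF k(2)]) (use m k emp in auto)
  moreover have "N + 1 + int k = p" using k by simp
  ultimately have "ins_upto E J N (Suc k) = ins E ?S p" using p by (simp add: Let_def)
  moreover have "?S \<subseteq> {..<p - E}" using ins_upto_le[of E J N m] m by auto
  ultimately have "ins_upto E ?K N (Suc k) = ins_upto E J N (Suc k)" using 1 ins_slide[OF E] by simp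
  thus ?thesis by (rule ins_upto_cong[OF _ k(4)]) (use k E in auto)
qed

lemma U_set_empty_iff: "U_set e J = {} \<longleftrightarrow> flush (int e) J"
  by (auto simp: U_set_def flush_def)

lemma finite_U_set:
  assumes "{..N} \<subseteq> J" "J \<subseteq> {..M}" shows "finite (U_set e J)"
proof (rule finite_subset)
  show "U_set e J \<subseteq> {N..M + int e}"
  proof
    fix x assume x: "x \<in> U_set e J"
    have "\<not> x - int e \<le> N" using x assms(1) by (auto simp: U_set_def)
    moreover have "x \<le> M" using x assms(2) by (auto simp: U_set_def)
    ultimately show "x \<in> {N..M + int e}" by auto
  qed
qed simp

lemma down_betaE:
  assumes e: "e > 0" and bd: "{..N} \<subseteq> J" "J \<subseteq> {..M}" and U: "U_set e J \<noteq> {}"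
  obtains p q where "p \<in> J" "p - int e \<notin> J" "\<And>x. x \<in> J \<Longrightarrow> x < p \<Longrightarrow> x - int e \<in> J"
    "q \<in> J" "p - int e < q" "q \<le> p" "\<And>x. x \<in> J \<Longrightarrow> p - int e < x \<Longrightarrow> x < q \<Longrightarrow> x + int e \<in> J"
    "down_beta e J = J - {q} \<union> {p - int e}"
proof -
  define p where "p = Min (U_set e J)"
  have fU: "finite (U_set e J)" by (rule finite_U_set[OF bd])
  have pU: "p \<in> U_set e J" unfolding p_def by (rule Min_in[OF fU U])
  have fW: "finite (W_set e J)"
    by (rule finite_subset[of _ "{p - int e..M} \<union> {p}"]) (use bd in \<open>auto simp: W_set_def p_def Let_def\<close>)
  have pW: "p \<in> W_set e J" by (simp add: W_set_def p_def Let_def)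
  define q where "q = Min (W_set e J)"
  have qW: "q \<in> W_set e J" unfolding q_def by (rule Min_in[OF fW]) (use pW in auto)
  show thesis
  proof (rule that[of p q])
    show "p \<in> J" "p - int e \<notin> J" using pU by (auto simp: U_set_def)
    show "x - int e \<in> J" if "x \<in> J" "x < p" for x
    proof (rule ccontr)
      assume "x - int e \<notin> J"
      hence "x \<in> U_set e J" using that by (simp add: U_set_def)
      hence "p \<le> x" unfolding p_def using fU by simp
      thus False using that by simp
    qed
    show "q \<in> J" "p - int e < q" using qW \<open>p \<in> J\<close> e by (auto simp: W_set_def p_def Let_def)
    show "q \<le> p" unfolding q_def using fW pW by simp
    show "x + int e \<in> J" if "x \<in> J" "p - int e < x" "x < q" for x
    proof (rule ccontr)
      assume "x + int e \<notin> J"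
      hence "x \<in> W_set e J" using that by (simp add: W_set_def p_def Let_def)
      hence "q \<le> x" unfolding q_def using fW by simp
      thus False using that by simp
    qed
    show "down_beta e J = J - {q} \<union> {p - int e}" using U by (simp add: down_beta_def p_def q_def)
  qed
qed

lemma down_beta_bounds:
  assumes e: "e > 0" and bd: "{..N} \<subseteq> J" "J \<subseteq> {..M}"
  shows "{..N} \<subseteq> down_beta e J" "down_beta e J \<subseteq> {..M}"
proof -
  have "{..N} \<subseteq> down_beta e J \<and> down_beta e J \<subseteq> {..M}"
  proof (cases "U_set e J = {}")
    case True thus ?thesis using bd by (simp add: down_beta_def)
  next
    case False
    obtain p q where pq: "p \<in> J" "p - int e \<notin> J" "p - int e < q" "down_beta e J = J - {q} \<union> {p - int e}"
      using down_betaE[OF e bd False] by metis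
    have "\<not> p - int e \<le> N" using pq(2) bd by auto
    thus ?thesis using pq bd by auto
  qed
  thus "{..N} \<subseteq> down_beta e J" "down_beta e J \<subseteq> {..M}" by auto
qed

text \<open>The move from \<open>q\<close> to \<open>h = p - E\<close> is taken apart. For the beads
  \<open>b\<close> of \<open>J\<close> between \<open>h\<close> and \<open>q\<close>, the sets with
  \<open>b\<close> replaced by \<open>h\<close> all have the same outcome: consecutive ones differ
  by a jump, whose supporting beads come from the minimality of \<open>p\<close> and of
  \<open>q\<close>. The lowest of these sets differs from \<open>J\<close> by a jump from
  \<open>h\<close>, or by a slide if \<open>b = p\<close>.\<close>

lemma ins_upto_down_beta:
  assumes e: "e > 0" and bd: "{..N + int e} \<subseteq> J" "J \<subseteq> {..M}" and n: "M \<le> N + int n"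
  shows "ins_upto (int e) (down_beta e J) N n = ins_upto (int e) J N n"
proof (cases "U_set e J = {}")
  case False
  define E where "E = int e"
  have E: "E > 0" using e by (simp add: E_def)
  obtain p q where p: "p \<in> J" "p - E \<notin> J" "\<And>x. x \<in> J \<Longrightarrow> x < p \<Longrightarrow> x - E \<in> J"
    and q: "q \<in> J" "p - E < q" "q \<le> p" "\<And>x. x \<in> J \<Longrightarrow> p - E < x \<Longrightarrow> x < q \<Longrightarrow> x + E \<in> J"
    and eq: "down_beta e J = J - {q} \<union> {p - E}"
    using down_betaE[OF e bd False] unfolding E_def by blast
  define h where "h = p - E"
  \<comment> \<open>The slack \<open>E\<close> above the floor \<open>N\<close> makes room for the
    supporting beads \<open>b - E\<close> of the jumps.\<close>
  have hN: "N + E < h" using p(2) bd(1) unfolding h_def E_def by (meson atMost_iff linorder_not_le subsetD)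
  have le: "x \<le> N + int n" if "x \<in> J" for x using that bd n by auto
  have "ins_upto E (J - {b} \<union> {h}) N n = ins_upto E J N n" if "b \<in> J" "h < b" "b \<le> q" for b
    using that
  proof (induction "nat (b - h)" arbitrary: b rule: less_induct)
    case less
    have bp: "b - E \<in> J" if "b < p" using p(3)[OF less.prems(1) that] .
    show ?case
    proof (cases "\<exists>x\<in>J. h < x \<and> x < b")
      case True
      let ?F = "{x \<in> J. h < x \<and> x < b}"
      have fin: "finite ?F" by (rule finite_subset[of _ "{h..b}"]) auto
      define c where "c = Max ?F"
      have "c \<in> ?F" unfolding c_def by (rule Max_in[OF fin]) (use True in auto)
      hence c: "c \<in> J" "h < c" "c < b" by auto
      have mx: "t \<notin> J" if "c < t" "t < b" for t
      proof
        assume "t \<in> J"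
        hence "t \<le> c" unfolding c_def using Max_ge[OF fin] that c by simp
        thus False using that by simp
      qed
      have IH: "ins_upto E (J - {c} \<union> {h}) N n = ins_upto E J N n"
        by (rule less.hyps) (use c less.prems in auto)
      have cE: "c + E \<in> J" using q(4)[OF c(1)] c less.prems by (simp add: h_def)
      \<comment> \<open>For \<open>b = p\<close> the supporting bead is the new bead
        \<open>h\<close> itself.\<close>
      have bE: "b - E \<in> J - {b} \<union> {h}"
      proof (cases "b < p")
        case True thus ?thesis using bp E by simp
      next
        case False hence "b = p" using less.prems q by simp
        thus ?thesis by (simp add: h_def)
      qed
      have bc: "c + (b - c) = b" by simp
      have "ins_upto E (J - {b} \<union> {h}) N n = ins_upto E (J - {c} \<union> {h}) N n"
      proof (rule ins_upto_jump[OF E, of "b - c" c])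
        show "b - c < E" using c less.prems q by (simp add: h_def)
        show "c + E \<in> J - {b} \<union> {h}" using cE c less.prems q by (simp add: h_def)
        show "c + E \<le> N + int n" using le[OF cE] .
        show "c + (b - c) - E \<in> J - {b} \<union> {h}" using bE by simp
        show "N < c + (b - c) - E" using hN less.prems by simp
        show "t \<notin> J - {b} \<union> {h}" if "c < t" "t < c + (b - c)" for t using mx[of t] that c by simp
      qed (use c less.prems in auto)
      thus ?thesis using IH by simp
    next
      case False
      show ?thesis
      proof (cases "b = p")
        case True
        show ?thesis unfolding True h_def
          by (rule ins_upto_slide[OF E p(1)])
            (use hN E le[OF p(1)] False True p(2) in \<open>auto simp: h_def order_le_less\<close>)
      next
        case bnp: False
        hence bp': "b < p" using less.prems q by simp
        show ?thesis
        proof (rule ins_upto_jump[OF E, of "b - h" h])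
          show "b - h < E" using bp' by (simp add: h_def)
          show "h + E \<in> J - {b} \<union> {h}" using p(1) bnp by (simp add: h_def)
          show "h + E \<le> N + int n" using le[OF p(1)] by (simp add: h_def)
          show "h + (b - h) - E \<in> J - {b} \<union> {h}" using bp[OF bp'] E by simp
          show "N < h + (b - h) - E" using hN less.prems by simp
          show "t \<notin> J - {b} \<union> {h}" if "h < t" "t < h + (b - h)" for t using False that by auto
          show "h \<notin> J" using p(2) by (simp add: h_def)
        qed (use less.prems in auto)
      qed
    qed
  qed
  from this[OF q(1)] show ?thesis using q eq by (simp add: h_def E_def)
qed (simp add: down_beta_def)

section \<open>Existence and uniqueness of the base of a set of beads\<close>

definition is_base :: "nat \<Rightarrow> int set \<Rightarrow> int set \<Rightarrow> bool" where
  "is_base e J K \<longleftrightarrow> U_set e K = {} \<and> (\<exists>k. K = (down_beta e ^^ k) J)"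

lemma down_beta_core: "U_set e K = {} \<Longrightarrow> (down_beta e ^^ k) K = K"
  by (induction k) (simp_all add: down_beta_def)

lemma is_base_unique:
  assumes "is_base e J K" "is_base e J L" shows "K = L"
proof -
  obtain k l where kl: "K = (down_beta e ^^ k) J" "L = (down_beta e ^^ l) J" "U_set e K = {}" "U_set e L = {}"
    using assms by (auto simp: is_base_def)
  have "K = (down_beta e ^^ (l + k)) J" using kl(1,3) down_beta_core[of e K l]
    by (simp add: funpow_add)
  moreover have "L = (down_beta e ^^ (k + l)) J" using kl(2,4) down_beta_core[of e L k]
    by (simp add: funpow_add)
  ultimately show ?thesis by (simp add: add.commute)
qed

text \<open>A step of \<open>down\<close> lowers a bead, so the sum of the heights above the floor
  decreases, and it does not change the outcome of the insertions. For the core reached at the end,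
  this outcome is the core itself.\<close>

lemma is_base_ins_upto:
  assumes e: "e > 0" and bd: "{..N + int e} \<subseteq> J" "J \<subseteq> {..M}" and n: "M \<le> N + int n"
  shows "is_base e J (ins_upto (int e) J N n)"
  using bd
proof (induction "\<Sum>x\<in>J \<inter> {N + int e<..}. nat (x - (N + int e))" arbitrary: J rule: less_induct)
  case less
  let ?N = "N + int e"
  show ?case
  proof (cases "U_set e J = {}")
    case True
    have "{..N} \<subseteq> J" using less.prems by auto
    from ins_upto_core[OF _ _ this, of "int e" n] True e
    have "ins_upto (int e) J N n = J \<inter> {..N + int n}" by (simp add: U_set_empty_iff)
    also have "\<dots> = J" using less.prems n by auto
    finally show ?thesis using True by (auto simp: is_base_def intro: exI[of _ 0])
  next
    case False
    obtain p q where pq: "p - int e \<notin> J" "q \<in> J" "p - int e < q" "down_beta e J = J - {q} \<union> {p - int e}"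
      using down_betaE[OF e less.prems False] by metis
    let ?h = "p - int e"
    have hN: "\<not> ?h \<le> ?N" using pq(1) less.prems(1) by (meson atMost_iff subsetD)
    have fin: "finite (J \<inter> {?N<..})"
      by (rule finite_subset[of _ "{?N..M}"]) (use less.prems in auto)
    let ?f = "\<lambda>x. nat (x - ?N)"
    have D: "down_beta e J \<inter> {?N<..} = insert ?h (J \<inter> {?N<..} - {q})" using pq hN by auto
    have "(\<Sum>x\<in>down_beta e J \<inter> {?N<..}. ?f x) = ?f ?h + (\<Sum>x\<in>J \<inter> {?N<..} - {q}. ?f x)"
      unfolding D using fin pq by (subst sum.insert) auto
    also have "\<dots> < ?f q + (\<Sum>x\<in>J \<inter> {?N<..} - {q}. ?f x)" using pq(3) hN by simp
    also have "\<dots> = (\<Sum>x\<in>J \<inter> {?N<..}. ?f x)"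
      using fin pq hN by (subst sum.remove[of _ q]) auto
    finally have lt: "(\<Sum>x\<in>down_beta e J \<inter> {?N<..}. ?f x) < (\<Sum>x\<in>J \<inter> {?N<..}. ?f x)" .
    have "is_base e (down_beta e J) (ins_upto (int e) (down_beta e J) N n)"
      by (rule less.hyps[OF lt]) (use down_beta_bounds[OF e less.prems] in auto)
    then obtain k where "U_set e (ins_upto (int e) J N n) = {}"
      "ins_upto (int e) J N n = (down_beta e ^^ k) (down_beta e J)"
      unfolding ins_upto_down_beta[OF e less.prems n] is_base_def by blast
    thus ?thesis unfolding is_base_def by (auto simp: funpow_swap1 intro!: exI[of _ "Suc k"])
  qed
qed

section \<open>The base along an edge of the crystal\<close>

text \<open>
  The levels of class \<open>c\<close> are the pairs of positions \<open>a\<close>, \<open>a + 1\<close> with \<open>a\<close> congruent to \<open>c\<close>; they are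
  neutral unless addable or removable. In \<open>above_ok\<close> and \<open>below_ok\<close> the level \<open>x\<close> itself is ignored.
\<close>
definition addable_at :: "int set \<Rightarrow> int \<Rightarrow> bool" where
  "addable_at J a \<longleftrightarrow> a \<in> J \<and> a + 1 \<notin> J"

definition removable_at :: "int set \<Rightarrow> int \<Rightarrow> bool" where
  "removable_at J a \<longleftrightarrow> a \<notin> J \<and> a + 1 \<in> J"

definition top_ok :: "int \<Rightarrow> int \<Rightarrow> int set \<Rightarrow> bool" where
  "top_ok E c J \<longleftrightarrow> (\<forall>a. E dvd (a - c) \<longrightarrow> addable_at J a \<longrightarrow> (\<exists>b>a. E dvd (b - c) \<and> removable_at J b))"

definition bot_ok :: "int \<Rightarrow> int \<Rightarrow> int set \<Rightarrow> bool" where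
  "bot_ok E c J \<longleftrightarrow> (\<forall>a. E dvd (a - c) \<longrightarrow> removable_at J a \<longrightarrow> (\<exists>b<a. E dvd (b - c) \<and> addable_at J b))"

definition above_ok :: "int \<Rightarrow> int \<Rightarrow> int set \<Rightarrow> bool" where
  "above_ok E x J \<longleftrightarrow> (\<forall>a>x. E dvd (a - x) \<longrightarrow> removable_at J a \<longrightarrow> (\<exists>b. x < b \<and> b < a \<and> E dvd (b - x) \<and> addable_at J b))"

definition below_ok :: "int \<Rightarrow> int \<Rightarrow> int set \<Rightarrow> bool" where
  "below_ok E x J \<longleftrightarrow> (\<forall>a<x. E dvd (a - x) \<longrightarrow> addable_at J a \<longrightarrow> (\<exists>b. a < b \<and> b < x \<and> E dvd (b - x) \<and> removable_at J b))"

definition adds_nodes :: "int \<Rightarrow> int \<Rightarrow> int set \<Rightarrow> int set \<Rightarrow> bool" where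
  "adds_nodes E c S T \<longleftrightarrow> (\<forall>x. \<not> in_block E c 1 x \<longrightarrow> (x \<in> S \<longleftrightarrow> x \<in> T)) \<and>
    (\<forall>a. E dvd (a - c) \<longrightarrow> (a \<in> S \<longleftrightarrow> a \<in> T) \<and> (a + 1 \<in> S \<longleftrightarrow> a + 1 \<in> T) \<or> addable_at S a \<and> removable_at T a)"

lemma in_block1D: "in_block E c 1 x \<Longrightarrow> E dvd (x - c) \<or> E dvd (x - 1 - c)"
proof -
  assume "in_block E c 1 x"
  then obtain a where a: "E dvd (a - c)" "a \<le> x" "x \<le> a + 1" by (auto simp: in_block_def)
  hence "a = x \<or> a = x - 1" by auto
  thus ?thesis using a by auto
qed

lemma greatest_int:
  assumes "P x0" "x0 \<le> B" "\<And>x. P x \<Longrightarrow> x \<le> (B :: int)"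
  shows "\<exists>y\<ge>x0. P y \<and> (\<forall>x>y. \<not> P x)"
proof -
  let ?F = "{x. P x \<and> x0 \<le> x}"
  have fin: "finite ?F" by (rule finite_subset[of _ "{x0..B}"]) (use assms in auto)
  have m: "Max ?F \<in> ?F" by (rule Max_in[OF fin]) (use assms in auto)
  have "\<not> P x" if "x > Max ?F" for x
  proof
    assume "P x"
    hence "x \<in> ?F" using that m by simp
    from Max_ge[OF fin this] show False using that by simp
  qed
  thus ?thesis using m by blast
qed

lemma exists_level:
  assumes "E > 0" shows "\<exists>y. E dvd (y - c) \<and> N < y \<and> y \<le> N + (E :: int)"
proof -
  define y where "y = prev_pos E c (N + E + 1)"
  have "E dvd (y - c)" "y \<le> N + E" "N < y"
    using prev_pos_dvd prev_pos_less[OF assms, of c "N + E + 1"] prev_pos_ge[OF assms, of "N + E + 1" c]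
    by (auto simp: y_def)
  thus ?thesis by blast
qed

text \<open>Under \<open>top_ok\<close> the highest non-empty level of the class has a bead on its
  right, so the last bead of \<open>J\<close> in a block with \<open>d = 1\<close> sits at a right
  end.\<close>

lemma base_right_closed:
  assumes e: "e \<ge> 2" and bd: "{..N} \<subseteq> J" "J \<subseteq> {..M}" and top: "top_ok (int e) c J"
    and base: "is_base e J K"
  shows "E dvd (a - c) \<Longrightarrow> E = int e \<Longrightarrow> a \<in> K \<Longrightarrow> a + 1 \<in> K"
proof -
  assume Ee: "E = int e" and a: "E dvd (a - c)" "a \<in> K"
  have E: "E > 0" "1 < E" using e Ee by auto
  \<comment> \<open>Low enough that \<open>y0\<close>, which is at most \<open>N - 1\<close>, is a
    bead and starts the search for the highest non-empty level.\<close>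
  define N' where "N' = N - E - 1"
  obtain y0 where y0: "E dvd (y0 - c)" "N' < y0" "y0 \<le> N' + E" using exists_level[OF E(1)] by blast
  let ?P = "\<lambda>y. E dvd (y - c) \<and> (y \<in> J \<or> y + 1 \<in> J)"
  have "y0 \<in> J" using y0 bd by (auto simp: N'_def)
  hence "\<exists>y\<ge>y0. ?P y \<and> (\<forall>x>y. \<not> ?P x)"
    by (intro greatest_int[of _ _ M]) (use y0 bd in auto)
  then obtain y where y: "y \<ge> y0" "E dvd (y - c)" "y \<in> J \<or> y + 1 \<in> J" "\<And>x. x > y \<Longrightarrow> \<not> ?P x"
    by blast
  have y1: "y + 1 \<in> J"
  proof (rule ccontr)
    assume "y + 1 \<notin> J"
    hence "addable_at J y" using y by (simp add: addable_at_def)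
    then obtain b where "b > y" "E dvd (b - c)" "removable_at J b" using top y(2) by (auto simp: top_ok_def Ee)
    thus False using y(4)[of b] by (auto simp: removable_at_def)
  qed
  define n where "n = nat (M - N')"
  have n: "M \<le> N' + int n" by (simp add: n_def)
  have "{..N' + int e} \<subseteq> J" using bd(1) by (auto simp: N'_def Ee)
  hence K: "K = ins_upto E J N' n"
    using is_base_unique[OF base is_base_ins_upto[OF _ _ bd(2) n]] e by (simp add: Ee)
  have "right_closed E c 1 (ins_upto E J N' n)"
  proof (rule ins_upto_right_closed[OF E(1) _ E(2) y1])
    show "E dvd (y + 1 - (c + 1))" using y(2) by simp
    show "N' < y + 1" using y y0 by simp
    show "y + 1 \<le> N' + int n" using y1 bd n by auto
    fix t assume t: "y + 1 < t" "t \<in> J"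
    show "\<not> in_block E c 1 t"
    proof
      assume "in_block E c 1 t"
      then obtain a where a: "E dvd (a - c)" "a \<le> t" "t \<le> a + 1" by (auto simp: in_block_def)
      hence "t = a \<or> t = a + 1" by auto
      thus False using y(4)[of a] a t by auto
    qed
  qed simp
  from right_closedD[OF this a(1), of a] show "a + 1 \<in> K" using a K by simp
qed

text \<open>\<open>below_ok\<close> puts the last bead of the class before \<open>x\<close> at a
  right end, so the comparison can start. If some level above \<open>x\<close> is non-empty,
  \<open>above_ok\<close> gives the lowest such level a bead on its left and the runs merge.
  Otherwise the block relation persists, and for \<open>d = 1\<close> it says that nodes are
  added.\<close>

lemma base_edge:
  assumes e: "e \<ge> 2" and bd: "{..N} \<subseteq> J" "J \<subseteq> {..M}" and x: "x \<in> J" "x + 1 \<notin> J"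
    and below: "below_ok (int e) x J" and above: "above_ok (int e) x J"
    and base: "is_base e J K" "is_base e (J - {x} \<union> {x + 1}) L"
  shows "K = L \<or> (\<forall>a>x. int e dvd (a - x) \<longrightarrow> a \<notin> J \<and> a + 1 \<notin> J) \<and> adds_nodes (int e) x K L"
proof -
  define E where "E = int e"
  have E: "E > 0" "1 < E" using e by (auto simp: E_def)
  define J' where "J' = J - {x} \<union> {x + 1}"
  define N' where "N' = min N (x - 1) - 2 * E - 1"
  define n where "n = nat (max M (x + 1) - N')"
  have n: "M \<le> N' + int n" "x + 1 \<le> N' + int n" by (auto simp: n_def)
  have bd': "{..N' + E} \<subseteq> J" "{..N' + E} \<subseteq> J'" "J \<subseteq> {..max M (x + 1)}" "J' \<subseteq> {..max M (x + 1)}"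
    using bd E by (auto simp: N'_def J'_def)
  have n': "max M (x + 1) \<le> N' + int n" using n by simp
  have K: "K = ins_upto E J N' n"
    using is_base_unique[OF base(1) is_base_ins_upto[OF _ _ bd'(3) n']] e bd'(1) by (simp add: E_def)
  have L: "L = ins_upto E J' N' n"
    using is_base_unique[OF base(2) is_base_ins_upto[OF _ _ bd'(4)[unfolded J'_def] n']] e bd'(2)
    by (simp add: E_def J'_def)
  have blk: "t = a \<or> t = a + 1" if "a \<le> t" "t \<le> a + 1" for a t :: int using that by auto
  obtain y0 where y0: "E dvd (y0 - x)" "N' < y0" "y0 \<le> N' + E" using exists_level[OF E(1)] by blast
  let ?P = "\<lambda>y. E dvd (y - x) \<and> y < x \<and> (y \<in> J \<or> y + 1 \<in> J)"
  have y0J: "y0 \<in> J" "y0 < x" using y0 bd E by (auto simp: N'_def)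
  have "\<exists>y\<ge>y0. ?P y \<and> (\<forall>z>y. \<not> ?P z)"
    by (intro greatest_int[of _ _ x]) (use y0 y0J in auto)
  then obtain y where y: "y \<ge> y0" "E dvd (y - x)" "y < x" "y \<in> J \<or> y + 1 \<in> J" "\<And>z. z > y \<Longrightarrow> \<not> ?P z"
    by blast
  have y1: "y + 1 \<in> J"
  proof (rule ccontr)
    assume "y + 1 \<notin> J"
    hence "addable_at J y" using y by (simp add: addable_at_def)
    then obtain b where "b > y" "b < x" "E dvd (b - x)" "removable_at J b" using below y(2,3) by (auto simp: below_ok_def E_def)
    thus False using y(5)[of b] by (auto simp: removable_at_def)
  qed
  have yx: "y + 1 < x" using cong_gap[OF y(2,3)] E by simp
  have rc: "right_closed E x 1 (ins_upto E J N' m)" if m: "N' + int m = x - 1" for m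
  proof (rule ins_upto_right_closed[OF E(1) _ E(2) y1])
    show "E dvd (y + 1 - (x + 1))" using y(2) by simp
    show "N' < y + 1" using y y0 by simp
    show "y + 1 \<le> N' + int m" using yx m by simp
    fix t assume t: "y + 1 < t" "t \<le> N' + int m" "t \<in> J"
    show "\<not> in_block E x 1 t"
    proof
      assume "in_block E x 1 t"
      then obtain a where a: "E dvd (a - x)" "a \<le> t" "t \<le> a + 1" by (auto simp: in_block_def)
      thus False using y(5)[of a] blk[OF a(2,3)] t m by auto
    qed
  qed simp
  have Nx: "N' < x" using E by (simp add: N'_def)
  have eq: "t \<in> J \<longleftrightarrow> t \<in> J'" if "t \<noteq> x" "t \<noteq> x + 1" for t using that by (simp add: J'_def)
  have xx: "x \<notin> J'" "x + 1 \<in> J'" by (auto simp: J'_def)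
  show ?thesis
  proof (cases "\<exists>a>x. E dvd (a - x) \<and> (a \<in> J \<or> a + 1 \<in> J)")
    case True
    then obtain z0 where z0: "z0 > x" "E dvd (z0 - x)" "z0 \<in> J \<or> z0 + 1 \<in> J" by blast
    \<comment> \<open>Negation turns the search for the least non-empty level into one for a
      greatest integer.\<close>
    let ?Q = "\<lambda>w. - w > x \<and> E dvd (- w - x) \<and> (- w \<in> J \<or> - w + 1 \<in> J)"
    have "\<exists>w\<ge>- z0. ?Q w \<and> (\<forall>v>w. \<not> ?Q v)"
      by (rule greatest_int[of _ _ "- x"]) (use z0 in auto)
    then obtain w where w: "?Q w" "\<And>v. v > w \<Longrightarrow> \<not> ?Q v" by blast
    define z where "z = - w"
    have z: "z > x" "E dvd (z - x)" "z \<in> J \<or> z + 1 \<in> J" using w(1) by (auto simp: z_def)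
    have zl: "\<not> (a \<in> J \<or> a + 1 \<in> J)" if "x < a" "a < z" "E dvd (a - x)" for a
      using w(2)[of "- a"] that by (simp add: z_def)
    have zJ: "z \<in> J"
    proof (rule ccontr)
      assume "z \<notin> J"
      hence "removable_at J z" using z by (simp add: removable_at_def)
      then obtain b where "x < b" "b < z" "E dvd (b - x)" "addable_at J b" using above z by (auto simp: above_ok_def E_def)
      thus False using zl[of b] by (simp add: addable_at_def)
    qed
    have "ins_upto E J N' n = ins_upto E J' N' n"
    proof (rule ins_upto_merge[OF E(1) _ E(2) Nx rc eq x xx _ z(2,1) zJ])
      show "z \<le> N' + int n" using zJ bd n by auto
      fix t assume t: "x + 1 < t" "t < z" "t \<in> J"
      show "\<not> in_block E x 1 t"
      proof
        assume "in_block E x 1 t"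
        then obtain a where a: "E dvd (a - x)" "a \<le> t" "t \<le> a + 1" by (auto simp: in_block_def)
        thus False using zl[of a] blk[OF a(2,3)] t by auto
      qed
    qed auto
    thus ?thesis using K L by simp
  next
    case False
    have "block_wise E x 1 (ins_upto E J N' n) (ins_upto E J' N' n)"
    proof (rule ins_upto_shift[OF E(1) _ E(2) Nx rc eq x xx _ n(2)])
      fix t assume t: "x + 1 < t" "t \<le> N' + int n" "t \<in> J"
      show "\<not> in_block E x 1 t"
      proof
        assume "in_block E x 1 t"
        then obtain a where a: "E dvd (a - x)" "a \<le> t" "t \<le> a + 1" by (auto simp: in_block_def)
        thus False using False blk[OF a(2,3)] t by auto
      qed
    qed auto
    hence rel: "block_wise E x 1 K L" using K L by simp
    have "(a \<in> K \<longleftrightarrow> a \<in> L) \<and> (a + 1 \<in> K \<longleftrightarrow> a + 1 \<in> L) \<or> addable_at K a \<and> removable_at L a" if "E dvd (a - x)" for a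
    proof -
      have "block_rel 1 a K L" using rel that by (simp add: block_wise_def)
      thus ?thesis
      proof (cases rule: block_relE)
        case 1
        thus ?thesis using 1[of a] 1[of "a + 1"] by simp
      next
        case (2 c)
        hence "c = a + 1" by simp
        thus ?thesis using 2(3,4) 2(5)[of a] 2(6)[of "a + 1"] by (simp add: addable_at_def removable_at_def)
      qed
    qed
    hence "adds_nodes E x K L" using rel by (simp add: adds_nodes_def block_wise_def)
    thus ?thesis using False by (auto simp: E_def)
  qed
qed

section \<open>Draining dead runners\<close>

text \<open>On beta sets this is \<open>e_restricted\<close>. It guarantees that \<open>up\<close>
  finds a vacancy for the bead it moves.\<close>

definition restricted :: "int \<Rightarrow> int set \<Rightarrow> bool" where
  "restricted E J \<longleftrightarrow> (\<forall>x\<in>J. \<exists>y\<in>J. x - E \<le> y \<and> y < x)"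

definition beta_like :: "int set \<Rightarrow> bool" where
  "beta_like J \<longleftrightarrow> (\<exists>N M. {..N} \<subseteq> J \<and> J \<subseteq> {..M})"

text \<open>The bead moved by \<open>up\<close> and its target, characterized without
  \<open>Max\<close> and \<open>Min\<close> so that runs on different sets can be compared.\<close>

definition is_pq :: "int \<Rightarrow> int set \<Rightarrow> int \<Rightarrow> int \<Rightarrow> bool" where
  "is_pq E J p q \<longleftrightarrow> p \<in> J \<and> p - E \<notin> J \<and> (\<forall>x\<in>J. p < x \<longrightarrow> x - E \<in> J) \<and>
     p < q \<and> \<not> E dvd (q - p) \<and> q - E \<in> J \<and> q \<notin> J \<and>
     (\<forall>v. p < v \<longrightarrow> \<not> E dvd (v - p) \<longrightarrow> v - E \<in> J \<longrightarrow> v \<notin> J \<longrightarrow> q \<le> v)"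

lemma is_pqD:
  assumes "is_pq E J p q"
  shows "p \<in> J" "p - E \<notin> J" "x \<in> J \<Longrightarrow> p < x \<Longrightarrow> x - E \<in> J" "p < q" "\<not> E dvd (q - p)" "q - E \<in> J" "q \<notin> J"
    "p < v \<Longrightarrow> \<not> E dvd (v - p) \<Longrightarrow> v - E \<in> J \<Longrightarrow> v \<notin> J \<Longrightarrow> q \<le> v"
  using assms unfolding is_pq_def by blast+

text \<open>Climb the runner of \<open>b\<close> to its last bead \<open>y\<close>. As
  \<open>b\<close> lies strictly between \<open>p - E\<close> and \<open>p\<close>, this is not the
  runner of \<open>p\<close>, and the free position \<open>y + E\<close> is beyond
  \<open>p\<close>.\<close>

lemma vacancy_above:
  assumes E: "E > (0 :: int)" and bd: "J \<subseteq> {..M}" and p: "p - E \<notin> J" and b: "b \<in> J" "p - E \<le> b" "b < p"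
  shows "\<exists>v. p < v \<and> \<not> E dvd (v - p) \<and> v - E \<in> J \<and> v \<notin> J \<and> E dvd (v - b)"
proof -
  let ?P = "\<lambda>y. E dvd (y - b) \<and> y \<in> J"
  have "\<exists>y\<ge>b. ?P y \<and> (\<forall>x>y. \<not> ?P x)"
    by (rule greatest_int[of _ _ M]) (use b bd in auto)
  then obtain y where y: "y \<ge> b" "E dvd (y - b)" "y \<in> J" "\<And>x. x > y \<Longrightarrow> \<not> ?P x" by blast
  have bp: "b \<noteq> p - E" using p b by auto
  have "\<not> E dvd (b - p)"
  proof
    assume "E dvd (b - p)"
    from cong_gap[OF this b(3)] show False using bp b by simp
  qed
  hence "\<not> E dvd (y + E - p)" using cong_trans[OF cong_sym[OF y(2)], of p] by auto
  moreover have "y + E \<notin> J" using y(4)[of "y + E"] y(2) E by auto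
  ultimately show ?thesis using y b bp by (intro exI[of _ "y + E"]) auto
qed

lemma up_betaE:
  assumes e: "e > 0" and bd: "beta_like J" and rs: "restricted (int e) J" and U: "U_set e J \<noteq> {}"
  obtains p q where "is_pq (int e) J p q" "up_beta e J = J - {p} \<union> {q}"
proof -
  obtain N M where NM: "{..N} \<subseteq> J" "J \<subseteq> {..M}" using bd by (auto simp: beta_like_def)
  have E: "int e > 0" using e by simp
  define p where "p = Max (U_set e J)"
  have fU: "finite (U_set e J)" by (rule finite_U_set[OF NM])
  have pU: "p \<in> U_set e J" unfolding p_def by (rule Max_in[OF fU U])
  hence p: "p \<in> J" "p - int e \<notin> J" by (auto simp: U_set_def)
  have fV: "finite (V_set e J)"
  proof (rule finite_subset)
    show "V_set e J \<subseteq> {p..M + int e}" using NM by (auto simp: V_set_def p_def Let_def)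
  qed simp
  obtain b where b: "b \<in> J" "p - int e \<le> b" "b < p" using rs p(1) by (auto simp: restricted_def)
  obtain v where "p < v" "\<not> int e dvd (v - p)" "v - int e \<in> J" "v \<notin> J"
    using vacancy_above[OF E NM(2) p(2) b] by blast
  hence "V_set e J \<noteq> {}" by (auto simp: V_set_def p_def Let_def)
  define q where "q = Min (V_set e J)"
  have qV: "q \<in> V_set e J" unfolding q_def by (rule Min_in[OF fV]) fact
  have mx: "x - int e \<in> J" if "x \<in> J" "p < x" for x
  proof (rule ccontr)
    assume "x - int e \<notin> J"
    hence "x \<in> U_set e J" using that by (simp add: U_set_def)
    hence "x \<le> p" unfolding p_def using fU by simp
    thus False using that by simp
  qed
  have mn: "q \<le> v" if "p < v" "\<not> int e dvd (v - p)" "v - int e \<in> J" "v \<notin> J" for v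
    unfolding q_def by (rule Min_le[OF fV]) (use that in \<open>auto simp: V_set_def p_def Let_def\<close>)
  have q: "p < q" "\<not> int e dvd (q - p)" "q - int e \<in> J" "q \<notin> J"
    using qV by (auto simp: V_set_def p_def Let_def)
  have "is_pq (int e) J p q" unfolding is_pq_def using p mx mn q by blast
  moreover have "up_beta e J = J - {p} \<union> {q}" using U by (simp add: up_beta_def p_def q_def)
  ultimately show thesis by (rule that)
qed

lemma is_pq_not_U: assumes "is_pq E J p q" "u \<in> J" "u - E \<notin> J" shows "u \<le> p"
  using assms is_pqD(3)[OF assms(1,2)] by force

lemma beta_like_move:
  assumes "beta_like J" "E > 0" "p - E \<notin> J" shows "beta_like (J - {p} \<union> {q})"
proof -
  obtain N M where NM: "{..N} \<subseteq> J" "J \<subseteq> {..M}" using assms by (auto simp: beta_like_def)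
  have "{..N} \<subseteq> J - {p} \<union> {q}"
  proof
    fix x assume x: "x \<in> {..N}"
    have "\<not> p - E \<le> N" using NM(1) assms(3) by (meson atMost_iff subsetD)
    thus "x \<in> J - {p} \<union> {q}" using x NM(1) assms(2) by auto
  qed
  moreover have "J - {p} \<union> {q} \<subseteq> {..max M q}" using NM(2) by auto
  ultimately show ?thesis unfolding beta_like_def by blast
qed

text \<open>Only a bead \<open>x\<close> whose sole neighbour within distance \<open>E\<close> below
  was \<open>p\<close> can suffer. Then \<open>x = p + E\<close>, since \<open>x - E\<close> is a
  bead, and a neighbour \<open>c\<close> of \<open>p\<close> gives the vacancy \<open>c + E\<close>;
  so \<open>q \<le> c + E < x\<close>, and \<open>q\<close> takes the place of
  \<open>p\<close>.\<close>

lemma restricted_move: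
  assumes E: "E > 0" and bd: "beta_like J" and rs: "restricted E J" and pq: "is_pq E J p q"
  shows "restricted E (J - {p} \<union> {q})"
  unfolding restricted_def
proof
  note pqD = is_pqD[OF pq]
  fix x assume x: "x \<in> J - {p} \<union> {q}"
  show "\<exists>y\<in>J - {p} \<union> {q}. x - E \<le> y \<and> y < x"
  proof (cases "x = q")
    case True
    have "q - E \<noteq> p" using pqD(5) by auto
    thus ?thesis using True pqD(6) E by (intro bexI[of _ "q - E"]) auto
  next
    case False
    hence xJ: "x \<in> J" "x \<noteq> p" using x by auto
    show ?thesis
    proof (cases "\<exists>y\<in>J. y \<noteq> p \<and> x - E \<le> y \<and> y < x")
      case True thus ?thesis by blast
    next
      case none: False
      obtain b where b: "b \<in> J" "x - E \<le> b" "b < x" using rs xJ by (auto simp: restricted_def)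
      hence bp: "b = p" using none by blast
      have "x - E \<in> J" using pqD(3)[OF xJ(1)] b bp by simp
      hence xp: "x = p + E" using none E by force
      obtain c where c: "c \<in> J" "p - E \<le> c" "c < p" using rs pqD(1) by (auto simp: restricted_def)
      have c': "c \<noteq> p - E" using c pqD(2) by auto
      have ndc: "\<not> E dvd (c - p)"
      proof
        assume "E dvd (c - p)"
        from cong_gap[OF this c(3)] show False using c c' by simp
      qed
      have "c + E \<notin> J"
      proof
        assume "c + E \<in> J"
        thus False using none xp c c' by force
      qed
      hence "q \<le> c + E" using pqD(8)[of "c + E"] c c' ndc by simp
      thus ?thesis using pqD(4) c xp by (intro bexI[of _ q]) auto
    qed
  qed
qed

lemma up_beta_pres:
  assumes "e > 0" "beta_like J" "restricted (int e) J"
  shows "beta_like (up_beta e J)" "restricted (int e) (up_beta e J)"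
proof -
  have "beta_like (up_beta e J) \<and> restricted (int e) (up_beta e J)"
  proof (cases "U_set e J = {}")
    case True thus ?thesis using assms by (simp add: up_beta_def)
  next
    case False
    obtain p q where pq: "is_pq (int e) J p q" "up_beta e J = J - {p} \<union> {q}"
      by (rule up_betaE[OF assms False])
    thus ?thesis using beta_like_move[OF assms(2) _ is_pqD(2)[OF pq(1)]] restricted_move[OF _ assms(2,3) pq(1)] assms(1) by simp
  qed
  thus "beta_like (up_beta e J)" "restricted (int e) (up_beta e J)" by auto
qed

lemma up_iter_pres:
  assumes "e > 0" "beta_like J" "restricted (int e) J"
  shows "beta_like ((up_beta e ^^ n) J) \<and> restricted (int e) ((up_beta e ^^ n) J)"
  by (induction n) (use assms up_beta_pres in auto)

text \<open>
  As long as \<open>Max U \<ge> z\<close>, \<open>up\<close> moves beads at positions \<open>\<ge> z\<close> only, and \<open>drain E J z\<close> is the outcome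
  when no element \<open>\<ge> z\<close> of \<open>U\<close> is left. Call a runner live if it carries a bead in the window from
  \<open>z - E\<close> to \<open>z - 1\<close>. All beads \<open>\<ge> z\<close> on dead runners disappear and fill vacancies of the live ones by
  bracket matching: a vacancy is filled iff some bead to its left is still unmatched. The function
  \<open>excess\<close> is \<open>1\<close> on beads of dead runners and \<open>-1\<close> on vacancies of live ones.
\<close>
definition window_rep :: "int \<Rightarrow> int \<Rightarrow> int \<Rightarrow> int" where
  "window_rep E z y = z - E + (y - z) mod E"

definition excess :: "int \<Rightarrow> int set \<Rightarrow> int \<Rightarrow> int \<Rightarrow> int" where
  "excess E J z y = (if y < z then 0 else of_bool (y \<in> J) - of_bool (window_rep E z y \<in> J))"

text \<open>The number of unmatched beads before \<open>t\<close> is the largest sum of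
  \<open>excess\<close> over an interval ending there, so for \<open>k \<ge> 0\<close> more than
  \<open>k\<close> are unmatched. The value \<open>k = 1\<close> enters when the two positions of a
  level are passed one after the other.\<close>

definition pending :: "int \<Rightarrow> int set \<Rightarrow> int \<Rightarrow> int \<Rightarrow> int \<Rightarrow> bool" where
  "pending E J z k t \<longleftrightarrow> (\<exists>s<t. k < sum (excess E J z) {s..<t})"

definition drain :: "int \<Rightarrow> int set \<Rightarrow> int \<Rightarrow> int set" where
  "drain E J z = {y. if y < z then y \<in> J else window_rep E z y \<in> J \<and> (y \<in> J \<or> pending E J z 0 y)}"

text \<open>
  The condition on \<open>u\<close> ensures that \<open>up\<close> skips no vacancy of a live runner when it moves the bead \<open>u\<close>.
\<close>
definition drain_inv :: "int \<Rightarrow> int \<Rightarrow> int set \<Rightarrow> bool" where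
  "drain_inv E z J \<longleftrightarrow> (\<forall>y\<ge>z. y \<in> J \<longrightarrow> window_rep E z y \<in> J \<longrightarrow> y - E \<in> J) \<and>
     (\<forall>u\<in>J. u - E \<notin> J \<longrightarrow> z \<le> u \<longrightarrow> u = z \<or> (\<forall>x. u < x \<longrightarrow> z \<le> x \<longrightarrow> x \<notin> J \<longrightarrow> window_rep E z x \<in> J \<longrightarrow>
        (\<exists>v. u < v \<and> v \<le> x \<and> \<not> E dvd (v - u) \<and> v - E \<in> J \<and> v \<notin> J)) \<and> (\<forall>x\<in>J. u < x \<longrightarrow> x - E \<in> J))"

lemma window_rep_bounds: "E > 0 \<Longrightarrow> z - E \<le> window_rep E z y \<and> window_rep E z y < z"
  using pos_mod_bound[of E "y - z"] pos_mod_sign[of E "y - z"] by (simp add: window_rep_def)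

lemma window_rep_dvd: "E dvd (window_rep E z y - y)"
proof -
  have "window_rep E z y - y = E * (-1 - (y - z) div E)"
    using minus_mod_eq_mult_div[of "y - z" E] by (simp add: window_rep_def algebra_simps)
  thus ?thesis by simp
qed

lemma window_rep_eqI:
  assumes "E > 0" "E dvd (a - y)" "z - E \<le> a" "a < z" shows "window_rep E z y = a"
proof (rule dvd_small)
  show "E dvd (window_rep E z y - a)" using cong_trans[OF window_rep_dvd cong_sym[OF assms(2)]] .
  show "\<bar>window_rep E z y - a\<bar> < E" using window_rep_bounds[OF assms(1), of z y] assms by linarith
qed

lemma window_rep_cong:
  assumes "E > 0" "E dvd (a - b)" shows "window_rep E z a = window_rep E z b"
proof (rule window_rep_eqI[OF assms(1)])
  show "E dvd (window_rep E z b - a)" using cong_trans[OF window_rep_dvd cong_sym[OF assms(2)]] .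
qed (use window_rep_bounds[OF assms(1), of z b] in auto)

lemma window_rep_small: "E > 0 \<Longrightarrow> z - E \<le> y \<Longrightarrow> y < z \<Longrightarrow> window_rep E z y = y"
  by (rule window_rep_eqI) auto

lemma window_rep_shift [simp]: "E > 0 \<Longrightarrow> window_rep E z (y - E) = window_rep E z y" "E > 0 \<Longrightarrow> window_rep E z (y + E) = window_rep E z y"
  by (rule window_rep_cong; simp)+

text \<open>Follow the live runner of \<open>x\<close> down in steps of \<open>E\<close> until a
  bead is met; the vacancy right above it is \<open>v\<close>. The walk cannot pass below
  \<open>u\<close>: vacancies between \<open>z\<close> and \<open>u\<close> are dead, and below
  \<open>z\<close> it would meet the bead of the window.\<close>

lemma drain_spot:
  assumes E: "E > 0" and u: "window_rep E z u \<notin> J" and low: "\<And>y. z \<le> y \<Longrightarrow> y < u \<Longrightarrow> y \<notin> J \<Longrightarrow> window_rep E z y \<notin> J"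
  shows "u < x \<Longrightarrow> z \<le> x \<Longrightarrow> x \<notin> J \<Longrightarrow> window_rep E z x \<in> J \<Longrightarrow>
    \<exists>v. u < v \<and> v \<le> x \<and> \<not> E dvd (v - u) \<and> v - E \<in> J \<and> v \<notin> J"
proof (induction "nat (x - u)" arbitrary: x rule: less_induct)
  case less
  have nd: "\<not> E dvd (x - u)" using window_rep_cong[OF E, of x u z] u less.prems by auto
  show ?case
  proof (cases "x - E \<in> J")
    case True thus ?thesis using less.prems nd by blast
  next
    case False
    have zx: "\<not> x - E < z"
    proof
      assume "x - E < z"
      hence "window_rep E z (x - E) = x - E" using less.prems E by (intro window_rep_small) auto
      thus False using less.prems False E by simp
    qed
    have "x - E \<noteq> u" using nd by auto
    moreover have "\<not> x - E < u" using low[of "x - E"] zx False less.prems E by auto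
    ultimately have "\<exists>v. u < v \<and> v \<le> x - E \<and> \<not> E dvd (v - u) \<and> v - E \<in> J \<and> v \<notin> J"
      by (intro less.hyps) (use less.prems False zx E in auto)
    then obtain v where "u < v" "v \<le> x - E" "\<not> E dvd (v - u)" "v - E \<in> J" "v \<notin> J" by blast
    moreover have "v \<le> x" using calculation(2) E by simp
    ultimately show ?thesis by blast
  qed
qed

lemma sum_point: "sum (\<lambda>y. of_bool (y = p) :: int) {s..<t} = of_bool (s \<le> p \<and> p < (t :: int))"
  by (simp add: sum.delta of_bool_def)

lemma sum_split_int:
  fixes f :: "int \<Rightarrow> int" assumes "a \<le> b" "b \<le> c" shows "sum f {a..<c} = sum f {a..<b} + sum f {b..<c}"
proof -
  have "{a..<c} = {a..<b} \<union> {b..<c}" using assms by auto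
  thus ?thesis by (simp add: sum.union_disjoint)
qed

text \<open>Moving \<open>p\<close> to \<open>q\<close> shifts one unit of \<open>excess\<close>,
  and no vacancy of a live runner lies strictly between them. Sums over intervals that start after
  \<open>p\<close>, at most at \<open>q\<close>, and end beyond \<open>q\<close> grow by one; but
  whenever such a sum becomes positive, the interval from \<open>p\<close> had a positive sum
  before. So nothing changes at the positions that matter for \<open>drain\<close>.\<close>

lemma drain_step:
  assumes E: "E > 0" and inv: "drain_inv E z J" and pq: "is_pq E J p q" and pz: "z \<le> p"
  defines "J1 \<equiv> J - {p} \<union> {q}"
  shows "drain E J1 z = drain E J z" "drain_inv E z J1" "\<And>y. y < z \<Longrightarrow> y \<in> J1 \<longleftrightarrow> y \<in> J"
proof -
  note pqD = is_pqD[OF pq]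
  have I1: "y - E \<in> J" if "z \<le> y" "y \<in> J" "window_rep E z y \<in> J" for y
    using inv that unfolding drain_inv_def by blast
  have dead: "window_rep E z u \<notin> J" if "u \<in> J" "u - E \<notin> J" "z \<le> u" for u using I1 that by blast
  have dp: "window_rep E z p \<notin> J" using dead pqD(1,2) pz by blast
  have spot: "\<exists>v. p < v \<and> v \<le> x \<and> \<not> E dvd (v - p) \<and> v - E \<in> J \<and> v \<notin> J" if "p < x" "x \<notin> J" "window_rep E z x \<in> J" for x
  proof (cases "p = z")
    case True
    show ?thesis by (rule drain_spot[OF E dp _ that(1) _ that(2,3)]) (use that pz True in auto)
  next
    case False
    have "z \<le> x" using that pz by simp
    thus ?thesis using inv pqD(1,2) pz False that unfolding drain_inv_def by blast
  qed
  have qs: "q \<le> x" if x: "p < x" "x \<notin> J" "window_rep E z x \<in> J" for x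
  proof -
    obtain v where "p < v" "v \<le> x" "\<not> E dvd (v - p)" "v - E \<in> J" "v \<notin> J" using spot[OF x] by blast
    thus ?thesis using pqD(8)[of v] by simp
  qed
  have repJ1: "window_rep E z y \<in> J1 \<longleftrightarrow> window_rep E z y \<in> J" for y
    using window_rep_bounds[OF E, of z y] pz pqD(4) by (auto simp: J1_def)
  show low: "\<And>y. y < z \<Longrightarrow> y \<in> J1 \<longleftrightarrow> y \<in> J" using pz pqD(4) by (auto simp: J1_def)
  have g1: "excess E J1 z y = excess E J z y + of_bool (y = q) - of_bool (y = p)" for y
    using pz pqD(1,4,7) repJ1[of y] by (auto simp: excess_def J1_def)
  have S1: "sum (excess E J1 z) {s..<t} = sum (excess E J z) {s..<t} + of_bool (s \<le> q \<and> q < t) - of_bool (s \<le> p \<and> p < t)" for s t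
    unfolding g1 sum_subtractf sum.distrib sum_point ..
  have gp: "excess E J z p = 1" using pz pqD(1) dp by (simp add: excess_def)
  have gpos: "excess E J z y \<ge> 0" if "p < y" "y < q" for y
    using qs[of y] that by (auto simp: excess_def)
  have mid: "sum (excess E J z) {p..<s} \<ge> 1" if "p < s" "s \<le> q" for s
  proof -
    have "sum (excess E J z) {p..<s} = sum (excess E J z) {p..<p+1} + sum (excess E J z) {p+1..<s}"
      by (rule sum_split_int) (use that in auto)
    moreover have "{p..<p+1} = {p}" by auto
    moreover have "sum (excess E J z) {p+1..<s} \<ge> 0" by (rule sum_nonneg) (use gpos that in auto)
    ultimately show ?thesis using gp by simp
  qed
  have pend1: "pending E J1 z 0 t \<longleftrightarrow> pending E J z 0 t" if "t \<le> p \<or> q < t" for t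
  proof (cases "t \<le> p")
    case True
    thus ?thesis using pqD(4) by (simp add: pending_def S1)
  next
    case False
    hence t: "q < t" "p < t" using that pqD(4) by auto
    show ?thesis
    proof
      assume "pending E J1 z 0 t"
      then obtain s where s: "s < t" "0 < sum (excess E J1 z) {s..<t}" by (auto simp: pending_def)
      show "pending E J z 0 t"
      proof (cases "p < s \<and> s \<le> q")
        case True
        have "sum (excess E J z) {p..<t} = sum (excess E J z) {p..<s} + sum (excess E J z) {s..<t}"
          by (rule sum_split_int) (use True s in auto)
        moreover have "sum (excess E J z) {s..<t} \<ge> 0" using s True t by (simp add: S1)
        ultimately have "sum (excess E J z) {p..<t} > 0" using mid[of s] True by simp
        thus ?thesis unfolding pending_def using t by blast
      next
        case False
        hence "sum (excess E J z) {s..<t} > 0" using s t pqD(4) by (auto simp: S1 split: if_splits)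
        thus ?thesis unfolding pending_def using s by blast
      qed
    next
      assume "pending E J z 0 t"
      then obtain s where s: "s < t" "0 < sum (excess E J z) {s..<t}" by (auto simp: pending_def)
      hence "0 < sum (excess E J1 z) {s..<t}" using t pqD(4) by (auto simp: S1)
      thus "pending E J1 z 0 t" unfolding pending_def using s by blast
    qed
  qed
  \<comment> \<open>The bead \<open>p\<close> itself is still unmatched on reaching
    \<open>q\<close>.\<close>
  have pendq: "pending E J z 0 q" unfolding pending_def using mid[of q] pqD(4) by (intro exI[of _ p]) auto
  show "drain E J1 z = drain E J z"
  proof (rule set_eqI)
    fix y
    show "y \<in> drain E J1 z \<longleftrightarrow> y \<in> drain E J z"
    proof (cases "y < z \<or> window_rep E z y \<notin> J")
      case True
      thus ?thesis using low repJ1 by (auto simp: drain_def)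
    next
      case False
      hence y: "z \<le> y" "window_rep E z y \<in> J" by auto
      have yp: "y \<noteq> p" using y dp by auto
      show ?thesis
      proof (cases "y = q")
        case True
        thus ?thesis using y pendq repJ1 by (auto simp: drain_def J1_def)
      next
        case nq: False
        have eq: "y \<in> J1 \<longleftrightarrow> y \<in> J" using nq yp by (simp add: J1_def)
        show ?thesis
        proof (cases "y \<in> J")
          case True
          thus ?thesis using y eq repJ1 by (simp add: drain_def)
        next
          case False
          have "y \<le> p \<or> q < y" using qs[of y] False y nq by force
          thus ?thesis using y eq repJ1 pend1 by (simp add: drain_def)
        qed
      qed
    qed
  qed
  show "drain_inv E z J1" unfolding drain_inv_def
  proof (intro conjI allI ballI impI)
    fix y assume y: "z \<le> y" "y \<in> J1" "window_rep E z y \<in> J1"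
    hence r: "window_rep E z y \<in> J" using repJ1 by simp
    have "y - E \<noteq> p"
    proof
      assume "y - E = p"
      hence "y = p + E" by simp
      thus False using r dp E by simp
    qed
    moreover have "y - E \<in> J" using y r I1 pqD(6) by (auto simp: J1_def)
    ultimately show "y - E \<in> J1" by (simp add: J1_def)
  next
    fix u assume u: "u \<in> J1" "u - E \<notin> J1" "z \<le> u"
    have "u \<noteq> q"
    proof
      assume "u = q"
      moreover have "q - E \<noteq> p" using pqD(5) by auto
      ultimately show False using u pqD(6) by (simp add: J1_def)
    qed
    hence uJ: "u \<in> J" "u \<noteq> p" using u by (auto simp: J1_def)
    have "u - E = p \<or> u - E \<notin> J" using u(2) by (auto simp: J1_def)
    \<comment> \<open>Apart from \<open>z\<close>, an element of the new \<open>U\<close> from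
      \<open>z\<close> on can only be the bead above the removed one: an older element below
      \<open>p\<close> would by the invariant make all beads above it flush, \<open>p\<close>
      included.\<close>
    hence "u = z \<or> u = p + E"
    proof
      assume nu: "u - E \<notin> J"
      have "u < p" using is_pq_not_U[OF pq uJ(1) nu] uJ by simp
      have "u = z"
      proof (rule ccontr)
        assume "u \<noteq> z"
        hence "\<forall>x\<in>J. u < x \<longrightarrow> x - E \<in> J" using inv uJ(1) nu u(3) unfolding drain_inv_def by blast
        thus False using pqD(1,2) \<open>u < p\<close> by blast
      qed
      thus ?thesis ..
    qed auto
    thus "u = z \<or> (\<forall>x. u < x \<longrightarrow> z \<le> x \<longrightarrow> x \<notin> J1 \<longrightarrow> window_rep E z x \<in> J1 \<longrightarrow>
        (\<exists>v. u < v \<and> v \<le> x \<and> \<not> E dvd (v - u) \<and> v - E \<in> J1 \<and> v \<notin> J1)) \<and> (\<forall>x\<in>J1. u < x \<longrightarrow> x - E \<in> J1)"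
    proof
      assume up: "u = p + E"
      have pE: "p + E \<in> J" using uJ up by simp
      have nlive: "\<not> E dvd (x - u)" if "window_rep E z x \<in> J" for x
      proof
        assume "E dvd (x - u)"
        hence "E dvd (x - p)" unfolding up by simp
        thus False using window_rep_cong[OF E, of x p z] that dp by simp
      qed
      have ex: "\<exists>v. u < v \<and> v \<le> x \<and> \<not> E dvd (v - u) \<and> v - E \<in> J1 \<and> v \<notin> J1"
        if "u < x" "z \<le> x" "x \<notin> J1" "window_rep E z x \<in> J" for x
        using that
      proof (induction "nat (x - u)" arbitrary: x rule: less_induct)
        case (less x)
        have xJ: "x \<notin> J" "x \<noteq> q" using less.prems up E by (auto simp: J1_def)
        have qx: "q < x" using qs[of x] xJ less.prems up E by simp
        show ?case
        proof (cases "x - E \<in> J1")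
          case True
          thus ?thesis using less.prems nlive by blast
        next
          case False
          have zx: "z \<le> x - E" using less.prems up pz by simp
          have nxp: "x - E \<noteq> p" using less.prems up by simp
          have xEJ: "x - E \<notin> J" using False nxp by (simp add: J1_def)
          have "p < x - E" using less.prems up by simp
          hence qxE: "q \<le> x - E" using qs[of "x - E"] xEJ less.prems E by simp
          have "x - E \<noteq> q" using False by (auto simp: J1_def)
          hence qxE': "q < x - E" using qxE by simp
          show ?thesis
          proof (cases "u < x - E")
            case True
            have "\<exists>v. u < v \<and> v \<le> x - E \<and> \<not> E dvd (v - u) \<and> v - E \<in> J1 \<and> v \<notin> J1"
              by (rule less.hyps) (use True zx False less.prems E in auto)
            then obtain v where v: "u < v" "v \<le> x - E" "\<not> E dvd (v - u)" "v - E \<in> J1" "v \<notin> J1" by blast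
            have "v \<le> x" using v(2) E by simp
            thus ?thesis using v by blast
          next
            case le: False
            \<comment> \<open>Here the walk down the runner of \<open>x\<close> has passed below
              \<open>u\<close>; the new bead \<open>q\<close> provides the vacancy
              \<open>q + E\<close> instead.\<close>
            have "q + E \<notin> J"
            proof
              assume "q + E \<in> J"
              from pqD(3)[OF this] show False using pqD(4,7) E by simp
            qed
            hence "q + E \<notin> J1" using E by (simp add: J1_def)
            moreover have "\<not> E dvd (q + E - u)" using pqD(5) unfolding up by simp
            moreover have "q + E - E \<in> J1" by (simp add: J1_def)
            moreover have "u < q + E" using pqD(4) up by simp
            moreover have "q + E \<le> x" using qxE' by simp
            ultimately show ?thesis by blast
          qed
        qed
      qed
      have fl: "x - E \<in> J1" if x: "x \<in> J1" "u < x" for x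
      proof (cases "x = q")
        case True
        have "q - E \<noteq> p" using pqD(5) by auto
        thus ?thesis using True pqD(6) by (simp add: J1_def)
      next
        case False
        hence "x - E \<in> J" using x pqD(3)[of x] up E by (auto simp: J1_def)
        thus ?thesis using x up by (auto simp: J1_def)
      qed
      show ?thesis using ex fl repJ1 by blast
    qed simp
  qed
qed

section \<open>Termination of \<open>up\<close> and reachability of the drained set\<close>

lemma Max_U_set:
  assumes "beta_like J" "is_pq (int e) J p q" shows "Max (U_set e J) = p"
proof -
  obtain N M where NM: "{..N} \<subseteq> J" "J \<subseteq> {..M}" using assms by (auto simp: beta_like_def)
  show ?thesis
    by (rule Max_eqI[OF finite_U_set[OF NM]])
      (use is_pqD(1,2)[OF assms(2)] is_pq_not_U[OF assms(2)] in \<open>auto simp: U_set_def\<close>)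
qed

text \<open>A step removes \<open>p\<close> from \<open>U\<close> and can only add
  \<open>p + E\<close>. If it does, the size of \<open>U\<close> may stay the same, but
  \<open>p + E\<close> is the new maximum and fewer beads of its runner lie at or above it.\<close>

lemma up_terminates:
  assumes e: "e > 0"
  shows "beta_like J \<Longrightarrow> restricted (int e) J \<Longrightarrow> \<exists>n. U_set e ((up_beta e ^^ n) J) = {}"
proof (induction J rule: wf_induct_rule[OF wf_measures[of "[\<lambda>J. card (U_set e J),
    \<lambda>J. card {x \<in> J. Max (U_set e J) \<le> x \<and> int e dvd (x - Max (U_set e J))}]"]])
  case (1 J)
  have E: "int e > 0" using e by simp
  show ?case
  proof (cases "U_set e J = {}")
    case True thus ?thesis by (intro exI[of _ 0]) simp
  next
    case False
    obtain p q where pq: "is_pq (int e) J p q" and up: "up_beta e J = J - {p} \<union> {q}"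
      by (rule up_betaE[OF e 1(2,3) False])
    note pqD = is_pqD[OF pq]
    let ?J = "up_beta e J"
    have pres: "beta_like ?J" "restricted (int e) ?J" using up_beta_pres[OF e 1(2,3)] .
    have mx: "Max (U_set e J) = p" by (rule Max_U_set[OF 1(2) pq])
    obtain N M where NM: "{..N} \<subseteq> J" "J \<subseteq> {..M}" using 1(2) by (auto simp: beta_like_def)
    have fU: "finite (U_set e J)" by (rule finite_U_set[OF NM])
    have pU: "p \<in> U_set e J" using pqD(1,2) by (simp add: U_set_def)
    have U: "U_set e ?J \<subseteq> (U_set e J - {p}) \<union> ({p + int e} \<inter> J)"
    proof
      fix u assume "u \<in> U_set e ?J"
      hence u: "u \<in> ?J" "u - int e \<notin> ?J" by (auto simp: U_set_def)
      have "u \<noteq> q"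
      proof
        assume "u = q"
        moreover have "q - int e \<noteq> p" using pqD(5) by auto
        ultimately show False using u pqD(6) by (simp add: up)
      qed
      hence uJ: "u \<in> J" "u \<noteq> p" using u by (auto simp: up)
      have "u - int e = p \<or> u - int e \<notin> J" using u(2) by (auto simp: up)
      thus "u \<in> (U_set e J - {p}) \<union> ({p + int e} \<inter> J)" using uJ by (auto simp: U_set_def)
    qed
    have "(?J, J) \<in> measures [\<lambda>J. card (U_set e J),
        \<lambda>J. card {x \<in> J. Max (U_set e J) \<le> x \<and> int e dvd (x - Max (U_set e J))}]"
    proof (cases "p + int e \<in> J")
      case False
      hence "U_set e ?J \<subseteq> U_set e J - {p}" using U by auto
      hence "card (U_set e ?J) \<le> card (U_set e J - {p})" using fU by (intro card_mono) auto
      also have "\<dots> < card (U_set e J)" using fU pU by (intro card_Diff1_less) auto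
      finally show ?thesis by simp
    next
      case True
      have "card (U_set e ?J) \<le> card (insert (p + int e) (U_set e J - {p}))"
        using U fU by (intro card_mono) auto
      also have "\<dots> \<le> Suc (card (U_set e J - {p}))" by (rule card_insert_le_m1) (use fU in auto)
      also have "\<dots> = card (U_set e J)" by (rule card_Suc_Diff1[OF fU pU])
      finally have le: "card (U_set e ?J) \<le> card (U_set e J)" .
      have pe: "p + int e \<in> ?J" "p \<notin> ?J" using True E pqD(4) by (auto simp: up)
      have "Max (U_set e ?J) = p + int e"
      proof (rule Max_eqI)
        show "finite (U_set e ?J)" by (rule finite_subset[OF U]) (use fU in auto)
        show "p + int e \<in> U_set e ?J" using pe by (simp add: U_set_def)
        fix u assume "u \<in> U_set e ?J"
        hence "u \<in> U_set e J \<or> u = p + int e" using U by blast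
        thus "u \<le> p + int e" using is_pq_not_U[OF pq, of u] E by (auto simp: U_set_def)
      qed
      moreover have sub: "{x \<in> ?J. p + int e \<le> x \<and> int e dvd (x - (p + int e))} \<subset>
          {x \<in> J. p \<le> x \<and> int e dvd (x - p)}" (is "?A \<subset> ?B")
      proof (rule psubsetI)
        show "?A \<subseteq> ?B"
        proof
          fix x assume x: "x \<in> ?A"
          hence "x \<noteq> q" using pqD(5) by auto
          thus "x \<in> ?B" using x by (auto simp: up)
        qed
        have "p \<in> ?B" "p \<notin> ?A" using pqD(1) E by auto
        thus "?A \<noteq> ?B" by metis
      qed
      moreover have fin: "finite {x \<in> J. p \<le> x \<and> int e dvd (x - p)}"
        by (rule finite_subset[of _ "{p..M}"]) (use NM in auto)
      ultimately have "card {x \<in> ?J. Max (U_set e ?J) \<le> x \<and> int e dvd (x - Max (U_set e ?J))} <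
          card {x \<in> J. Max (U_set e J) \<le> x \<and> int e dvd (x - Max (U_set e J))}"
        using psubset_card_mono[OF fin sub] mx by simp
      moreover have "card (U_set e ?J) < card (U_set e J) \<or> card (U_set e ?J) = card (U_set e J)"
        using le by linarith
      ultimately show ?thesis by (simp only: in_measures) blast
    qed
    from 1(1)[OF this pres] obtain n where "U_set e ((up_beta e ^^ n) ?J) = {}" by blast
    thus ?thesis by (intro exI[of _ "Suc n"]) (simp add: funpow_swap1)
  qed
qed

lemma live_chain_class:
  assumes E: "E > 0" and fl: "\<And>y. z \<le> y \<Longrightarrow> E dvd (y - y0) \<Longrightarrow> y \<in> J \<Longrightarrow> y - E \<in> J"
  shows "z \<le> y \<Longrightarrow> E dvd (y - y0) \<Longrightarrow> y \<in> J \<Longrightarrow> window_rep E z y \<in> J"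
proof (induction "nat (y - z)" arbitrary: y rule: less_induct)
  case less
  have m: "y - E \<in> J" by (rule fl[OF less.prems])
  show ?case
  proof (cases "z \<le> y - E")
    case True
    have "window_rep E z (y - E) \<in> J" by (rule less.hyps) (use m E True less.prems in auto)
    thus ?thesis using E by simp
  next
    case False
    hence "window_rep E z (y - E) = y - E" using less.prems E by (intro window_rep_small) auto
    thus ?thesis using m E by simp
  qed
qed

lemma live_chain:
  assumes E: "E > 0" and fl: "\<And>y. z \<le> y \<Longrightarrow> y \<in> J \<Longrightarrow> y - E \<in> J"
  shows "z \<le> y \<Longrightarrow> y \<in> J \<Longrightarrow> window_rep E z y \<in> J"
  using live_chain_class[OF E, of z y J y] fl by simp

text \<open>All beads from \<open>z\<close> on then sit on live runners, so \<open>excess\<close> is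
  never positive and nothing is pending.\<close>

lemma drain_trivial:
  assumes E: "E > 0" and fl: "\<And>y. z \<le> y \<Longrightarrow> y \<in> J \<Longrightarrow> y - E \<in> J"
  shows "drain E J z = J"
proof -
  have lc: "window_rep E z y \<in> J" if "z \<le> y" "y \<in> J" for y
    by (rule live_chain[OF E _ that]) (rule fl)
  have "excess E J z y \<le> 0" for y using lc[of y] by (auto simp: excess_def)
  hence "sum (excess E J z) {s..<t} \<le> 0" for s t by (intro sum_nonpos) auto
  hence "\<not> pending E J z 0 t" for t unfolding pending_def using linorder_not_le by blast
  thus ?thesis using lc by (auto simp: drain_def)
qed

text \<open>Induction on the number of steps to a core. While some element of \<open>U\<close> is
  \<ge> \<open>z\<close>, so is the maximum, and \<open>drain_step\<close> applies; afterwards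
  draining is trivial.\<close>

lemma drain_reach:
  assumes e: "e > 0" and bd: "beta_like J" and rs: "restricted (int e) J" and inv: "drain_inv (int e) z J"
  shows "\<exists>n. (up_beta e ^^ n) J = drain (int e) J z \<and> (\<forall>y\<in>drain (int e) J z. z \<le> y \<longrightarrow> y - int e \<in> drain (int e) J z)"
proof -
  have E: "int e > 0" using e by simp
  have base: "\<exists>n. (up_beta e ^^ n) J = drain (int e) J z \<and>
      (\<forall>y\<in>drain (int e) J z. z \<le> y \<longrightarrow> y - int e \<in> drain (int e) J z)"
    if "drain_inv (int e) z J" "\<And>y. z \<le> y \<Longrightarrow> y \<in> J \<Longrightarrow> y - int e \<in> J"
    "beta_like J" "restricted (int e) J" for J
  proof -
    have "drain (int e) J z = J" by (rule drain_trivial[OF E that(2)])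
    thus "\<exists>n. (up_beta e ^^ n) J = drain (int e) J z \<and>
        (\<forall>y\<in>drain (int e) J z. z \<le> y \<longrightarrow> y - int e \<in> drain (int e) J z)"
      using that(2) by (intro exI[of _ 0]) auto
  qed
  have "\<exists>n. (up_beta e ^^ n) J = drain (int e) J z \<and>
      (\<forall>y\<in>drain (int e) J z. z \<le> y \<longrightarrow> y - int e \<in> drain (int e) J z)"
    if "U_set e ((up_beta e ^^ k) J) = {}" "beta_like J" "restricted (int e) J" "drain_inv (int e) z J" for k J
    using that
  proof (induction k arbitrary: J)
    case 0
    show ?case by (rule base) (use 0 in \<open>auto simp: U_set_def\<close>)
  next
    case (Suc k)
    show ?case
    proof (cases "\<forall>y\<in>J. z \<le> y \<longrightarrow> y - int e \<in> J")
      case True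
      thus ?thesis by (intro base) (use Suc in auto)
    next
      case False
      then obtain u where u: "u \<in> J" "z \<le> u" "u - int e \<notin> J" by blast
      hence "U_set e J \<noteq> {}" by (auto simp: U_set_def)
      then obtain p q where pq: "is_pq (int e) J p q" and up: "up_beta e J = J - {p} \<union> {q}"
        by (rule up_betaE[OF e Suc.prems(2,3)])
      have "z \<le> p" using is_pq_not_U[OF pq u(1,3)] u(2) by simp
      note st = drain_step[OF E Suc.prems(4) pq this, folded up]
      have "U_set e ((up_beta e ^^ k) (up_beta e J)) = {}" using Suc.prems(1) by (simp add: funpow_swap1)
      from Suc.IH[OF this up_beta_pres[OF e Suc.prems(2,3)] st(2)]
      obtain n where n: "(up_beta e ^^ n) (up_beta e J) = drain (int e) J z"
        "\<forall>y\<in>drain (int e) J z. z \<le> y \<longrightarrow> y - int e \<in> drain (int e) J z" unfolding st(1) by blast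
      show ?thesis by (rule exI[of _ "Suc n"]) (use n in \<open>simp add: funpow_swap1\<close>)
    qed
  qed
  moreover obtain k where "U_set e ((up_beta e ^^ k) J) = {}" using up_terminates[OF e bd rs] ..
  ultimately show ?thesis using bd rs inv .
qed

text \<open>From \<open>z\<close> on, only \<open>z\<close> and \<open>z + 1\<close> can lie in
  \<open>U\<close>. If \<open>z + 1\<close> does, \<open>z1\<close> says that \<open>z\<close> is
  not a vacancy of a live runner, which is what \<open>drain_spot\<close> asks for
  \<open>u = z + 1\<close>.\<close>

lemma drain_inv_start:
  assumes E: "E \<ge> 2" and fl: "\<And>y. z + 1 < y \<Longrightarrow> y \<in> J \<Longrightarrow> y - E \<in> J"
    and z1: "z + 1 \<in> J \<Longrightarrow> z + 1 - E \<notin> J \<Longrightarrow> z \<in> J \<or> z - E \<notin> J"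
  shows "drain_inv E z J"
proof -
  have r: "window_rep E z z = z - E" "window_rep E z (z + 1) = z + 1 - E"
    by (rule window_rep_eqI; use E in simp)+
  have E0: "E > 0" using E by simp
  show ?thesis unfolding drain_inv_def
  proof (intro conjI allI ballI impI)
    fix y assume y: "z \<le> y" "y \<in> J" "window_rep E z y \<in> J"
    have "y = z \<or> y = z + 1 \<or> z + 1 < y" using y by auto
    thus "y - E \<in> J" using y r fl by auto
  next
    fix u assume u: "u \<in> J" "u - E \<notin> J" "z \<le> u"
    have "\<not> z + 1 < u" using fl u by blast
    hence "u = z \<or> u = z + 1" using u by auto
    thus "u = z \<or> (\<forall>x. u < x \<longrightarrow> z \<le> x \<longrightarrow> x \<notin> J \<longrightarrow> window_rep E z x \<in> J \<longrightarrow>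
        (\<exists>v. u < v \<and> v \<le> x \<and> \<not> E dvd (v - u) \<and> v - E \<in> J \<and> v \<notin> J)) \<and> (\<forall>x\<in>J. u < x \<longrightarrow> x - E \<in> J)"
    proof
      assume uz: "u = z + 1"
      have ru: "window_rep E z u \<notin> J" using r u uz by simp
      have low: "window_rep E z y \<notin> J" if "z \<le> y" "y < u" "y \<notin> J" for y
      proof -
        have "y = z" using that uz by simp
        thus ?thesis using z1 u uz that r by simp
      qed
      have "\<forall>x. u < x \<longrightarrow> z \<le> x \<longrightarrow> x \<notin> J \<longrightarrow> window_rep E z x \<in> J \<longrightarrow>
        (\<exists>v. u < v \<and> v \<le> x \<and> \<not> E dvd (v - u) \<and> v - E \<in> J \<and> v \<notin> J)"
        by (intro allI impI, rule drain_spot[OF E0 ru low])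
      moreover have "\<forall>x\<in>J. u < x \<longrightarrow> x - E \<in> J" using fl uz by simp
      ultimately show ?thesis by simp
    qed simp
  qed
qed

section \<open>The roof\<close>

definition is_roof :: "nat \<Rightarrow> int set \<Rightarrow> int set \<Rightarrow> bool" where
  "is_roof e J K \<longleftrightarrow> U_set e K = {} \<and> (\<exists>n. K = (up_beta e ^^ n) J)"

lemma up_beta_core: "U_set e K = {} \<Longrightarrow> (up_beta e ^^ k) K = K"
  by (induction k) (simp_all add: up_beta_def)

lemma is_roof_unique:
  assumes "is_roof e J K" "is_roof e J L" shows "K = L"
proof -
  obtain k l where kl: "K = (up_beta e ^^ k) J" "L = (up_beta e ^^ l) J" "U_set e K = {}" "U_set e L = {}"
    using assms by (auto simp: is_roof_def)
  have "K = (up_beta e ^^ (l + k)) J" using kl(1,3) up_beta_core[of e K l]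
    by (simp add: funpow_add)
  moreover have "L = (up_beta e ^^ (k + l)) J" using kl(2,4) up_beta_core[of e L k]
    by (simp add: funpow_add)
  ultimately show ?thesis by (simp add: add.commute)
qed

lemma is_roof_step:
  assumes "is_roof e ((up_beta e ^^ n) J) K" shows "is_roof e J K"
proof -
  obtain k where "K = (up_beta e ^^ k) ((up_beta e ^^ n) J)" "U_set e K = {}" using assms by (auto simp: is_roof_def)
  hence "K = (up_beta e ^^ (k + n)) J" by (simp add: funpow_add)
  thus ?thesis using \<open>U_set e K = {}\<close> unfolding is_roof_def by blast
qed

lemma is_roof_exists:
  assumes "e > 0" "beta_like J" "restricted (int e) J" shows "\<exists>K. is_roof e J K"
  using up_terminates[OF assms] unfolding is_roof_def by blast

lemma up_beta_pq:
  assumes bd: "beta_like J" and pq: "is_pq (int e) J p q"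
  shows "up_beta e J = J - {p} \<union> {q}"
proof -
  note D = is_pqD[OF pq]
  obtain N M where NM: "{..N} \<subseteq> J" "J \<subseteq> {..M}" using bd by (auto simp: beta_like_def)
  have mx: "Max (U_set e J) = p" by (rule Max_U_set[OF bd pq])
  have "finite (V_set e J)"
  proof (rule finite_subset)
    show "V_set e J \<subseteq> {p..M + int e}" using NM by (auto simp: V_set_def mx Let_def)
  qed simp
  hence "Min (V_set e J) = q"
    by (intro Min_eqI) (use D(4-8) in \<open>auto simp: V_set_def mx Let_def\<close>)
  moreover have "p \<in> U_set e J" using D(1,2) by (simp add: U_set_def)
  ultimately show ?thesis unfolding up_beta_def using mx by auto
qed

lemma flush_above_down:
  assumes E: "E > (0 :: int)" and fl: "\<And>x. x \<in> J \<Longrightarrow> p < x \<Longrightarrow> x - E \<in> J" and q: "p < q"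
  shows "y \<in> J \<Longrightarrow> E dvd (y - q) \<Longrightarrow> q \<le> y \<Longrightarrow> q \<in> J"
proof (induction "nat (y - q)" arbitrary: y rule: less_induct)
  case less
  show ?case
  proof (cases "y = q")
    case False
    have "q \<le> y - E" using cong_gap[OF cong_sym[OF less.prems(2)]] less.prems(3) False by simp
    moreover have "y - E \<in> J" by (rule fl[OF less.prems(1)]) (use less.prems q in simp)
    ultimately show ?thesis using less.hyps[of "y - E"] less.prems E by simp
  qed (use less.prems in simp)
qed

text \<open>
  The part of \<open>above_ok\<close> that persists under the steps of \<open>up\<close> far above \<open>x\<close>.
\<close>
definition weak_above_ok :: "int \<Rightarrow> int \<Rightarrow> int set \<Rightarrow> bool" where
  "weak_above_ok E x J \<longleftrightarrow> (\<forall>a>x. E dvd (a - x) \<longrightarrow> removable_at J a \<longrightarrow> (\<exists>b. x < b \<and> b < a \<and> E dvd (b - x) \<and> b + 1 \<notin> J))"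

text \<open>A level that becomes removable loses the bead \<open>p\<close> on its left or gains the
  bead \<open>q\<close> on its right. If \<open>p\<close> is in the class, the vacancy
  \<open>p - E\<close> leads to a witness. Otherwise minimality of \<open>q = a + 1\<close> makes
  \<open>a - E\<close> vacant, so level \<open>a - E\<close> was removable and passes on its
  witness. An old witness \<open>b\<close> is lost only for \<open>b + 1 = q\<close>, but then
  flushness above \<open>p\<close>, applied from \<open>a + 1\<close> downwards, would have made
  \<open>q\<close> a bead.\<close>

lemma weak_above_ok_move:
  assumes E: "E > 0" and weak_above_ok: "weak_above_ok E x J" and pq: "is_pq E J p q" and p: "x + E + 1 < p"
  shows "weak_above_ok E x (J - {p} \<union> {q})"
  unfolding weak_above_ok_def
proof (intro allI impI)
  note D = is_pqD[OF pq]
  let ?J = "J - {p} \<union> {q}"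
  fix a assume a: "x < a" "E dvd (a - x)" "removable_at ?J a"
  hence aR: "a \<notin> ?J" "a + 1 \<in> ?J" by (auto simp: removable_at_def)
  have keep: "b + 1 \<notin> ?J" if "b + 1 \<notin> J" "b + 1 < q" for b using that by auto
  have acJ: "\<exists>b. x < b \<and> b < c \<and> E dvd (b - x) \<and> b + 1 \<notin> J" if "x < c" "E dvd (c - x)" "c \<notin> J" "c + 1 \<in> J" for c
    using weak_above_ok that unfolding weak_above_ok_def removable_at_def by blast
  have K: "\<exists>b. x < b \<and> b < a \<and> E dvd (b - x) \<and> b + 1 \<notin> ?J" if "E dvd (p - x)" "p \<le> a"
  proof (cases "p - E + 1 \<in> J")
    case True
    have "\<exists>b. x < b \<and> b < p - E \<and> E dvd (b - x) \<and> b + 1 \<notin> J"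
      by (rule acJ) (use p that D(2) True in auto)
    then obtain b where b: "x < b" "b < p - E" "E dvd (b - x)" "b + 1 \<notin> J" by blast
    hence "b + 1 \<notin> ?J" using keep[of b] D(4) E by simp
    moreover have "b < a" using b that E by simp
    ultimately show ?thesis using b by blast
  next
    case False
    have "p - E + 1 \<notin> ?J" using keep[of "p - E"] False D(4) E by simp
    moreover have "x < p - E" "p - E < a" using p that E by auto
    ultimately show ?thesis using that(1) by (intro exI[of _ "p - E"]) simp
  qed
  show "\<exists>b. x < b \<and> b < a \<and> E dvd (b - x) \<and> b + 1 \<notin> ?J"
  proof (cases "a + 1 = q")
    case True
    hence pa: "p \<le> a" using D(4) by simp
    show ?thesis
    proof (cases "E dvd (p - x)")
      case True thus ?thesis using K pa by blast
    next
      case False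
      have nap: "\<not> E dvd (a - p)"
      proof
        assume "E dvd (a - p)"
        from cong_trans[OF cong_sym[OF this] a(2)] show False using False by simp
      qed
      hence "a \<noteq> p" by auto
      hence ap: "p < a" "a \<notin> J" using pa aR(1) by auto
      have aE: "a - E \<notin> J"
      proof
        assume "a - E \<in> J"
        from D(8)[OF ap(1) nap this ap(2)] show False using True by simp
      qed
      have q': "a - E + 1 \<in> J" using D(6) True by (simp add: algebra_simps)
      have "\<exists>b. x < b \<and> b < a - E \<and> E dvd (b - x) \<and> b + 1 \<notin> J"
        by (rule acJ) (use p ap a aE q' in auto)
      then obtain b where b: "x < b" "b < a - E" "E dvd (b - x)" "b + 1 \<notin> J" by blast
      have "b + 1 \<notin> ?J" "b < a" using keep[of b] b True E by auto
      thus ?thesis using b by blast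
    qed
  next
    case False
    hence a1: "a + 1 \<in> J" using aR(2) by simp
    show ?thesis
    proof (cases "a = p")
      case True thus ?thesis using K a(2) by simp
    next
      case ap: False
      hence "a \<notin> J" using aR(1) by simp
      then obtain b where b: "x < b" "b < a" "E dvd (b - x)" "b + 1 \<notin> J" using acJ[OF a(1,2) _ a1] by blast
      have "b + 1 \<noteq> q"
      proof
        assume bq: "b + 1 = q"
        have "E dvd (a + 1 - q)" using cong_trans[OF a(2) cong_sym[OF b(3)]] bq by (auto simp: algebra_simps)
        from flush_above_down[OF E D(3) D(4) a1 this] show False using b(2) bq D(7) by simp
      qed
      hence "b + 1 \<notin> ?J" using b by simp
      thus ?thesis using b by blast
    qed
  qed
qed

text \<open>For \<open>x\<close> below all vacancies, \<open>bot_ok\<close> yields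
  \<open>weak_above_ok E x\<close>, which all steps of \<open>up\<close> preserve. In a core it
  excludes removable levels above \<open>x\<close>, since a bead at \<open>a + 1\<close> forces one
  at \<open>b + 1\<close>.\<close>

lemma roof_left_closed:
  assumes e: "e \<ge> 2" and bd: "beta_like J" and rs: "restricted (int e) J" and bot: "bot_ok (int e) c J"
    and roof: "is_roof e J K" and a: "int e dvd (a - c)" "a + 1 \<in> K"
  shows "a \<in> K"
proof (rule ccontr)
  assume aK: "a \<notin> K"
  define E where "E = int e"
  have E: "E > 0" using e by (simp add: E_def)
  obtain N where N: "{..N} \<subseteq> J" using bd by (auto simp: beta_like_def)
  \<comment> \<open>The margin \<open>E + 1\<close> below \<open>N\<close> ensures
    \<open>x + E + 1 < p\<close> for every bead \<open>p\<close> that \<open>up\<close>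
    moves.\<close>
  obtain x where x: "E dvd (x - c)" "x \<le> N - E - 1"
    using exists_level[OF E, of c "N - E - 1 - E"] by auto
  have ax: "E dvd (b - c) \<longleftrightarrow> E dvd (b - x)" for b
    using cong_trans[of E b c x] cong_trans[of E b x c] x(1) cong_sym by blast
  have ac0: "weak_above_ok E x J" unfolding weak_above_ok_def
  proof (intro allI impI)
    fix a assume "x < a" "E dvd (a - x)" "removable_at J a"
    then obtain b where b: "b < a" "E dvd (b - c)" "addable_at J b"
      using bot ax unfolding bot_ok_def E_def by blast
    have "\<not> b + 1 \<le> N" using b(3) N unfolding addable_at_def by (meson atMost_iff subsetD)
    hence "x < b" using x(2) E by simp
    thus "\<exists>b. x < b \<and> b < a \<and> E dvd (b - x) \<and> b + 1 \<notin> J" using b ax by (auto simp: addable_at_def)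
  qed
  have "beta_like ((up_beta e ^^ n) J) \<and> restricted E ((up_beta e ^^ n) J) \<and> weak_above_ok E x ((up_beta e ^^ n) J) \<and> {..N} \<subseteq> (up_beta e ^^ n) J" for n
  proof (induction n)
    case 0 show ?case using bd rs ac0 N by (simp add: E_def)
  next
    case (Suc n)
    let ?J = "(up_beta e ^^ n) J"
    have IH: "beta_like ?J" "restricted E ?J" "weak_above_ok E x ?J" "{..N} \<subseteq> ?J" using Suc by auto
    show ?case
    proof (cases "U_set e ?J = {}")
      case True
      hence "up_beta e ?J = ?J" by (simp add: up_beta_def)
      thus ?thesis using IH by simp
    next
      case False
      obtain p q where pq: "is_pq (int e) ?J p q" "up_beta e ?J = ?J - {p} \<union> {q}"
        by (rule up_betaE[OF _ IH(1) IH(2)[unfolded E_def] False]) (use e in auto)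
      have pN: "\<not> p - E \<le> N" using is_pqD(2)[OF pq(1)] IH(4) unfolding E_def by (meson atMost_iff subsetD)
      have "weak_above_ok E x (up_beta e ?J)" unfolding pq(2)
        by (rule weak_above_ok_move[OF E IH(3) pq(1)[folded E_def]]) (use pN x(2) E in simp)
      moreover have "{..N} \<subseteq> up_beta e ?J" using IH(4) pN E unfolding pq(2) by auto
      moreover have "beta_like (up_beta e ?J)" "restricted E (up_beta e ?J)"
        using up_beta_pres[OF _ IH(1) IH(2)[unfolded E_def]] e by (auto simp: E_def)
      ultimately show ?thesis by simp
    qed
  qed
  moreover obtain n where n: "K = (up_beta e ^^ n) J" "U_set e K = {}" using roof by (auto simp: is_roof_def)
  ultimately have K: "weak_above_ok E x K" "{..N} \<subseteq> K" by auto
  have fl: "flush E K" using n(2) by (simp add: U_set_empty_iff E_def)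
  have "\<not> a \<le> N" using aK K(2) by auto
  hence "x < a" using x(2) E by simp
  moreover have "E dvd (a - x)" using a(1) ax by (simp add: E_def)
  ultimately obtain b where b: "b < a" "E dvd (b - x)" "b + 1 \<notin> K"
    using K(1) aK a(2) unfolding weak_above_ok_def removable_at_def by blast
  have "E dvd (a + 1 - (b + 1))" using cong_trans[OF \<open>E dvd (a - x)\<close> cong_sym[OF b(2)]] by simp
  from flush_down[OF fl a(2) this _ E] show False using b by simp
qed

text \<open>While \<open>up\<close> moves beads \<open>p > x + E + 1\<close>, its choices look only
  at positions above \<open>x + 1\<close>, where the two sets agree. So both make the same moves
  until they are flush beyond \<open>x + E + 1\<close>.\<close>

lemma up_parallel:
  assumes e: "e > 0" and E: "E = int e"
  shows "\<lbrakk>U_set e ((up_beta e ^^ k) J) = {}; beta_like J; restricted E J; beta_like (J - {x} \<union> {x + 1}); restricted E (J - {x} \<union> {x + 1});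
    x \<in> J; x + 1 \<notin> J; weak_above_ok E x J\<rbrakk> \<Longrightarrow>
    \<exists>n K. K = (up_beta e ^^ n) J \<and> K - {x} \<union> {x + 1} = (up_beta e ^^ n) (J - {x} \<union> {x + 1}) \<and> beta_like K \<and> restricted E K \<and>
      beta_like (K - {x} \<union> {x + 1}) \<and> restricted E (K - {x} \<union> {x + 1}) \<and> weak_above_ok E x K \<and>
      (\<forall>y\<in>K. x + E + 1 < y \<longrightarrow> y - E \<in> K) \<and> (\<forall>y\<le>x + E + 1. y \<in> K \<longleftrightarrow> y \<in> J)"
proof (induction k arbitrary: J)
  case 0
  show ?case by (rule exI[of _ 0], rule exI[of _ J]) (use 0 E in \<open>auto simp: U_set_def\<close>)
next
  case (Suc k)
  have E0: "E > 0" using e E by simp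
  let ?J' = "J - {x} \<union> {x + 1}"
  show ?case
  proof (cases "\<forall>y\<in>J. x + E + 1 < y \<longrightarrow> y - E \<in> J")
    case True
    show ?thesis by (rule exI[of _ 0], rule exI[of _ J]) (use Suc.prems True in auto)
  next
    case False
    then obtain u where u: "u \<in> J" "x + E + 1 < u" "u - E \<notin> J" by blast
    hence "U_set e J \<noteq> {}" using E by (auto simp: U_set_def)
    then obtain p q where pq: "is_pq E J p q" and up: "up_beta e J = J - {p} \<union> {q}"
      using up_betaE[OF e Suc.prems(2) Suc.prems(3)[unfolded E]] E by blast
    note D = is_pqD[OF pq]
    have p: "x + E + 1 < p" using is_pq_not_U[OF pq u(1,3)] u(2) by simp
    have pq': "is_pq E ?J' p q" unfolding is_pq_def
    proof (intro conjI ballI allI impI)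
      show "p \<in> ?J'" "p - E \<notin> ?J'" "p < q" "\<not> E dvd (q - p)" "q - E \<in> ?J'" "q \<notin> ?J'"
        using D(1,2,4-7) p E0 by auto
      show "y - E \<in> ?J'" if "y \<in> ?J'" "p < y" for y using D(3)[of y] that p E0 by auto
      show "q \<le> v" if "p < v" "\<not> E dvd (v - p)" "v - E \<in> ?J'" "v \<notin> ?J'" for v
        using D(8)[of v] that p E0 by auto
    qed
    have up': "up_beta e ?J' = ?J' - {p} \<union> {q}"
      by (rule up_beta_pq[OF Suc.prems(4) pq'[unfolded E]])
    let ?K = "J - {p} \<union> {q}"
    have eq: "?K - {x} \<union> {x + 1} = ?J' - {p} \<union> {q}" using p D(4) E0 by auto
    have pres: "beta_like ?K" "restricted E ?K" "beta_like (?K - {x} \<union> {x + 1})" "restricted E (?K - {x} \<union> {x + 1})"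
      using up_beta_pres[OF e Suc.prems(2) Suc.prems(3)[unfolded E]]
        up_beta_pres[OF e Suc.prems(4) Suc.prems(5)[unfolded E]] unfolding up up' eq E by auto
    have x': "x \<in> ?K" "x + 1 \<notin> ?K" using Suc.prems(6,7) p D(4) E0 by auto
    have ac': "weak_above_ok E x ?K" by (rule weak_above_ok_move[OF E0 Suc.prems(8) pq p])
    have U: "U_set e ((up_beta e ^^ k) ?K) = {}" using Suc.prems(1) by (simp add: funpow_swap1 up)
    have low: "y \<in> ?K \<longleftrightarrow> y \<in> J" if "y \<le> x + E + 1" for y using that p D(4) by auto
    from Suc.IH[OF U pres x' ac'] obtain n K where K: "K = (up_beta e ^^ n) ?K"
      "K - {x} \<union> {x + 1} = (up_beta e ^^ n) (?K - {x} \<union> {x + 1})"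
      "beta_like K \<and> restricted E K \<and> beta_like (K - {x} \<union> {x + 1}) \<and> restricted E (K - {x} \<union> {x + 1}) \<and> weak_above_ok E x K \<and>
      (\<forall>y\<in>K. x + E + 1 < y \<longrightarrow> y - E \<in> K)" "\<forall>y\<le>x + E + 1. y \<in> K \<longleftrightarrow> y \<in> ?K" by blast
    have "K = (up_beta e ^^ Suc n) J" using K(1) by (simp add: funpow_swap1 up)
    moreover have "K - {x} \<union> {x + 1} = (up_beta e ^^ Suc n) ?J'" using K(2)
      by (simp only: funpow_Suc_right o_apply up' eq)
    moreover have "\<forall>y\<le>x + E + 1. y \<in> K \<longleftrightarrow> y \<in> J" using K(4) low by simp
    ultimately show ?thesis using K(3) by blast
  qed
qed

section \<open>Bracket counts on intervals that respect levels\<close>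

lemma sum_blocks_eq:
  fixes f h :: "int \<Rightarrow> int"
  assumes E: "E \<ge> 2"
    and out: "\<And>y. \<not> E dvd (y - c) \<Longrightarrow> \<not> E dvd (y - 1 - c) \<Longrightarrow> f y = h y"
    and blk: "\<And>a. E dvd (a - c) \<Longrightarrow> f a + f (a + 1) = h a + h (a + 1)"
    and t: "\<not> E dvd (t - 1 - c)"
  shows "s \<le> t \<Longrightarrow> \<not> E dvd (s - 1 - c) \<Longrightarrow> sum f {s..<t} = sum h {s..<t}"
proof (induction "nat (t - s)" arbitrary: s rule: less_induct)
  case less
  show ?case
  proof (cases "s = t")
    case False
    hence st: "s < t" using less.prems by simp
    show ?thesis
    proof (cases "E dvd (s - c)")
      case True
      have "s + 1 \<noteq> t" using t True by auto
      hence s2: "s + 2 \<le> t" using st by simp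
      have n2: "\<not> E dvd (s + 2 - 1 - c)"
      proof
        assume "E dvd (s + 2 - 1 - c)"
        hence "E dvd (s + 2 - 1 - c - (s - c))" using True by (rule dvd_diff)
        thus False using E zdvd_imp_le[of E 1] by simp
      qed
      have two: "{s..<s+2} = {s, s + 1}" by auto
      have sp: "sum w {s..<t} = w s + w (s + 1) + sum w {s+2..<t}" for w :: "int \<Rightarrow> int"
        using sum_split_int[of s "s + 2" t w] s2 unfolding two by simp
      have "sum f {s+2..<t} = sum h {s+2..<t}" by (rule less.hyps) (use s2 n2 in auto)
      thus ?thesis using blk[OF True] unfolding sp[of f] sp[of h] by simp
    next
      case F: False
      have one: "{s..<s+1} = {s}" by auto
      have sp: "sum w {s..<t} = w s + sum w {s+1..<t}" for w :: "int \<Rightarrow> int"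
        using sum_split_int[of s "s + 1" t w] st unfolding one by simp
      have "sum f {s+1..<t} = sum h {s+1..<t}" by (rule less.hyps) (use st F in auto)
      thus ?thesis using out[OF F less.prems(2)] unfolding sp[of f] sp[of h] by simp
    qed
  qed simp
qed

text \<open>By \<open>sp\<close>, an interval that starts in the middle of a level can be extended
  or shortened by one position without lowering its sum. It then consists of whole levels and
  positions off the class, where \<open>f\<close> and \<open>h\<close> have equal sums.\<close>

lemma pending_blocks_imp:
  fixes f h :: "int \<Rightarrow> int"
  assumes E: "E \<ge> 2"
    and out: "\<And>y. \<not> E dvd (y - c) \<Longrightarrow> \<not> E dvd (y - 1 - c) \<Longrightarrow> f y = h y"
    and blk: "\<And>a. E dvd (a - c) \<Longrightarrow> f a + f (a + 1) = h a + h (a + 1)"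
    and sp: "\<And>a. E dvd (a - c) \<Longrightarrow> f a \<ge> 0 \<or> f (a + 1) \<le> 0"
    and t: "\<not> E dvd (t - 1 - c)" and k: "k \<ge> 0"
    and ex: "\<exists>s<t. k < sum f {s..<t}"
  shows "\<exists>s<t. k < sum h {s..<t}"
proof -
  obtain s where s: "s < t" "k < sum f {s..<t}" using ex by blast
  have "\<exists>s'\<le>t. \<not> E dvd (s' - 1 - c) \<and> k < sum f {s'..<t}"
  proof (cases "E dvd (s - 1 - c)")
    case False thus ?thesis using s by (intro exI[of _ s]) auto
  next
    case True
    have one: "{s..<s+1} = {s}" "{s-1..<s} = {s-1}" by auto
    have sp1: "sum f {s..<t} = f s + sum f {s+1..<t}"
      using sum_split_int[of s "s + 1" t f] s unfolding one by simp
    have sp2: "sum f {s-1..<t} = f (s - 1) + sum f {s..<t}"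
      using sum_split_int[of "s - 1" s t f] s unfolding one by simp
    have nn: "\<not> E dvd b" if "b = s - c \<or> b = s - 2 - c" for b
    proof
      assume "E dvd b"
      hence "E dvd (s - 1 - c - b)" using True by (metis dvd_diff)
      moreover have "s - 1 - c - b = -1 \<or> s - 1 - c - b = 1" using that by auto
      ultimately have "E dvd -1 \<or> E dvd 1" by metis
      thus False using E zdvd_imp_le[of E 1] by simp
    qed
    from sp[OF True] show ?thesis
    proof
      assume "0 \<le> f (s - 1)"
      thus ?thesis using s sp2 nn[of "s - 2 - c"] by (intro exI[of _ "s - 1"]) auto
    next
      assume "f (s - 1 + 1) \<le> 0"
      thus ?thesis using s sp1 nn[of "s - c"] by (intro exI[of _ "s + 1"]) auto
    qed
  qed
  then obtain s' where s': "s' \<le> t" "\<not> E dvd (s' - 1 - c)" "k < sum f {s'..<t}" by blast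
  hence "k < sum h {s'..<t}" using sum_blocks_eq[where f = f and h = h and c = c, OF E out blk t s'(1,2)] by simp
  moreover have "s' \<noteq> t" using s'(3) k by auto
  ultimately show ?thesis using s'(1) by (intro exI[of _ s']) auto
qed

lemma pending_blocks:
  assumes E: "E \<ge> 2"
    and out: "\<And>y. \<not> E dvd (y - c) \<Longrightarrow> \<not> E dvd (y - 1 - c) \<Longrightarrow> excess E S z y = excess E T w y"
    and blk: "\<And>a. E dvd (a - c) \<Longrightarrow> excess E S z a + excess E S z (a + 1) = excess E T w a + excess E T w (a + 1)"
    and sp: "\<And>a. E dvd (a - c) \<Longrightarrow> excess E S z a \<ge> 0 \<or> excess E S z (a + 1) \<le> 0"
      "\<And>a. E dvd (a - c) \<Longrightarrow> excess E T w a \<ge> 0 \<or> excess E T w (a + 1) \<le> 0"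
    and t: "\<not> E dvd (t - 1 - c)" and k: "k \<ge> 0"
  shows "pending E S z k t \<longleftrightarrow> pending E T w k t"
  unfolding pending_def
proof
  show "\<exists>s<t. k < sum (excess E T w) {s..<t}" if "\<exists>s<t. k < sum (excess E S z) {s..<t}"
    by (rule pending_blocks_imp[where f = "excess E S z" and h = "excess E T w" and c = c, OF E out blk sp(1) t k that])
  show "\<exists>s<t. k < sum (excess E S z) {s..<t}" if "\<exists>s<t. k < sum (excess E T w) {s..<t}"
    by (rule pending_blocks_imp[where f = "excess E T w" and h = "excess E S z" and c = c,
          OF E out[symmetric] blk[symmetric] sp(2) t k that])
qed

text \<open>One step of the bracket count: entry \<open>t\<close> changes the number of unmatched
  beads by its excess. The second alternative is the interval consisting of \<open>t\<close>
  alone.\<close>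

lemma pending_Suc:
  assumes k: "k \<ge> 0"
  shows "pending E S z k (t + 1) \<longleftrightarrow> pending E S z (k - excess E S z t) t \<or> k < excess E S z t"
proof -
  have one: "{t..<t+1} = {t}" by auto
  have sp: "sum (excess E S z) {s..<t+1} = sum (excess E S z) {s..<t} + excess E S z t" if "s \<le> t" for s
    using sum_split_int[of s t "t + 1" "excess E S z"] that unfolding one by simp
  show ?thesis
  proof
    assume "pending E S z k (t + 1)"
    then obtain s where s: "s < t + 1" "k < sum (excess E S z) {s..<t+1}" by (auto simp: pending_def)
    show "pending E S z (k - excess E S z t) t \<or> k < excess E S z t"
    proof (cases "s = t")
      case True thus ?thesis using s one by simp
    next
      case False
      hence "s < t" "k - excess E S z t < sum (excess E S z) {s..<t}" using s sp[of s] by auto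
      thus ?thesis unfolding pending_def by blast
    qed
  next
    assume "pending E S z (k - excess E S z t) t \<or> k < excess E S z t"
    thus "pending E S z k (t + 1)"
    proof
      assume "pending E S z (k - excess E S z t) t"
      then obtain s where s: "s < t" "k - excess E S z t < sum (excess E S z) {s..<t}" by (auto simp: pending_def)
      thus ?thesis unfolding pending_def using sp[of s] by (intro exI[of _ s]) auto
    next
      assume "k < excess E S z t"
      thus ?thesis unfolding pending_def using one by (intro exI[of _ t]) auto
    qed
  qed
qed

section \<open>The roof along an edge of the crystal\<close>

text \<open>Forgets on which side of a level of the class a single bead lies; this is the relation
  that survives the drains.\<close>

definition level_equiv :: "int \<Rightarrow> int \<Rightarrow> int set \<Rightarrow> int set \<Rightarrow> bool" where
  "level_equiv E x S T \<longleftrightarrow> (\<forall>y. \<not> E dvd (y - x) \<longrightarrow> \<not> E dvd (y - 1 - x) \<longrightarrow> (y \<in> S \<longleftrightarrow> y \<in> T)) \<and>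
     (\<forall>a. E dvd (a - x) \<longrightarrow> of_bool (a \<in> S) + of_bool (a + 1 \<in> S) = (of_bool (a \<in> T) + of_bool (a + 1 \<in> T) :: int))"

lemma level_equivD:
  assumes "level_equiv E x S T"
  shows "\<not> E dvd (y - x) \<Longrightarrow> \<not> E dvd (y - 1 - x) \<Longrightarrow> y \<in> S \<longleftrightarrow> y \<in> T"
    "E dvd (a - x) \<Longrightarrow> of_bool (a \<in> S) + of_bool (a + 1 \<in> S) = (of_bool (a \<in> T) + of_bool (a + 1 \<in> T) :: int)"
  using assms unfolding level_equiv_def by blast+

lemma not_dvd_one: "E \<ge> 2 \<Longrightarrow> E dvd (a :: int) \<Longrightarrow> \<not> E dvd (a + 1)" "E \<ge> 2 \<Longrightarrow> E dvd (a :: int) \<Longrightarrow> \<not> E dvd (a - 1)"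
proof -
  assume E: "E \<ge> 2" and a: "E dvd a"
  have n: "\<not> E dvd 1" using E zdvd_imp_le[of E 1] by auto
  show "\<not> E dvd (a + 1)" using a n dvd_add_right_iff by blast
  show "\<not> E dvd (a - 1)" using a n dvd_diff[of E a "a - 1"] by auto
qed

lemma window_rep_dvd_iff: "E dvd (window_rep E z y - c) \<longleftrightarrow> E dvd (y - c)"
  using cong_trans[OF window_rep_dvd[of E z y], of c] cong_trans[OF cong_sym[OF window_rep_dvd[of E z y]], of c] by blast

lemma window_rep_pair:
  assumes E: "E \<ge> 2" and t: "\<not> E dvd (t - 1 - a)"
  shows "window_rep E t (a + 1) = window_rep E t a + 1"
proof (rule window_rep_eqI)
  have d: "E dvd (window_rep E t a - a)" by (rule window_rep_dvd)
  thus "E dvd (window_rep E t a + 1 - (a + 1))" by simp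
  have b: "t - E \<le> window_rep E t a" "window_rep E t a < t" using window_rep_bounds[of E t a] E by auto
  have "window_rep E t a \<noteq> t - 1" using d t by auto
  thus "t - E \<le> window_rep E t a + 1" "window_rep E t a + 1 < t" using b by auto
qed (use E in simp)

text \<open>By flushness above \<open>t\<close>, all beads from \<open>t\<close> on in the two
  runners of the class are live. So \<open>excess\<close> is \<le> 0 there, and its sum over a level
  depends only on numbers of beads. Both sets then have the same pending beads before a level and
  equally many live vacancies in it, hence equally many that get filled.\<close>

lemma level_equiv_drain:
  assumes E: "E \<ge> 2" and level_equiv: "level_equiv E x S T" and t: "\<not> E dvd (t - x)" "\<not> E dvd (t - 1 - x)"
    and fS: "\<And>y. t < y \<Longrightarrow> y \<in> S \<Longrightarrow> y - E \<in> S" and fT: "\<And>y. t < y \<Longrightarrow> y \<in> T \<Longrightarrow> y - E \<in> T"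
  shows "level_equiv E x (drain E S t) (drain E T t)"
proof -
  have E0: "E > 0" using E by simp
  have rx: "E dvd (window_rep E t y - c) \<longleftrightarrow> E dvd (y - c)" for y c
    by (rule window_rep_dvd_iff)
  have rx1: "E dvd (window_rep E t y - 1 - x) \<longleftrightarrow> E dvd (y - 1 - x)" for y
    using rx[of y "1 + x"] by (simp add: diff_diff_add)
  have window_rep_out: "window_rep E t y \<in> S \<longleftrightarrow> window_rep E t y \<in> T" if "\<not> E dvd (y - x)" "\<not> E dvd (y - 1 - x)" for y
    by (rule level_equivD(1)[OF level_equiv]) (use that rx rx1 in auto)
  have out: "excess E S t y = excess E T t y" if "\<not> E dvd (y - x)" "\<not> E dvd (y - 1 - x)" for y
    using window_rep_out[OF that] level_equivD(1)[OF level_equiv that] by (simp add: excess_def)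
  have pair: "window_rep E t (a + 1) = window_rep E t a + 1" if a: "E dvd (a - x)" for a
  proof (rule window_rep_pair[OF E])
    show "\<not> E dvd (t - 1 - a)" using cong_trans[OF _ a, of "t - 1"] t(2) by blast
  qed
  have tl: "t \<le> a \<longleftrightarrow> t \<le> a + 1" if "E dvd (a - x)" for a
  proof -
    have "t \<noteq> a + 1" using that t(2) by auto
    thus ?thesis by auto
  qed
  have blk: "excess E S t a + excess E S t (a + 1) = excess E T t a + excess E T t (a + 1)" if a: "E dvd (a - x)" for a
  proof (cases "t \<le> a")
    case True
    have "E dvd (window_rep E t a - x)" using rx a by simp
    from level_equivD(2)[OF level_equiv this] level_equivD(2)[OF level_equiv a] show ?thesis
      using True tl[OF a] by (simp add: excess_def pair[OF a])
  next
    case False thus ?thesis using tl[OF a] by (simp add: excess_def)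
  qed
  have liv: "window_rep E t y \<in> A" if A: "\<And>y. t < y \<Longrightarrow> y \<in> A \<Longrightarrow> y - E \<in> A" and y: "t \<le> y" "y \<in> A"
    and c: "E dvd (y - x) \<or> E dvd (y - 1 - x)" for A y
  proof (rule live_chain_class[OF E0 _ y(1) _ y(2)])
    show "E dvd (y - y)" by simp
    fix w assume w: "t \<le> w" "E dvd (w - y)" "w \<in> A"
    have "w \<noteq> t"
    proof
      assume "w = t"
      hence d: "E dvd (t - y)" using w by simp
      from c show False
      proof
        assume "E dvd (y - x)" thus False using cong_trans[OF d] t(1) by blast
      next
        assume c: "E dvd (y - 1 - x)"
        have "E dvd (t - 1 - (y - 1))" using d by simp
        from cong_trans[OF this c] show False using t(2) by simp
      qed
    qed
    thus "w - E \<in> A" using A w by simp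
  qed
  have np: "excess E A t y \<le> 0" if "\<And>y. t < y \<Longrightarrow> y \<in> A \<Longrightarrow> y - E \<in> A" "E dvd (y - x) \<or> E dvd (y - 1 - x)" for A y
    using liv[OF that(1) _ _ that(2)] by (auto simp: excess_def)
  have npS: "excess E S t y \<le> 0" and npT: "excess E T t y \<le> 0" if "E dvd (y - x) \<or> E dvd (y - 1 - x)" for y
    using np[OF fS that] np[OF fT that] by auto
  have pending: "pending E S t k y \<longleftrightarrow> pending E T t k y" if "\<not> E dvd (y - 1 - x)" "k \<ge> 0" for k y
    by (rule pending_blocks[where c = x, OF E out blk _ _ that]) (use npS npT in auto)
  have psuc: "pending E A t 0 (a + 1) \<longleftrightarrow> pending E A t (- excess E A t a) a" if "excess E A t a \<le> 0" for A a
    using pending_Suc[of 0 E A t a] that by auto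
  show ?thesis unfolding level_equiv_def
  proof (intro conjI allI impI)
    fix y assume y: "\<not> E dvd (y - x)" "\<not> E dvd (y - 1 - x)"
    show "y \<in> drain E S t \<longleftrightarrow> y \<in> drain E T t"
      using window_rep_out[OF y] level_equivD(1)[OF level_equiv y] pending[OF y(2), of 0] by (simp add: drain_def)
  next
    fix a assume a: "E dvd (a - x)"
    show "of_bool (a \<in> drain E S t) + of_bool (a + 1 \<in> drain E S t) =
        (of_bool (a \<in> drain E T t) + of_bool (a + 1 \<in> drain E T t) :: int)"
    proof (cases "t \<le> a")
      case False
      thus ?thesis using level_equivD(2)[OF level_equiv a] tl[OF a] by (simp add: drain_def)
    next
      case True
      let ?r = "window_rep E t a"
      have ra: "E dvd (?r - x)" using rx a by simp
      have na: "\<not> E dvd (a - 1 - x)" using not_dvd_one(2)[OF E a] by (simp add: algebra_simps)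
      have a1: "E dvd (a + 1 - 1 - x)" using a by simp
      have gS: "excess E S t a = of_bool (a \<in> S) - of_bool (?r \<in> S)"
        and gT: "excess E T t a = of_bool (a \<in> T) - of_bool (?r \<in> T)"
        using True by (auto simp: excess_def)
      have D: "(a \<in> drain E A t) = (?r \<in> A \<and> (a \<in> A \<or> pending E A t 0 a))"
        "(a + 1 \<in> drain E A t) = (?r + 1 \<in> A \<and> (a + 1 \<in> A \<or> pending E A t 0 (a + 1)))" for A
        using True tl[OF a] pair[OF a] by (auto simp: drain_def)
      have sS: "a \<in> S \<Longrightarrow> ?r \<in> S" "a + 1 \<in> S \<Longrightarrow> ?r + 1 \<in> S"
        using liv[OF fS True] liv[OF fS, of "a + 1"] True a a1 pair[OF a] by auto
      have sT: "a \<in> T \<Longrightarrow> ?r \<in> T" "a + 1 \<in> T \<Longrightarrow> ?r + 1 \<in> T"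
        using liv[OF fT True] liv[OF fT, of "a + 1"] True a a1 pair[OF a] by auto
      have P: "pending E S t 0 a = pending E T t 0 a" "pending E S t 1 a = pending E T t 1 a"
        using pending[OF na, of 0] pending[OF na, of 1] by auto
      \<comment> \<open>Passing \<open>a\<close> uses up one pending bead exactly when
        \<open>a\<close> is a live vacancy.\<close>
      have Q: "pending E S t 0 (a + 1) = (if a \<notin> S \<and> ?r \<in> S then pending E S t 1 a else pending E S t 0 a)"
        using psuc[of S a] npS[of a] a sS(1) gS by (auto split: if_splits)
      have R: "pending E T t 0 (a + 1) = (if a \<notin> T \<and> ?r \<in> T then pending E T t 1 a else pending E T t 0 a)"
        using psuc[of T a] npT[of a] a sT(1) gT by (auto split: if_splits)
      note c1 = level_equivD(2)[OF level_equiv a] and c2 = level_equivD(2)[OF level_equiv ra]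
      show ?thesis unfolding D Q R P using c1 c2 sS sT
        by (cases "a \<in> S"; cases "a + 1 \<in> S"; cases "a \<in> T"; cases "a + 1 \<in> T"; cases "?r \<in> S"; cases "?r \<in> T";
            cases "?r + 1 \<in> S"; cases "?r + 1 \<in> T"; simp)
    qed
  qed
qed

text \<open>As \<open>z - E\<close> is vacant, the left runner of the class is dead in both sets.
  From \<open>z\<close> on its positions end up empty, and a live right position is filled iff its
  level holds a bead or a bead is pending before the level. Both sets share these data.\<close>

lemma drain_merge:
  assumes E: "E \<ge> 2" and level_equiv: "level_equiv E x S T" and z: "E dvd (z - x)" "z - E \<notin> S"
    and eq: "\<And>y. y < z \<Longrightarrow> y \<in> S \<longleftrightarrow> y \<in> T"
  shows "drain E S z = drain E T z"
proof -
  have E0: "E > 0" using E by simp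
  have req: "window_rep E z y \<in> S \<longleftrightarrow> window_rep E z y \<in> T" for y
    using eq window_rep_bounds[OF E0, of z y] by simp
  have out: "excess E S z y = excess E T z y" if "\<not> E dvd (y - x)" "\<not> E dvd (y - 1 - x)" for y
    using req level_equivD(1)[OF level_equiv that] by (simp add: excess_def)
  have rz: "window_rep E z a = z - E" if a: "E dvd (a - x)" for a
  proof (rule window_rep_eqI[OF E0])
    have "E dvd (z - a)" using cong_trans[OF z(1) cong_sym[OF a]] .
    thus "E dvd (z - E - a)" by simp
  qed (use E in auto)
  have za: "z \<le> a + 1 \<longleftrightarrow> z \<le> a" if a: "E dvd (a - x)" for a
  proof -
    have "z \<noteq> a + 1" using not_dvd_one(1)[OF E a] z(1) by (auto simp: algebra_simps)
    thus ?thesis by auto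
  qed
  have dead: "window_rep E z a \<notin> S" "window_rep E z a \<notin> T" if "E dvd (a - x)" for a
    using rz[OF that] z(2) req[of a] by auto
  have blk: "excess E S z a + excess E S z (a + 1) = excess E T z a + excess E T z (a + 1)" if a: "E dvd (a - x)" for a
  proof -
    have "a + 1 < z \<longleftrightarrow> a < z" using za[OF a] by linarith
    thus ?thesis using level_equivD(2)[OF level_equiv a] dead[OF a] req[of "a + 1"] by (simp add: excess_def)
  qed
  have nn: "excess E S z a \<ge> 0" "excess E T z a \<ge> 0" if "E dvd (a - x)" for a
    using dead[OF that] by (auto simp: excess_def)
  have pending: "pending E S z k y \<longleftrightarrow> pending E T z k y" if "\<not> E dvd (y - 1 - x)" "k \<ge> 0" for k y
    by (rule pending_blocks[where c = x, OF E out blk _ _ that]) (use nn in auto)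
  show ?thesis
  proof (rule set_eqI)
    fix y
    show "y \<in> drain E S z \<longleftrightarrow> y \<in> drain E T z"
    proof (cases "y < z")
      case True thus ?thesis using eq by (simp add: drain_def)
    next
      case yz: False
      consider (l) "E dvd (y - x)" | (r) "E dvd (y - 1 - x)" | (o) "\<not> E dvd (y - x)" "\<not> E dvd (y - 1 - x)" by blast
      thus ?thesis
      proof cases
        case l thus ?thesis using dead yz by (simp add: drain_def)
      next
        case o thus ?thesis using level_equivD(1)[OF level_equiv o] req pending[OF o(2), of 0] by (simp add: drain_def)
      next
        case r
        define a where "a = y - 1"
        have a: "E dvd (a - x)" "y = a + 1" using r by (auto simp: a_def)
        have az: "z \<le> a" using za[OF a(1)] yz a(2) by auto
        have na: "\<not> E dvd (a - 1 - x)" using not_dvd_one(2)[OF E a(1)] by (simp add: algebra_simps)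
        have g: "excess E S z a = of_bool (a \<in> S)" "excess E T z a = of_bool (a \<in> T)"
          using dead[OF a(1)] az by (auto simp: excess_def)
        have PS: "pending E S z 0 (a + 1) \<longleftrightarrow> a \<in> S \<or> pending E S z 0 a"
          using pending_Suc[of 0 E S z a] g(1) by (cases "a \<in> S") auto
        have PT: "pending E T z 0 (a + 1) \<longleftrightarrow> a \<in> T \<or> pending E T z 0 a"
          using pending_Suc[of 0 E T z a] g(2) by (cases "a \<in> T") auto
        have "(a \<in> S \<or> a + 1 \<in> S) \<longleftrightarrow> (a \<in> T \<or> a + 1 \<in> T)"
          using level_equivD(2)[OF level_equiv a(1)]
          by (cases "a \<in> S"; cases "a + 1 \<in> S"; cases "a \<in> T"; cases "a + 1 \<in> T"; simp)
        thus ?thesis using yz req[of y] PS PT pending[OF na, of 0] unfolding a(2) drain_def by auto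
      qed
    qed
  qed
qed

text \<open>In the window starting at \<open>x\<close>, the left runner of the class is live and the
  right one dead; after the move it is the other way round. So from \<open>x + E\<close> on, each
  drained level has at most one bead, on opposite sides for the two sets, and without removable
  levels it is present in one iff in the other.\<close>

lemma drain_edge:
  assumes E: "E \<ge> 2" and x: "x \<in> K" "x + 1 \<notin> K"
    and R: "\<And>a. x < a \<Longrightarrow> E dvd (a - x) \<Longrightarrow> \<not> removable_at K a"
  shows "level_equiv E x (drain E K (x + E)) (drain E (K - {x} \<union> {x + 1}) (x + E))"
proof -
  let ?K = "K - {x} \<union> {x + 1}" and ?z = "x + E"
  have E0: "E > 0" using E by simp
  have rx: "E dvd (window_rep E ?z y - c) \<longleftrightarrow> E dvd (y - c)" for y c
    by (rule window_rep_dvd_iff)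
  have ra: "window_rep E ?z a = x" "window_rep E ?z (a + 1) = x + 1" if a: "E dvd (a - x)" for a
  proof -
    show "window_rep E ?z a = x" by (rule window_rep_eqI[OF E0]) (use cong_sym[OF a] E in auto)
    show "window_rep E ?z (a + 1) = x + 1" by (rule window_rep_eqI[OF E0]) (use cong_sym[OF a] E in auto)
  qed
  have za: "?z \<le> a + 1 \<longleftrightarrow> ?z \<le> a" if a: "E dvd (a - x)" for a
  proof -
    have "?z \<noteq> a + 1"
    proof
      assume "?z = a + 1"
      hence "a - x + 1 = E" by simp
      thus False using not_dvd_one(1)[OF E a] by simp
    qed
    thus ?thesis by auto
  qed
  have oK: "y \<in> ?K \<longleftrightarrow> y \<in> K" if "\<not> E dvd (y - x)" "\<not> E dvd (y - 1 - x)" for y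
  proof -
    have "y \<noteq> x" "y \<noteq> x + 1" using that by auto
    thus ?thesis by auto
  qed
  have hiK: "y \<in> ?K \<longleftrightarrow> y \<in> K" if "?z \<le> y" for y using that E by auto
  have window_rep_out: "window_rep E ?z y \<in> ?K \<longleftrightarrow> window_rep E ?z y \<in> K" if "\<not> E dvd (y - x)" "\<not> E dvd (y - 1 - x)" for y
    by (rule oK) (use rx[of y x] rx[of y "1 + x"] that in \<open>auto simp: diff_diff_add\<close>)
  have out: "excess E K ?z y = excess E ?K ?z y" if "\<not> E dvd (y - x)" "\<not> E dvd (y - 1 - x)" for y
    unfolding excess_def using window_rep_out[OF that] oK[OF that] by simp
  have gK: "excess E K ?z a = (if a < ?z then 0 else of_bool (a \<in> K) - 1)"
    "excess E K ?z (a + 1) = (if a < ?z then 0 else of_bool (a + 1 \<in> K))"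
    "excess E ?K ?z a = (if a < ?z then 0 else of_bool (a \<in> K))"
    "excess E ?K ?z (a + 1) = (if a < ?z then 0 else of_bool (a + 1 \<in> K) - 1)" if a: "E dvd (a - x)" for a
    using za[OF a] x hiK[of a] hiK[of "a + 1"] by (auto simp: excess_def ra[OF a])
  have noR: "a \<in> K" if "E dvd (a - x)" "\<not> a < ?z" "a + 1 \<in> K" for a
    using R[of a] that E by (auto simp: removable_at_def)
  have pending: "pending E K ?z k y \<longleftrightarrow> pending E ?K ?z k y" if "\<not> E dvd (y - 1 - x)" "k \<ge> 0" for k y
  proof (rule pending_blocks[where c = x, OF E out _ _ _ that])
    show "excess E K ?z a + excess E K ?z (a + 1) = excess E ?K ?z a + excess E ?K ?z (a + 1)" if "E dvd (a - x)" for a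
      unfolding gK[OF that] by simp
    show "0 \<le> excess E K ?z a \<or> excess E K ?z (a + 1) \<le> 0" if "E dvd (a - x)" for a
      unfolding gK[OF that] using noR[OF that] by auto
    show "0 \<le> excess E ?K ?z a \<or> excess E ?K ?z (a + 1) \<le> 0" if "E dvd (a - x)" for a
      unfolding gK[OF that] by auto
  qed
  show ?thesis unfolding level_equiv_def
  proof (intro conjI allI impI)
    fix y assume y: "\<not> E dvd (y - x)" "\<not> E dvd (y - 1 - x)"
    show "y \<in> drain E K ?z \<longleftrightarrow> y \<in> drain E ?K ?z"
      unfolding drain_def using window_rep_out[OF y] oK[OF y] pending[OF y(2), of 0] by simp
  next
    fix a assume a: "E dvd (a - x)"
    show "of_bool (a \<in> drain E K ?z) + of_bool (a + 1 \<in> drain E K ?z) =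
        (of_bool (a \<in> drain E ?K ?z) + of_bool (a + 1 \<in> drain E ?K ?z) :: int)"
    proof (cases "a < ?z")
      case True
      hence m: "(a \<in> drain E A ?z) = (a \<in> A)" "(a + 1 \<in> drain E A ?z) = (a + 1 \<in> A)" for A
        using za[OF a] by (auto simp: drain_def)
      have "a + 1 \<noteq> x" "a \<noteq> x + 1"
        using not_dvd_one(1)[OF E a] not_dvd_one(2)[OF E a] E by (auto simp: algebra_simps)
      thus ?thesis unfolding m using x by (cases "a = x") auto
    next
      case False
      have na: "\<not> E dvd (a - 1 - x)" using not_dvd_one(2)[OF E a] by (simp add: algebra_simps)
      have D: "(a \<in> drain E K ?z) = (a \<in> K \<or> pending E K ?z 0 a)" "a + 1 \<notin> drain E K ?z"
        "a \<notin> drain E ?K ?z" "(a + 1 \<in> drain E ?K ?z) = (a + 1 \<in> K \<or> pending E ?K ?z 0 (a + 1))"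
        using False za[OF a] x hiK[of "a + 1"] ra[OF a] by (auto simp: drain_def)
      have "pending E ?K ?z 0 (a + 1) \<longleftrightarrow> a \<in> K \<or> pending E ?K ?z 0 a"
        using pending_Suc[of 0 E ?K ?z a] False gK(3)[OF a] by (cases "a \<in> K") auto
      hence "(a \<in> drain E K ?z) = (a + 1 \<in> drain E ?K ?z)"
        using D noR[OF a False] pending[OF na, of 0] by blast
      thus ?thesis using D(2,3) by simp
    qed
  qed
qed

text \<open>
  The positions at which both sets are drained descend. The sets stay level-equivalent, and they merge
  as soon as a level below \<open>x\<close> is reached that is not full.
\<close>
lemma roof_stage:
  assumes e: "e \<ge> 2" and E: "E = int e" and J: "{..N} \<subseteq> J" and below: "below_ok E x J"
  shows "\<lbrakk>beta_like L; restricted E L; beta_like M; restricted E M; {..N} \<subseteq> L; {..N} \<subseteq> M; level_equiv E x L M;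
    \<And>y. t < y \<Longrightarrow> y \<in> L \<Longrightarrow> y - E \<in> L; \<And>y. t < y \<Longrightarrow> y \<in> M \<Longrightarrow> y - E \<in> M; t < x + E; \<not> E dvd (t - x);
    \<And>y. y \<le> t \<Longrightarrow> y < x \<Longrightarrow> (y \<in> L \<longleftrightarrow> y \<in> J) \<and> (y \<in> M \<longleftrightarrow> y \<in> J);
    \<And>a. E dvd (a - x) \<Longrightarrow> t - E < a \<Longrightarrow> a < x \<Longrightarrow> a \<in> J \<and> a + 1 \<in> J\<rbrakk> \<Longrightarrow>
    \<exists>K K'. is_roof e L K \<and> is_roof e M K' \<and>
      (K = K' \<or> (\<forall>a<x. E dvd (a - x) \<longrightarrow> a \<in> J \<and> a + 1 \<in> J) \<and> level_equiv E x K K')"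
proof (induction "nat (t - N)" arbitrary: t L M rule: less_induct)
  case less
  note bL = less.prems(1,2) and bM = less.prems(3,4) and NL = less.prems(5) and NM = less.prems(6)
    and level_equiv = less.prems(7) and fL = less.prems(8) and fM = less.prems(9) and tx = less.prems(10)
    and tn = less.prems(11) and low = less.prems(12) and full = less.prems(13)
  have E2: "E \<ge> 2" and E0: "E > 0" and e0: "e > 0" using e E by auto
  show ?case
  proof (cases "t \<le> N")
    case True
    have UL: "U_set e L = {}" if "\<And>y. t < y \<Longrightarrow> y \<in> L \<Longrightarrow> y - E \<in> L" "{..N} \<subseteq> L" for L
    proof -
      have "y - E \<in> L" if "y \<in> L" for y
      proof (cases "t < y")
        case False
        hence "y - E \<in> {..N}" using True E0 by simp
        thus ?thesis using \<open>{..N} \<subseteq> L\<close> by blast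
      qed (use \<open>y \<in> L\<close> \<open>\<And>y. t < y \<Longrightarrow> y \<in> L \<Longrightarrow> y - E \<in> L\<close> in blast)
      thus ?thesis using E by (auto simp: U_set_def)
    qed
    have "is_roof e L L" "is_roof e M M"
      using UL[OF fL NL] UL[OF fM NM] by (auto simp: is_roof_def intro: exI[of _ 0])
    moreover have "a \<in> J \<and> a + 1 \<in> J" if "a < x" "E dvd (a - x)" for a
    proof (cases "t - E < a")
      case False
      hence "a \<in> {..N}" "a + 1 \<in> {..N}" using True E2 by auto
      thus ?thesis using J by blast
    qed (use full that in blast)
    ultimately show ?thesis using level_equiv by blast
  next
    case tN: False
    show ?thesis
    proof (cases "E dvd (t - 1 - x)")
      case False
      have st: "drain_inv E t A" if "\<And>y. t < y \<Longrightarrow> y \<in> A \<Longrightarrow> y - E \<in> A" for A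
        by (rule drain_inv_start[OF E2]) (use that in auto)
      have dr: "\<exists>n. (up_beta e ^^ n) A = drain E A t \<and> (\<forall>y\<in>drain E A t. t \<le> y \<longrightarrow> y - E \<in> drain E A t)"
        if "beta_like A" "restricted E A" "\<And>y. t < y \<Longrightarrow> y \<in> A \<Longrightarrow> y - E \<in> A" for A
        using drain_reach[OF e0 that(1), of t] that(2) st[OF that(3)] E by simp
      obtain n where n: "(up_beta e ^^ n) L = drain E L t" "\<And>y. y \<in> drain E L t \<Longrightarrow> t \<le> y \<Longrightarrow> y - E \<in> drain E L t"
        using dr[OF bL fL] by blast
      obtain m where m: "(up_beta e ^^ m) M = drain E M t" "\<And>y. y \<in> drain E M t \<Longrightarrow> t \<le> y \<Longrightarrow> y - E \<in> drain E M t"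
        using dr[OF bM fM] by blast
      have dl: "y \<in> drain E A t \<longleftrightarrow> y \<in> A" if "y < t" for y A using that by (simp add: drain_def)
      have "\<exists>K K'. is_roof e (drain E L t) K \<and> is_roof e (drain E M t) K' \<and>
        (K = K' \<or> (\<forall>a<x. E dvd (a - x) \<longrightarrow> a \<in> J \<and> a + 1 \<in> J) \<and> level_equiv E x K K')"
      proof (rule less.hyps[of "t - 1"])
        show "nat (t - 1 - N) < nat (t - N)" using tN by simp
        show "beta_like (drain E L t)" "restricted E (drain E L t)"
          using up_iter_pres[OF e0 bL(1) bL(2)[unfolded E], of n] n(1) E by auto
        show "beta_like (drain E M t)" "restricted E (drain E M t)"
          using up_iter_pres[OF e0 bM(1) bM(2)[unfolded E], of m] m(1) E by auto
        show "{..N} \<subseteq> drain E L t" "{..N} \<subseteq> drain E M t" using NL NM tN dl by auto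
        show "level_equiv E x (drain E L t) (drain E M t)" by (rule level_equiv_drain[OF E2 level_equiv tn False fL fM])
        show "y - E \<in> drain E L t" if "t - 1 < y" "y \<in> drain E L t" for y using n(2) that by simp
        show "y - E \<in> drain E M t" if "t - 1 < y" "y \<in> drain E M t" for y using m(2) that by simp
        show "t - 1 < x + E" using tx by simp
        show "\<not> E dvd (t - 1 - x)" by (rule False)
        show "(y \<in> drain E L t \<longleftrightarrow> y \<in> J) \<and> (y \<in> drain E M t \<longleftrightarrow> y \<in> J)" if "y \<le> t - 1" "y < x" for y
          using low[of y] dl[of y] that by simp
        show "a \<in> J \<and> a + 1 \<in> J" if "E dvd (a - x)" "t - 1 - E < a" "a < x" for a
        proof -
          have "a \<noteq> t - E" using that(1) tn by auto
          thus ?thesis using full[of a] that by simp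
        qed
      qed
      then obtain K K' where "is_roof e (drain E L t) K" "is_roof e (drain E M t) K'"
        "K = K' \<or> (\<forall>a<x. E dvd (a - x) \<longrightarrow> a \<in> J \<and> a + 1 \<in> J) \<and> level_equiv E x K K'" by blast
      thus ?thesis using is_roof_step[of e n L K] is_roof_step[of e m M K'] n(1) m(1) by auto
    next
      case True
      define y where "y = t - 1"
      have y: "E dvd (y - x)" "t = y + 1" using True by (auto simp: y_def)
      have yx: "y \<le> x"
      proof (rule ccontr)
        assume "\<not> y \<le> x"
        hence "x \<le> y - E" using cong_gap[OF cong_sym[OF y(1)]] by simp
        thus False using tx y(2) by simp
      qed
      have w: "(v \<in> L \<longleftrightarrow> v \<in> J) \<and> (v \<in> M \<longleftrightarrow> v \<in> J)" if "v < y" for v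
        by (rule low) (use that yx y(2) in auto)
      have yE: "E dvd (y - E - x)" using y(1) by simp
      consider (full) "y - E \<in> J" "y + 1 - E \<in> J" | (l) "y - E \<notin> J" | (A) "y - E \<in> J" "y + 1 - E \<notin> J" by blast
      thus ?thesis
      proof cases
        case A
        \<comment> \<open>\<open>below_ok\<close> would put a removable level between
          \<open>y - E\<close> and \<open>x\<close>, but all levels there are known to be
          full.\<close>
        hence "addable_at J (y - E)" by (simp add: addable_at_def algebra_simps)
        then obtain b where b: "y - E < b" "b < x" "E dvd (b - x)" "removable_at J b"
          using below yE yx E0 unfolding below_ok_def by force
        have "y - E \<le> b - E" by (rule cong_gap[OF cong_trans[OF yE cong_sym[OF b(3)]] b(1)])
        hence "b \<in> J" using full[OF b(3) _ b(2)] y(2) E2 by simp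
        thus ?thesis using b(4) by (simp add: removable_at_def)
      next
        case l
        have st: "drain_inv E y A" if "\<And>v. t < v \<Longrightarrow> v \<in> A \<Longrightarrow> v - E \<in> A" "y - E \<notin> A" for A
          by (rule drain_inv_start[OF E2]) (use that y(2) in auto)
        have wl: "y - E \<notin> L" "y - E \<notin> M" using w[of "y - E"] l E0 by auto
        obtain n where n: "(up_beta e ^^ n) L = drain E L y"
          using drain_reach[OF e0 bL(1), of y] bL(2) st[OF fL wl(1)] E by auto
        obtain m where m: "(up_beta e ^^ m) M = drain E M y"
          using drain_reach[OF e0 bM(1), of y] bM(2) st[OF fM wl(2)] E by auto
        have eq: "drain E L y = drain E M y"
          by (rule drain_merge[OF E2 level_equiv y(1) wl(1)]) (use w in auto)
        have "beta_like (drain E L y)" "restricted (int e) (drain E L y)"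
          using up_iter_pres[OF e0 bL(1) bL(2)[unfolded E], of n] n by auto
        then obtain K where K: "is_roof e (drain E L y) K" using is_roof_exists[OF e0] by blast
        have "is_roof e L K" using is_roof_step[of e n L K] K n by simp
        moreover have "is_roof e M K" using is_roof_step[of e m M K] K m eq by simp
        ultimately show ?thesis by blast
      next
        case full': full
        show ?thesis
        proof (rule less.hyps[of "y - 1"])
          show "nat (y - 1 - N) < nat (t - N)" using tN y(2) by simp
          \<comment> \<open>Level \<open>y\<close> needs no draining because level
            \<open>y - E\<close> is full, so \<open>t\<close> descends by two at once.\<close>
          have in2: "v - E \<in> A" if "y - 1 < v" "v \<in> A" "\<And>v. t < v \<Longrightarrow> v \<in> A \<Longrightarrow> v - E \<in> A"
            "\<And>v. v < y \<Longrightarrow> v \<in> A \<longleftrightarrow> v \<in> J" for v A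
          proof -
            have "v = y \<or> v = y + 1 \<or> t < v" using that(1) y(2) by auto
            thus ?thesis using that(2,3) that(4)[of "y - E"] that(4)[of "y + 1 - E"] full' E2 by auto
          qed
          show "v - E \<in> L" if "y - 1 < v" "v \<in> L" for v by (rule in2[OF that fL]) (use w in auto)
          show "v - E \<in> M" if "y - 1 < v" "v \<in> M" for v by (rule in2[OF that fM]) (use w in auto)
          show "y - 1 < x + E" using yx E0 by simp
          show "\<not> E dvd (y - 1 - x)" using not_dvd_one(2)[OF E2 y(1)] by (simp add: algebra_simps)
          show "(v \<in> L \<longleftrightarrow> v \<in> J) \<and> (v \<in> M \<longleftrightarrow> v \<in> J)" if "v \<le> y - 1" "v < x" for v using w that by simp
          show "a \<in> J \<and> a + 1 \<in> J" if a: "E dvd (a - x)" "y - 1 - E < a" "a < x" for a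
          proof (cases "a = y - E")
            case True
            hence a1: "a + 1 = y + 1 - E" by simp
            have "a + 1 \<in> J" unfolding a1 by (rule full'(2))
            thus ?thesis using full'(1) True by simp
          next
            case False
            hence lt: "y - E < a" using a(2) by simp
            have "y - E \<le> a - E" by (rule cong_gap[OF cong_trans[OF yE cong_sym[OF a(1)]] lt])
            thus ?thesis using full[OF a(1) _ a(3)] y(2) E2 by simp
          qed
        qed (use bL bM NL NM level_equiv in auto)
      qed
    qed
  qed
qed

text \<open>Far above \<open>x\<close> both sets make the same moves. The drain at
  \<open>x + E\<close>, where the two runners have opposite roles in the two sets, leaves
  level-equivalent sets, and from there \<open>roof_stage\<close> takes over.\<close>

lemma roof_edge:
  assumes e: "e \<ge> 2" and E: "E = int e" and bd: "beta_like J" "restricted E J" "restricted E (J - {x} \<union> {x + 1})"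
    and x: "x \<in> J" "x + 1 \<notin> J" and below: "below_ok E x J" and above: "above_ok E x J"
    and roof: "is_roof e J K" "is_roof e (J - {x} \<union> {x + 1}) K'"
  shows "K = K' \<or> (\<forall>a<x. E dvd (a - x) \<longrightarrow> a \<in> J \<and> a + 1 \<in> J) \<and> level_equiv E x K K'"
proof -
  let ?J = "J - {x} \<union> {x + 1}"
  have E2: "E \<ge> 2" and E0: "E > 0" and e0: "e > 0" using e E by auto
  obtain N0 M where NM: "{..N0} \<subseteq> J" "J \<subseteq> {..M}" using bd(1) by (auto simp: beta_like_def)
  have "{..min N0 (x - 1)} \<subseteq> ?J" "?J \<subseteq> {..max M (x + 1)}" using NM by auto
  hence bd': "beta_like ?J" unfolding beta_like_def by blast
  define N where "N = min N0 (x - 1)"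
  have N: "{..N} \<subseteq> J" using NM(1) by (auto simp: N_def)
  have weak_above_ok: "weak_above_ok E x J" unfolding weak_above_ok_def
  proof (intro allI impI)
    fix a assume "x < a" "E dvd (a - x)" "removable_at J a"
    then obtain b where "x < b" "b < a" "E dvd (b - x)" "addable_at J b" using above unfolding above_ok_def by blast
    thus "\<exists>b. x < b \<and> b < a \<and> E dvd (b - x) \<and> b + 1 \<notin> J" by (auto simp: addable_at_def)
  qed
  obtain k where k: "U_set e ((up_beta e ^^ k) J) = {}" using up_terminates[OF e0 bd(1)] bd(2) E by auto
  obtain n F where F: "F = (up_beta e ^^ n) J" "F - {x} \<union> {x + 1} = (up_beta e ^^ n) ?J" "beta_like F" "restricted E F"
      "beta_like (F - {x} \<union> {x + 1})" "restricted E (F - {x} \<union> {x + 1})" "weak_above_ok E x F"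
      and fl: "\<And>y. y \<in> F \<Longrightarrow> x + E + 1 < y \<Longrightarrow> y - E \<in> F" and low: "\<And>y. y \<le> x + E + 1 \<Longrightarrow> y \<in> F \<longleftrightarrow> y \<in> J"
    using up_parallel[OF e0 E k bd(1,2) bd' bd(3) x weak_above_ok] by metis
  let ?F = "F - {x} \<union> {x + 1}" and ?z = "x + E"
  have xF: "x \<in> F" "x + 1 \<notin> F" using low[of x] low[of "x + 1"] x E0 by auto
  \<comment> \<open>The witness \<open>b\<close> from \<open>weak_above_ok\<close> is refuted:
    beyond \<open>x + E + 1\<close> the set is flush, so the bead \<open>a + 1\<close> forces beads
    down its runner as far as \<open>b + 1\<close>.\<close>
  have noR: "\<not> removable_at F a" if a: "x < a" "E dvd (a - x)" for a
  proof
    assume R: "removable_at F a"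
    then obtain b where b: "x < b" "b < a" "E dvd (b - x)" "b + 1 \<notin> F" using F(7) a unfolding weak_above_ok_def by blast
    have a1: "a + 1 \<in> F" using R by (simp add: removable_at_def)
    have xb: "x \<le> b - E" using cong_gap[OF cong_sym[OF b(3)] b(1)] .
    have ab: "E dvd (a + 1 - (b + 1 + E))" using cong_trans[OF a(2) cong_sym[OF b(3)]] unfolding cong_shift by simp
    have bE: "b \<le> a - E" using cong_gap[OF cong_trans[OF b(3) cong_sym[OF a(2)]] b(2)] .
    have fl': "y - E \<in> F" if "y \<in> F" "b + 1 < y" for y using fl[of y] that xb by simp
    from flush_above_down[OF E0 fl' _ a1 ab] have "b + 1 + E \<in> F" using bE E0 by simp
    hence "b + 1 \<in> F" using fl'[of "b + 1 + E"] E0 by simp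
    thus False using b(4) by simp
  qed
  have zJ: "?z \<in> F" if "?z + 1 \<in> F" using noR[of ?z] that E0 by (auto simp: removable_at_def)
  have st1: "drain_inv E ?z F"
    by (rule drain_inv_start[OF E2]) (use fl zJ in auto)
  have st2: "drain_inv E ?z ?F"
  proof (rule drain_inv_start[OF E2])
    show "y - E \<in> ?F" if "?z + 1 < y" "y \<in> ?F" for y using fl[of y] that E0 by auto
  qed simp
  obtain a where a: "(up_beta e ^^ a) F = drain E F ?z" "\<And>y. y \<in> drain E F ?z \<Longrightarrow> ?z \<le> y \<Longrightarrow> y - E \<in> drain E F ?z"
    using drain_reach[OF e0 F(3), of ?z] F(4) st1 E by auto
  obtain b where b: "(up_beta e ^^ b) ?F = drain E ?F ?z" "\<And>y. y \<in> drain E ?F ?z \<Longrightarrow> ?z \<le> y \<Longrightarrow> y - E \<in> drain E ?F ?z"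
    using drain_reach[OF e0 F(5), of ?z] F(6) st2 E by auto
  have dl: "y \<in> drain E A ?z \<longleftrightarrow> y \<in> A" if "y < ?z" for y A using that by (simp add: drain_def)
  have lowD: "(y \<in> drain E F ?z \<longleftrightarrow> y \<in> J) \<and> (y \<in> drain E ?F ?z \<longleftrightarrow> y \<in> J)" if "y < x" for y
    using dl[of y] low[of y] that E0 by auto
  have "\<exists>K K'. is_roof e (drain E F ?z) K \<and> is_roof e (drain E ?F ?z) K' \<and>
      (K = K' \<or> (\<forall>a<x. E dvd (a - x) \<longrightarrow> a \<in> J \<and> a + 1 \<in> J) \<and> level_equiv E x K K')"
  proof (rule roof_stage[OF e E N below, of _ _ "?z - 1"])
    show "beta_like (drain E F ?z)" "restricted E (drain E F ?z)"
      using up_iter_pres[OF e0 F(3) F(4)[unfolded E], of a] a(1) E by auto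
    show "beta_like (drain E ?F ?z)" "restricted E (drain E ?F ?z)"
      using up_iter_pres[OF e0 F(5) F(6)[unfolded E], of b] b(1) E by auto
    show "{..N} \<subseteq> drain E F ?z"
    proof
      fix v assume "v \<in> {..N}"
      hence "v < x" "v \<in> J" using N by (auto simp: N_def)
      thus "v \<in> drain E F ?z" using lowD by simp
    qed
    show "{..N} \<subseteq> drain E ?F ?z"
    proof
      fix v assume "v \<in> {..N}"
      hence "v < x" "v \<in> J" using N by (auto simp: N_def)
      thus "v \<in> drain E ?F ?z" using lowD by simp
    qed
    show "level_equiv E x (drain E F ?z) (drain E ?F ?z)" by (rule drain_edge[OF E2 xF noR])
    show "y - E \<in> drain E F ?z" if "?z - 1 < y" "y \<in> drain E F ?z" for y using a(2) that by simp
    show "y - E \<in> drain E ?F ?z" if "?z - 1 < y" "y \<in> drain E ?F ?z" for y using b(2) that by simp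
    show "\<not> E dvd (?z - 1 - x)" using not_dvd_one(2)[OF E2, of E] by (simp add: algebra_simps)
    show "(y \<in> drain E F ?z \<longleftrightarrow> y \<in> J) \<and> (y \<in> drain E ?F ?z \<longleftrightarrow> y \<in> J)" if "y \<le> ?z - 1" "y < x" for y
      using lowD that by simp
  qed (use E0 in auto)
  then obtain G G' where G: "is_roof e (drain E F ?z) G" "is_roof e (drain E ?F ?z) G'"
    "G = G' \<or> (\<forall>a<x. E dvd (a - x) \<longrightarrow> a \<in> J \<and> a + 1 \<in> J) \<and> level_equiv E x G G'" by blast
  have "is_roof e F G" "is_roof e ?F G'" using is_roof_step[of e a F G] is_roof_step[of e b ?F G'] G a(1) b(1) by auto
  hence "is_roof e J G" "is_roof e ?J G'" using is_roof_step[of e n J G] is_roof_step[of e n ?J G'] F(1,2) by auto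
  hence "G = K" "G' = K'" using is_roof_unique roof by blast+
  thus ?thesis using G(3) by simp
qed

section \<open>Partitions and beta sets\<close>

definition bead :: "part \<Rightarrow> nat \<Rightarrow> int" where
  "bead lam k = int (lam k) - int k"

lemma beta_set_bead: "beta_set c lam = range (\<lambda>k. bead lam k + c)"
  unfolding beta_set_def bead_def by (rule arg_cong[where f = range]) auto

lemma beta_set_0: "beta_set 0 lam = range (bead lam)"
  by (simp add: beta_set_bead)

lemma in_beta_set: "x \<in> beta_set c lam \<longleftrightarrow> x - c \<in> beta_set 0 lam"
  by (auto simp: beta_set_bead image_iff algebra_simps)

lemma bead_less:
  assumes "is_partition lam" "k < l" shows "bead lam l < bead lam k"
proof -
  have "lam l \<le> lam k" using assms by (simp add: antimonoD is_partition_def)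
  thus ?thesis using assms(2) by (simp add: bead_def)
qed

lemma bead_less_iff: "is_partition lam \<Longrightarrow> bead lam l < bead lam k \<longleftrightarrow> k < l"
  using bead_less[of lam k l] bead_less[of lam l k] by (cases k l rule: linorder_cases) auto

lemma bead_inj: "is_partition lam \<Longrightarrow> bead lam k = bead lam l \<longleftrightarrow> k = l"
  using bead_less[of lam k l] bead_less[of lam l k] by (cases k l rule: linorder_cases) auto

lemma part_support:
  assumes "is_partition lam" shows "lam k \<noteq> 0 \<longleftrightarrow> k < card {k. lam k \<noteq> 0}"
proof -
  let ?A = "{k. lam k \<noteq> 0}"
  have fin: "finite ?A" using assms by (simp add: is_partition_def)
  have dn: "l \<in> ?A" if "l \<le> k" "k \<in> ?A" for k l
  proof -
    have "lam k \<le> lam l" using assms that(1) by (simp add: antimonoD is_partition_def)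
    thus ?thesis using that(2) by simp
  qed
  have *: "{..k} \<subseteq> ?A" if "k \<in> ?A" for k using dn[OF _ that] by blast
  show ?thesis
  proof
    assume "lam k \<noteq> 0"
    hence "card {..k} \<le> card ?A" using *[of k] fin by (intro card_mono) auto
    thus "k < card ?A" by simp
  next
    assume k: "k < card ?A"
    show "lam k \<noteq> 0"
    proof
      assume "lam k = 0"
      hence "k \<notin> ?A" by simp
      hence "?A \<subseteq> {..<k}" using dn by (meson lessThan_iff linorder_not_le subsetI)
      hence "card ?A \<le> card {..<k}" by (intro card_mono) auto
      thus False using k by simp
    qed
  qed
qed

text \<open>Exactly the beta sets of charge \<open>c\<close>, by \<open>charged_beta_set\<close> and
  \<open>charged_partition\<close>. The condition survives the move of a bead, so
  \<open>part_of_beta\<close> is meaningful after each step of \<open>up\<close> and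
  \<open>down\<close>.\<close>

definition charged :: "int \<Rightarrow> int set \<Rightarrow> bool" where
  "charged c J \<longleftrightarrow> (\<exists>N. {..N} \<subseteq> J \<and> finite (J \<inter> {N<..}) \<and> int (card (J \<inter> {N<..})) = c - N)"

lemma charged_lower:
  assumes "{..N} \<subseteq> J" "finite (J \<inter> {N<..})" "int (card (J \<inter> {N<..})) = c - N" "N' \<le> N"
  shows "finite (J \<inter> {N'<..}) \<and> int (card (J \<inter> {N'<..})) = c - N'"
proof -
  have "J \<inter> {N'<..} = {N'<..N} \<union> (J \<inter> {N<..})" using assms by auto
  moreover have "card ({N'<..N} \<union> (J \<inter> {N<..})) = card {N'<..N} + card (J \<inter> {N<..})"
    using assms by (intro card_Un_disjoint) auto
  ultimately show ?thesis using assms by simp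
qed

lemma charged_beta_set:
  assumes "is_partition lam" shows "charged c (beta_set c lam)"
proof -
  define n where "n = card {k. lam k \<noteq> 0}"
  have z: "lam k = 0 \<longleftrightarrow> n \<le> k" for k
    using part_support[OF assms, of k] unfolding n_def by linarith
  define N where "N = c - int n"
  have low: "{..N} \<subseteq> beta_set c lam"
  proof
    fix x assume "x \<in> {..N}"
    hence x: "x \<le> N" by simp
    hence "n \<le> nat (c - x)" by (simp add: N_def)
    hence "bead lam (nat (c - x)) + c = x" using x z[of "nat (c - x)"] by (simp add: bead_def N_def)
    thus "x \<in> beta_set c lam" unfolding beta_set_bead by (metis rangeI)
  qed
  have lt: "N < bead lam k + c \<longleftrightarrow> k < n" for k
  proof (cases "k < n")
    case True
    hence "lam k \<noteq> 0" using z[of k] by simp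
    thus ?thesis using True by (simp add: bead_def N_def)
  next
    case False
    hence "lam k = 0" using z[of k] by simp
    thus ?thesis using False by (simp add: bead_def N_def)
  qed
  have eq: "beta_set c lam \<inter> {N<..} = (\<lambda>k. bead lam k + c) ` {..<n}"
  proof (intro equalityI subsetI)
    fix x assume "x \<in> beta_set c lam \<inter> {N<..}"
    then obtain k where k: "x = bead lam k + c" "N < x" unfolding beta_set_bead by blast
    thus "x \<in> (\<lambda>k. bead lam k + c) ` {..<n}" using lt[of k] by simp
  next
    fix x assume "x \<in> (\<lambda>k. bead lam k + c) ` {..<n}"
    then obtain k where k: "x = bead lam k + c" "k < n" by blast
    thus "x \<in> beta_set c lam \<inter> {N<..}" using lt[of k] by (simp add: beta_set_bead)
  qed
  have "inj_on (\<lambda>k. bead lam k + c) {..<n}" by (rule inj_onI) (simp add: bead_inj[OF assms])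
  hence "card ((\<lambda>k. bead lam k + c) ` {..<n}) = n" by (simp add: card_image)
  hence "finite (beta_set c lam \<inter> {N<..}) \<and> int (card (beta_set c lam \<inter> {N<..})) = c - N"
    unfolding eq by (simp add: N_def)
  thus ?thesis unfolding charged_def using low by blast
qed

lemma charged_beta_like: "charged c J \<Longrightarrow> beta_like J"
proof -
  assume "charged c J"
  then obtain N where N: "{..N} \<subseteq> J" "finite (J \<inter> {N<..})" by (auto simp: charged_def)
  define M where "M = Max (insert N (J \<inter> {N<..}))"
  have M: "x \<le> M" if "x \<in> insert N (J \<inter> {N<..})" for x
    unfolding M_def by (rule Max_ge[OF _ that]) (use N(2) in simp)
  have "J \<subseteq> {..M}"
  proof
    fix x assume "x \<in> J"
    thus "x \<in> {..M}" using M[of x] M[of N] by (cases "N < x") auto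
  qed
  thus ?thesis using N(1) unfolding beta_like_def by blast
qed

lemma charged_move:
  assumes "charged c J" "p \<in> J" "q \<notin> J" shows "charged c (J - {p} \<union> {q})"
proof -
  obtain N where N: "{..N} \<subseteq> J" "finite (J \<inter> {N<..})" "int (card (J \<inter> {N<..})) = c - N"
    using assms(1) by (auto simp: charged_def)
  define N' where "N' = min N (min p q - 1)"
  have N': "finite (J \<inter> {N'<..})" "int (card (J \<inter> {N'<..})) = c - N'" "N' < p" "N' < q" "{..N'} \<subseteq> J"
    using charged_lower[OF N, of N'] N(1) by (auto simp: N'_def)
  have "(J - {p} \<union> {q}) \<inter> {N'<..} = insert q (J \<inter> {N'<..} - {p})" using N' by auto
  moreover have "card (insert q (J \<inter> {N'<..} - {p})) = Suc (card (J \<inter> {N'<..} - {p}))"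
    using N'(1) assms(3) by (intro card_insert_disjoint) simp_all
  moreover have "Suc (card (J \<inter> {N'<..} - {p})) = card (J \<inter> {N'<..})"
    using N'(3) assms(2) by (intro card_Suc_Diff1[OF N'(1)]) simp
  moreover have "{..N'} \<subseteq> J - {p} \<union> {q}" using N' by auto
  ultimately show ?thesis unfolding charged_def using N'(1,2) by (intro exI[of _ N']) simp
qed

text \<open>The beads above \<open>N\<close> in decreasing order are the first
  \<open>L = c - N\<close> rows. Being distinct integers they give weakly decreasing parts, and the
  last one, lying above \<open>N\<close>, keeps all parts nonnegative.\<close>

lemma charged_partition:
  assumes "charged c J" shows "\<exists>lam. is_partition lam \<and> beta_set c lam = J"
proof -
  obtain N where N: "{..N} \<subseteq> J" "finite (J \<inter> {N<..})" "int (card (J \<inter> {N<..})) = c - N"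
    using assms by (auto simp: charged_def)
  define xs where "xs = rev (sorted_list_of_set (J \<inter> {N<..}))"
  define L where "L = length xs"
  have L: "int L = c - N" using N(3) by (simp add: L_def xs_def)
  have set: "set xs = J \<inter> {N<..}" using N(2) by (simp add: xs_def)
  have dec: "xs ! l + int (l - k) \<le> xs ! k" if "k \<le> l" "l < L" for k l
    using that
  proof (induction l rule: dec_induct)
    case (step l)
    have "sorted_wrt (<) (rev xs)" by (simp add: xs_def strict_sorted_list_of_set)
    hence "sorted_wrt (>) xs" by (simp add: sorted_wrt_rev)
    hence "xs ! Suc l < xs ! l" using step.prems by (auto simp: sorted_wrt_iff_nth_less L_def)
    moreover have "int (Suc l - k) = int (l - k) + 1" using step.hyps by simp
    ultimately show ?case using step by simp
  qed simp
  have gt: "N < xs ! k" if "k < L" for k using that set nth_mem[of k xs] by (auto simp: L_def)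
  have ge: "xs ! k - c + int k \<ge> 0" if "k < L" for k
  proof -
    have "xs ! (L - 1) + int (L - 1 - k) \<le> xs ! k" by (rule dec) (use that in auto)
    moreover have "N < xs ! (L - 1)" by (rule gt) (use that in simp)
    moreover have "int (L - 1 - k) = int L - 1 - int k" using that by (simp add: of_nat_diff)
    ultimately show ?thesis using L by linarith
  qed
  define lam where "lam = (\<lambda>k. if k < L then nat (xs ! k - c + int k) else 0)"
  have j: "int (lam k) + c - int k = (if k < L then xs ! k else c - int k)" for k
    using ge[of k] by (simp add: lam_def)
  have "antimono lam"
  proof (rule antimonoI)
    fix k l :: nat assume kl: "k \<le> l"
    show "lam l \<le> lam k"
    proof (cases "l < L")
      case True
      thus ?thesis using dec[OF kl True] kl by (simp add: lam_def of_nat_diff)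
    qed (simp add: lam_def)
  qed
  moreover have "{k. lam k \<noteq> 0} \<subseteq> {..<L}" by (auto simp: lam_def)
  hence "finite {k. lam k \<noteq> 0}" by (rule finite_subset) simp
  moreover have "beta_set c lam = J"
  proof -
    have "range (\<lambda>k. int (lam k) + c - int k) = set xs \<union> {..N}"
    proof (intro equalityI subsetI)
      fix x assume "x \<in> range (\<lambda>k. int (lam k) + c - int k)"
      then obtain k where "x = int (lam k) + c - int k" by blast
      hence "x = (if k < L then xs ! k else c - int k)" using j[of k] by simp
      thus "x \<in> set xs \<union> {..N}" using L by (auto simp: L_def split: if_splits)
    next
      fix x assume "x \<in> set xs \<union> {..N}"
      thus "x \<in> range (\<lambda>k. int (lam k) + c - int k)"
      proof
        assume "x \<in> set xs"
        then obtain k where "k < L" "xs ! k = x" by (auto simp: in_set_conv_nth L_def)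
        thus ?thesis using j[of k] by (intro range_eqI[of _ _ k]) simp
      next
        assume "x \<in> {..N}"
        thus ?thesis using j[of "nat (c - x)"] L by (intro range_eqI[of _ _ "nat (c - x)"]) auto
      qed
    qed
    also have "\<dots> = J" using set N(1) by auto
    finally show ?thesis by (simp add: beta_set_def)
  qed
  ultimately show ?thesis by (auto simp: is_partition_def)
qed

section \<open>Inclusion of diagrams in terms of bead counts\<close>

definition dominated :: "int set \<Rightarrow> int set \<Rightarrow> bool" where
  "dominated J K \<longleftrightarrow> (\<forall>y. card (J \<inter> {y..}) \<le> card (K \<inter> {y..}))"

lemma card_beta_set_ge:
  assumes "is_partition lam"
  shows "card (beta_set c lam \<inter> {y..}) = card {k. y \<le> bead lam k + c}" "finite {k. y \<le> bead lam k + c}"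
proof -
  have "beta_set c lam \<inter> {y..} = (\<lambda>k. bead lam k + c) ` {k. y \<le> bead lam k + c}"
    by (auto simp: beta_set_bead)
  moreover have "inj (\<lambda>k. bead lam k + c)" by (auto simp: inj_def bead_inj[OF assms])
  ultimately show "card (beta_set c lam \<inter> {y..}) = card {k. y \<le> bead lam k + c}"
    by (metis card_image inj_on_subset subset_UNIV)
  have "bead lam k + c \<le> int (lam 0) + c - int k" for k

    using bead_less[OF assms, of 0 k] antimonoD[of lam 0 k] assms by (simp add: is_partition_def bead_def)
  hence *: "int k \<le> int (lam 0) + c - y" if "y \<le> bead lam k + c" for k using that by (smt (verit))
  have "{k. y \<le> bead lam k + c} \<subseteq> {..nat (int (lam 0) + c - y)}"
  proof
    fix k assume "k \<in> {k. y \<le> bead lam k + c}"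
    thus "k \<in> {..nat (int (lam 0) + c - y)}" using *[of k] by simp
  qed
  thus "finite {k. y \<le> bead lam k + c}" by (rule finite_subset) simp
qed

text \<open>Row \<open>k\<close> is recovered from the count at \<open>y = bead lam k + c\<close>:
  there \<open>lam\<close> has exactly \<open>k + 1\<close> beads, so \<mu> has a bead of index at
  least \<open>k\<close> that is not lower.\<close>

lemma sub_diagram_iff:
  assumes lam: "is_partition lam" and mu: "is_partition \<mu>"
  shows "sub_diagram lam \<mu> \<longleftrightarrow> dominated (beta_set c lam) (beta_set c \<mu>)"
proof
  assume "sub_diagram lam \<mu>"
  hence le: "bead lam k \<le> bead \<mu> k" for k by (simp add: sub_diagram_def bead_def)
  have "card {k. y \<le> bead lam k + c} \<le> card {k. y \<le> bead \<mu> k + c}" for y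
  proof (rule card_mono[OF card_beta_set_ge(2)[OF mu]])
    show "{k. y \<le> bead lam k + c} \<subseteq> {k. y \<le> bead \<mu> k + c}"
    proof
      fix k assume "k \<in> {k. y \<le> bead lam k + c}"
      thus "k \<in> {k. y \<le> bead \<mu> k + c}" using le[of k] by simp
    qed
  qed
  thus "dominated (beta_set c lam) (beta_set c \<mu>)"
    by (simp add: dominated_def card_beta_set_ge(1)[OF lam] card_beta_set_ge(1)[OF mu])
next
  assume dom: "dominated (beta_set c lam) (beta_set c \<mu>)"
  have eq: "{l. bead \<nu> k + c \<le> bead \<nu> l + c} = {..k}" if "is_partition \<nu>" for k \<nu>
  proof -
    have "bead \<nu> k + c \<le> bead \<nu> l + c \<longleftrightarrow> l \<le> k" for l
      using bead_less_iff[OF that, of l k] by linarith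
    thus ?thesis by auto
  qed
  show "sub_diagram lam \<mu>" unfolding sub_diagram_def
  proof
    fix k
    let ?A = "{l. bead lam k + c \<le> bead \<mu> l + c}"
    have "card {..k} \<le> card ?A"
      using dom eq[OF lam, of k] unfolding dominated_def card_beta_set_ge(1)[OF lam] card_beta_set_ge(1)[OF mu]
      by metis
    hence "\<not> ?A \<subseteq> {..<k}" using card_mono[of "{..<k}" ?A] by auto
    then obtain l where "l \<in> ?A" "l \<notin> {..<k}" by blast
    hence l: "l \<in> ?A" "k \<le> l" by simp_all
    have "bead \<mu> l \<le> bead \<mu> k" using bead_less[OF mu, of k l] l(2) by (cases "k = l") auto
    hence "bead lam k \<le> bead \<mu> k" using l(1) by simp
    thus "lam k \<le> \<mu> k" by (simp add: bead_def)
  qed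
qed

lemma beta_set_inj:
  assumes "is_partition lam" "is_partition \<mu>" "beta_set c lam = beta_set c \<mu>" shows "lam = \<mu>"
proof
  fix k
  have "sub_diagram lam \<mu>" "sub_diagram \<mu> lam"
    using assms(3) by (auto simp: sub_diagram_iff[OF assms(1,2), of c] sub_diagram_iff[OF assms(2,1), of c] dominated_def)
  thus "lam k = \<mu> k" by (simp add: sub_diagram_def order_antisym)
qed

lemma part_of_beta_eq:
  assumes "is_partition lam" "beta_set c lam = J" shows "part_of_beta c J = lam"
  unfolding part_of_beta_def
  by (rule the_equality) (use assms beta_set_inj in blast)+

lemma part_of_beta_charged:
  assumes "charged c J" shows "is_partition (part_of_beta c J)" "beta_set c (part_of_beta c J) = J"
proof -
  obtain lam where lam: "is_partition lam" "beta_set c lam = J" using charged_partition[OF assms] by blast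
  show "is_partition (part_of_beta c J)" "beta_set c (part_of_beta c J) = J"
    using part_of_beta_eq[OF lam] lam by auto
qed

section \<open>Base and roof of a partition through its beta set\<close>

lemma restricted_beta_set:
  assumes "e_restricted e lam" shows "restricted (int e) (beta_set 0 lam)"
  unfolding restricted_def
proof
  fix x assume "x \<in> beta_set 0 lam"
  then obtain k where k: "x = bead lam k" by (auto simp: beta_set_0)
  have "is_partition lam" "lam k - lam (Suc k) < e" using assms by (auto simp: e_restricted_def)
  hence "x - int e \<le> bead lam (Suc k) \<and> bead lam (Suc k) < x"
    using bead_less[of lam k "Suc k"] unfolding k by (auto simp: bead_def)
  thus "\<exists>y\<in>beta_set 0 lam. x - int e \<le> y \<and> y < x" by (auto simp: beta_set_0)
qed

lemma e_restricted_beta_set: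
  assumes "is_partition lam" "e > 0" "restricted (int e) (beta_set 0 lam)" shows "e_restricted e lam"
  unfolding e_restricted_def
proof (intro conjI allI)
  fix k
  obtain l where l: "bead lam k - int e \<le> bead lam l" "bead lam l < bead lam k"
    using assms(3) by (auto simp: restricted_def beta_set_0)
  have "k < l" using l(2) bead_less_iff[OF assms(1)] by blast
  hence "bead lam l \<le> bead lam (Suc k)" using bead_less[OF assms(1), of "Suc k" l] by (cases "Suc k = l") auto
  hence "int (lam k) - int e + 1 \<le> int (lam (Suc k))" using l(1) by (simp add: bead_def)
  thus "lam k - lam (Suc k) < e" using assms(2) by linarith
qed (rule assms(1))

lemma base_spec:
  assumes e: "e > 0" and lam: "is_partition lam"
  shows "is_partition (base e lam)" "is_base e (beta_set 0 lam) (beta_set 0 (base e lam))"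
proof -
  have it: "is_partition ((down e ^^ n) lam) \<and>
      beta_set 0 ((down e ^^ n) lam) = (down_beta e ^^ n) (beta_set 0 lam)" for n
  proof (induction n)
    case (Suc n)
    let ?l = "(down e ^^ n) lam" and ?J = "(down_beta e ^^ n) (beta_set 0 lam)"
    have ch: "charged 0 ?J" using charged_beta_set[of ?l 0] Suc by simp
    then obtain N M where NM: "{..N} \<subseteq> ?J" "?J \<subseteq> {..M}" using charged_beta_like unfolding beta_like_def by blast
    have "charged 0 (down_beta e ?J)"
    proof (cases "U_set e ?J = {}")
      case False
      obtain p q where pq: "p - int e \<notin> ?J" "q \<in> ?J" "down_beta e ?J = ?J - {q} \<union> {p - int e}"
        using down_betaE[OF e NM False] by metis
      thus ?thesis using charged_move[OF ch pq(2,1)] by simp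
    qed (use ch in \<open>simp add: down_beta_def\<close>)
    from part_of_beta_charged[OF this] show ?case using Suc by (simp add: down_def)
  qed (use lam in simp)
  obtain N M where NM: "{..N} \<subseteq> beta_set 0 lam" "beta_set 0 lam \<subseteq> {..M}"
    using charged_beta_like[OF charged_beta_set[OF lam]] unfolding beta_like_def by blast
  have "is_base e (beta_set 0 lam) (ins_upto (int e) (beta_set 0 lam) (N - int e) (nat (M - (N - int e))))"
    by (rule is_base_ins_upto[OF e _ NM(2)]) (use NM(1) in auto)
  then obtain n where n: "U_set e ((down_beta e ^^ n) (beta_set 0 lam)) = {}" by (auto simp: is_base_def)
  let ?r = "(down e ^^ n) lam"
  have eq: "beta_set 0 ?r = (down_beta e ^^ n) (beta_set 0 lam)" "is_partition ?r" using it[of n] by auto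
  have 2: "is_base e (beta_set 0 lam) (beta_set 0 ?r)"
    unfolding is_base_def eq(1) using n by blast
  have "e_core e ?r" using eq n by (simp add: e_core_def)
  moreover have "\<rho> = ?r" if "e_core e \<rho>" "\<rho> = (down e ^^ k) lam" for \<rho> k
  proof -
    have "beta_set 0 \<rho> = (down_beta e ^^ k) (beta_set 0 lam)" "U_set e (beta_set 0 \<rho>) = {}"
      using it[of k] that by (simp_all add: e_core_def)
    hence 1: "is_base e (beta_set 0 lam) (beta_set 0 \<rho>)" unfolding is_base_def by blast
    show ?thesis
      by (rule beta_set_inj[of _ _ 0, OF _ _ is_base_unique[OF 1 2]]) (use that(1) eq(2) in \<open>simp_all add: e_core_def\<close>)
  qed
  ultimately have "base e lam = ?r" unfolding base_def by (intro the_equality) blast+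
  thus "is_partition (base e lam)" "is_base e (beta_set 0 lam) (beta_set 0 (base e lam))"
    using eq(2) 2 by simp_all
qed

lemma roof_spec:
  assumes e: "e > 0" and lam: "e_restricted e lam"
  shows "is_partition (roof e lam)" "is_roof e (beta_set 0 lam) (beta_set 0 (roof e lam))"
proof -
  have part: "is_partition lam" using lam by (simp add: e_restricted_def)
  have bd: "beta_like (beta_set 0 lam)" by (rule charged_beta_like[OF charged_beta_set[OF part]])
  have rs: "restricted (int e) (beta_set 0 lam)" by (rule restricted_beta_set[OF lam])
  have it: "is_partition ((up e ^^ n) lam) \<and>
      beta_set 0 ((up e ^^ n) lam) = (up_beta e ^^ n) (beta_set 0 lam)" for n
  proof (induction n)
    case (Suc n)
    let ?l = "(up e ^^ n) lam" and ?J = "(up_beta e ^^ n) (beta_set 0 lam)"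
    have ch: "charged 0 ?J" using charged_beta_set[of ?l 0] Suc by simp
    have bd': "beta_like ?J" "restricted (int e) ?J" using up_iter_pres[OF e bd rs, of n] by auto
    have "charged 0 (up_beta e ?J)"
    proof (cases "U_set e ?J = {}")
      case False
      obtain p q where pq: "is_pq (int e) ?J p q" "up_beta e ?J = ?J - {p} \<union> {q}"
        using up_betaE[OF e bd' False] by blast
      thus ?thesis using charged_move[OF ch is_pqD(1,7)[OF pq(1)]] by simp
    qed (use ch in \<open>simp add: up_beta_def\<close>)
    from part_of_beta_charged[OF this] show ?case using Suc by (simp add: up_def)
  qed (use part in simp)
  obtain n where n: "U_set e ((up_beta e ^^ n) (beta_set 0 lam)) = {}" using up_terminates[OF e bd rs] by blast
  let ?r = "(up e ^^ n) lam"
  have eq: "beta_set 0 ?r = (up_beta e ^^ n) (beta_set 0 lam)" "is_partition ?r" using it[of n] by auto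
  have 2: "is_roof e (beta_set 0 lam) (beta_set 0 ?r)"
    unfolding is_roof_def eq(1) using n by blast
  have "e_core e ?r" using eq n by (simp add: e_core_def)
  moreover have "\<rho> = ?r" if "e_core e \<rho>" "\<rho> = (up e ^^ k) lam" for \<rho> k
  proof -
    have "beta_set 0 \<rho> = (up_beta e ^^ k) (beta_set 0 lam)" "U_set e (beta_set 0 \<rho>) = {}"
      using it[of k] that by (simp_all add: e_core_def)
    hence 1: "is_roof e (beta_set 0 lam) (beta_set 0 \<rho>)" unfolding is_roof_def by blast
    show ?thesis
      by (rule beta_set_inj[of _ _ 0, OF _ _ is_roof_unique[OF 1 2]]) (use that(1) eq(2) in \<open>simp_all add: e_core_def\<close>)
  qed
  ultimately have "roof e lam = ?r" unfolding roof_def by (intro the_equality) blast+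
  thus "is_partition (roof e lam)" "is_roof e (beta_set 0 lam) (beta_set 0 (roof e lam))"
    using eq(2) 2 by simp_all
qed

section \<open>The map \<open>\<tau>\<^sub>m\<close>\<close>

text \<open>For a core these are the positions \<open>M_beta e J i + int e\<close>, one on each
  runner.\<close>

definition vacancies :: "int \<Rightarrow> int set \<Rightarrow> int set" where
  "vacancies E J = {w. w \<notin> J \<and> w - E \<in> J}"

text \<open>The sorted list in \<open>tau\<close> becomes a condition on ranks, which can be
  transported along order-preserving maps.\<close>

definition tau_set :: "int \<Rightarrow> nat \<Rightarrow> int set \<Rightarrow> int set" where
  "tau_set E m J = J \<union> {x \<in> vacancies E J. card {w \<in> vacancies E J. x < w} < m}"

lemma finite_vacancies: "beta_like J \<Longrightarrow> finite (vacancies E J)"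
proof -
  assume "beta_like J"
  then obtain N M where NM: "{..N} \<subseteq> J" "J \<subseteq> {..M}" by (auto simp: beta_like_def)
  have "vacancies E J \<subseteq> {N..M + E}"
  proof
    fix w assume w: "w \<in> vacancies E J"
    have "w - E \<le> M" using w NM(2) unfolding vacancies_def by blast
    moreover have "\<not> w \<le> N" using w NM(1) unfolding vacancies_def by blast
    ultimately show "w \<in> {N..M + E}" by simp
  qed
  thus ?thesis by (rule finite_subset) simp
qed

lemma set_take_rev_sorted_list:
  fixes A :: "int set"
  assumes fin: "finite A"
  shows "set (take m (rev (sorted_list_of_set A))) = {x \<in> A. card {y \<in> A. x < y} < m}"
proof -
  define ys where "ys = rev (sorted_list_of_set A)"
  have set: "set ys = A" using fin by (simp add: ys_def)
  have dec: "sorted_wrt (>) ys" by (simp add: ys_def sorted_wrt_rev strict_sorted_list_of_set)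
  have dist: "distinct ys" by (simp add: ys_def)
  have lt: "ys ! l < ys ! k \<longleftrightarrow> k < l" if "k < length ys" "l < length ys" for k l
    using dec that by (metis linorder_neqE_nat order_less_asym sorted_wrt_iff_nth_less)
  have card: "card {y \<in> A. ys ! k < y} = k" if k: "k < length ys" for k
  proof -
    have "{y \<in> A. ys ! k < y} = (\<lambda>l. ys ! l) ` {..<k}"
    proof (intro equalityI subsetI)
      fix y assume y: "y \<in> {y \<in> A. ys ! k < y}"
      then obtain l where l: "l < length ys" "y = ys ! l" using set by (auto simp: in_set_conv_nth)
      thus "y \<in> (\<lambda>l. ys ! l) ` {..<k}" using lt[OF l(1) k] y by blast
    next
      fix y assume "y \<in> (\<lambda>l. ys ! l) ` {..<k}"
      then obtain l where l: "l < k" "y = ys ! l" by blast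
      have "l < length ys" using l k by simp
      thus "y \<in> {y \<in> A. ys ! k < y}" using lt[of l k] l k nth_mem[of l ys] set by auto
    qed
    moreover have "inj_on (\<lambda>l. ys ! l) {..<k}"
      using dist k by (intro inj_onI) (simp add: nth_eq_iff_index_eq)
    ultimately show ?thesis by (simp add: card_image)
  qed
  show ?thesis unfolding ys_def[symmetric]
  proof (intro equalityI subsetI)
    fix x assume "x \<in> set (take m ys)"
    then obtain k where k: "k < length ys" "k < m" "x = ys ! k" by (auto simp: in_set_conv_nth)
    thus "x \<in> {x \<in> A. card {y \<in> A. x < y} < m}" using card[OF k(1)] set nth_mem[OF k(1)] by simp
  next
    fix x assume x: "x \<in> {x \<in> A. card {y \<in> A. x < y} < m}"
    then obtain k where k: "k < length ys" "x = ys ! k" using set by (auto simp: in_set_conv_nth)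
    hence "k < m" using x card[OF k(1)] by simp
    hence "k < length (take m ys)" "take m ys ! k = x" using k by simp_all
    thus "x \<in> set (take m ys)" by (metis nth_mem)
  qed
qed

lemma charged_insert:
  assumes "charged c J" "q \<notin> J" shows "charged (c + 1) (insert q J)"
proof -
  obtain N where N: "{..N} \<subseteq> J" "finite (J \<inter> {N<..})" "int (card (J \<inter> {N<..})) = c - N"
    using assms(1) by (auto simp: charged_def)
  have "\<not> q \<le> N" using N(1) assms(2) by blast
  hence eq: "insert q J \<inter> {N<..} = insert q (J \<inter> {N<..})" by auto
  have "card (insert q (J \<inter> {N<..})) = Suc (card (J \<inter> {N<..}))"
    using N(2) assms(2) by (intro card_insert_disjoint) simp_all
  thus ?thesis unfolding charged_def using N by (intro exI[of _ N]) (auto simp: eq)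
qed

lemma charged_union:
  assumes "finite F" "charged c J" "F \<inter> J = {}" shows "charged (c + int (card F)) (J \<union> F)"
  using assms(1,3)
proof induction
  case empty thus ?case using assms(2) by simp
next
  case (insert q F)
  have ih: "charged (c + int (card F)) (J \<union> F)" using insert by blast
  have "q \<notin> J \<union> F" using insert by blast
  from charged_insert[OF ih this] show ?case using insert by (simp add: algebra_simps)
qed

lemma M_beta_vacancies:
  assumes E: "int e > 0" and fl: "flush (int e) J" and w: "w \<in> vacancies (int e) J"
  shows "M_beta e J (w mod int e) = w - int e"
  unfolding M_beta_def
proof (rule Greatest_equality)
  show "w - int e \<in> J \<and> (w - int e) mod int e = w mod int e" using w by (simp add: vacancies_def)
  fix y assume y: "y \<in> J \<and> y mod int e = w mod int e"
  hence d: "int e dvd (y - w)" by (simp add: mod_eq_dvd_iff)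
  have "\<not> w \<le> y" using flush_down[OF fl _ d _ E] y w by (auto simp: vacancies_def)
  thus "y \<le> w - int e" using cong_gap[OF d] by simp
qed

lemma vacancies_residue:
  assumes E: "int e > 0" and bd: "beta_like J"
  shows "\<exists>w \<in> vacancies (int e) J. w mod int e = i mod int e"
proof -
  obtain N M where NM: "{..N} \<subseteq> J" "J \<subseteq> {..M}" using bd by (auto simp: beta_like_def)
  let ?P = "\<lambda>y. int e dvd (y - i) \<and> y \<in> J"
  obtain y0 where y0: "int e dvd (y0 - i)" "y0 \<le> N" using exists_level[OF E, of i "N - int e"] by auto
  have "y0 \<in> J" using y0(2) NM(1) by auto
  have "\<exists>y\<ge>y0. ?P y \<and> (\<forall>x>y. \<not> ?P x)"
    by (rule greatest_int[of _ _ M]) (use y0 \<open>y0 \<in> J\<close> NM(2) in auto)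
  then obtain y where y: "?P y" "\<And>x. x > y \<Longrightarrow> \<not> ?P x" by blast
  have "y + int e \<notin> J" using y(2)[of "y + int e"] y(1) E by auto
  hence "y + int e \<in> vacancies (int e) J" using y(1) by (simp add: vacancies_def)
  moreover have "(y + int e) mod int e = i mod int e" using y(1) by (simp add: mod_eq_dvd_iff)
  ultimately show ?thesis by blast
qed

lemma tau_spec:
  assumes e: "e > 0" and m: "m \<le> e" and lam: "is_partition lam" and core: "U_set e (beta_set 0 lam) = {}"
  shows "is_partition (tau e m lam)" "beta_set (int m) (tau e m lam) = tau_set (int e) m (beta_set 0 lam)"
proof -
  define J where "J = beta_set 0 lam"
  define E where "E = int e"
  have E: "E > 0" using e by (simp add: E_def)
  have ch: "charged 0 J" unfolding J_def by (rule charged_beta_set[OF lam])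
  have bd: "beta_like J" by (rule charged_beta_like[OF ch])
  have fl: "flush E J" using core by (simp add: U_set_empty_iff J_def E_def)
  have finV: "finite (vacancies E J)" by (rule finite_vacancies[OF bd])
  have img: "M_beta e J ` {0..<E} = (\<lambda>w. w - E) ` vacancies E J"
  proof (intro equalityI subsetI)
    fix x assume "x \<in> M_beta e J ` {0..<E}"
    then obtain i where i: "x = M_beta e J i" "i mod E = i" by auto
    obtain w where w: "w \<in> vacancies E J" "w mod E = i" using vacancies_residue[of e J i] E bd i(2) unfolding E_def by auto
    thus "x \<in> (\<lambda>w. w - E) ` vacancies E J" using M_beta_vacancies[of e J w] E fl i(1) unfolding E_def by auto
  next
    fix x assume "x \<in> (\<lambda>w. w - E) ` vacancies E J"
    then obtain w where w: "w \<in> vacancies E J" "x = w - E" by blast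
    hence "x = M_beta e J (w mod E)" using M_beta_vacancies[of e J w] E fl unfolding E_def by simp
    thus "x \<in> M_beta e J ` {0..<E}" using E by (intro image_eqI[of _ _ "w mod E"]) simp_all
  qed
  let ?A = "(\<lambda>w. w - E) ` vacancies E J"
  have cardA: "card ?A = card (vacancies E J)" by (rule card_image) (simp add: inj_on_def)
  \<comment> \<open>Every residue contributes a vacancy, so \<open>take m\<close> really yields
    \<open>m\<close> entries and the charge rises by exactly \<open>m\<close>.\<close>
  have cardV: "card (vacancies E J) \<ge> e"
  proof -
    have "{0..<E} \<subseteq> (\<lambda>w. w mod E) ` vacancies E J"
    proof
      fix i assume i: "i \<in> {0..<E}"
      then obtain w where "w \<in> vacancies E J" "w mod E = i" using vacancies_residue[of e J i] E bd unfolding E_def by auto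
      thus "i \<in> (\<lambda>w. w mod E) ` vacancies E J" by blast
    qed
    hence "card {0..<E} \<le> card ((\<lambda>w. w mod E) ` vacancies E J)" using finV by (intro card_mono) auto
    also have "\<dots> \<le> card (vacancies E J)" by (rule card_image_le[OF finV])
    finally show ?thesis by (simp add: E_def)
  qed
  let ?T = "set (take m (M_list e J))"
  have T: "?T = {x \<in> ?A. card {y \<in> ?A. x < y} < m}"
    unfolding M_list_def E_def[symmetric] img by (rule set_take_rev_sorted_list) (use finV in simp)
  let ?F = "(\<lambda>x. x + E) ` ?T"
  have rank: "card {y \<in> ?A. w - E < y} = card {v \<in> vacancies E J. w < v}" for w
  proof -
    have "{y \<in> ?A. w - E < y} = (\<lambda>v. v - E) ` {v \<in> vacancies E J. w < v}" by auto
    thus ?thesis by (simp add: card_image inj_on_def)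
  qed
  have F: "?F = {x \<in> vacancies E J. card {w \<in> vacancies E J. x < w} < m}"
  proof (intro equalityI subsetI)
    fix x assume "x \<in> ?F"
    then obtain w where w: "x = w - E + E" "w \<in> vacancies E J" "card {y \<in> ?A. w - E < y} < m" unfolding T by blast
    thus "x \<in> {x \<in> vacancies E J. card {w \<in> vacancies E J. x < w} < m}" using rank[of w] by simp
  next
    fix x assume x: "x \<in> {x \<in> vacancies E J. card {w \<in> vacancies E J. x < w} < m}"
    hence "x - E \<in> ?T" unfolding T using rank[of x] by simp
    thus "x \<in> ?F" by (intro image_eqI[of _ _ "x - E"]) simp_all
  qed
  have eq: "J \<union> ?F = tau_set E m J" unfolding tau_set_def F ..
  have "distinct (M_list e J)" by (simp add: M_list_def)
  moreover have "length (M_list e J) = card (vacancies E J)"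
    unfolding M_list_def E_def[symmetric] img using cardA by simp
  ultimately have "card ?T = m" using m cardV by (simp add: distinct_card)
  hence cF: "card ?F = m" by (simp add: card_image inj_on_def)
  have "?F \<inter> J = {}" unfolding F by (auto simp: vacancies_def)
  from charged_union[OF _ ch this] have chm: "charged (int m) (tau_set E m J)" using cF unfolding eq by simp
  have "tau e m lam = part_of_beta (int m) (tau_set E m J)"
    unfolding tau_def Let_def J_def[symmetric] E_def[symmetric] eq ..
  thus "is_partition (tau e m lam)" "beta_set (int m) (tau e m lam) = tau_set (int e) m (beta_set 0 lam)"
    using part_of_beta_charged[OF chm] by (simp_all add: J_def E_def)
qed

text \<open>If \<open>a\<close> is one of the added vacancies, then \<open>a + 1\<close> is a bead
  or again a vacancy, and as a larger one it is also among the first \<open>m\<close>.\<close>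

lemma tau_set_right_closed:
  assumes bd: "beta_like J" and J: "\<And>a. E dvd (a - c) \<Longrightarrow> a \<in> J \<Longrightarrow> a + 1 \<in> J"
    and a: "E dvd (a - c)" "a \<in> tau_set E m J"
  shows "a + 1 \<in> tau_set E m J"
proof (cases "a + 1 \<in> J")
  case False
  hence av: "a \<in> vacancies E J" "card {w \<in> vacancies E J. a < w} < m" using a J unfolding tau_set_def by auto
  have "a - E + 1 \<in> J" using J[of "a - E"] av(1) a(1) by (simp add: vacancies_def)
  hence "a + 1 \<in> vacancies E J" using False by (simp add: vacancies_def algebra_simps)
  moreover have "card {w \<in> vacancies E J. a + 1 < w} \<le> card {w \<in> vacancies E J. a < w}"
    using finite_vacancies[OF bd] by (intro card_mono) auto
  ultimately show ?thesis using av(2) by (simp add: tau_set_def)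
qed (simp add: tau_set_def)

section \<open>The simple reflection on positions, and how \<open>tau_set\<close> commutes with
  it\<close>

definition pair_swap :: "int \<Rightarrow> int \<Rightarrow> int \<Rightarrow> int" where
  "pair_swap E c y = (if E dvd (y - c) then y + 1 else if E dvd (y - 1 - c) then y - 1 else y)"

lemma pair_swap_left: "E \<ge> 2 \<Longrightarrow> E dvd (a - c) \<Longrightarrow> pair_swap E c a = a + 1"
  by (simp add: pair_swap_def)

lemma pair_swap_right: "E \<ge> 2 \<Longrightarrow> E dvd (a - c) \<Longrightarrow> pair_swap E c (a + 1) = a"
  using not_dvd_one(1)[of E "a - c"] by (simp add: pair_swap_def algebra_simps)

lemma pair_swap_out: "\<not> E dvd (y - c) \<Longrightarrow> \<not> E dvd (y - 1 - c) \<Longrightarrow> pair_swap E c y = y"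
  by (simp add: pair_swap_def)

lemma pair_cases:
  fixes y c E :: int
  obtains (l) "E dvd (y - c)" | (r) a where "E dvd (a - c)" "y = a + 1" | (o) "\<not> E dvd (y - c)" "\<not> E dvd (y - 1 - c)"
proof -
  consider "E dvd (y - c)" | "E dvd (y - 1 - c)" | "\<not> E dvd (y - c)" "\<not> E dvd (y - 1 - c)" by blast
  thus thesis
  proof cases
    case 2 show thesis by (rule r[of "y - 1"]) (use 2 in simp_all)
  qed (use l o in blast)+
qed

lemma pair_swap_swap: "E \<ge> 2 \<Longrightarrow> pair_swap E c (pair_swap E c y) = y"
  by (rule pair_cases[of E y c]) (simp_all add: pair_swap_left pair_swap_right pair_swap_out)

lemma pair_swap_shift: "pair_swap E c (y - E) = pair_swap E c y - E"
proof -
  have "y - E - 1 - c = y - 1 - E - c" by simp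
  thus ?thesis unfolding pair_swap_def by (simp only: cong_shift) simp
qed

lemma pair_swap_less:
  assumes "E \<ge> 2" "v < w" "\<not> (E dvd (v - c) \<and> w = v + 1)"
  shows "pair_swap E c v < pair_swap E c w"
proof -
  have b: "pair_swap E c y \<le> y + 1" "y - 1 \<le> pair_swap E c y" for y by (auto simp: pair_swap_def)
  have ne: "pair_swap E c v \<noteq> pair_swap E c w" using pair_swap_swap[OF assms(1), of c] assms(2) by (metis order_less_irrefl)
  show ?thesis
  proof (cases "w = v + 1")
    case True
    hence "\<not> E dvd (v - c)" using assms(3) by simp
    hence "pair_swap E c v \<le> v" "w \<le> pair_swap E c w" using True by (auto simp: pair_swap_def)
    thus ?thesis using assms(2) by simp
  next
    case False
    hence "v + 2 \<le> w" using assms(2) by simp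
    thus ?thesis using b(1)[of v] b(2)[of w] ne by simp
  qed
qed

lemma adds_nodesD:
  assumes "adds_nodes E c S T"
  shows "\<not> E dvd (y - c) \<Longrightarrow> \<not> E dvd (y - 1 - c) \<Longrightarrow> y \<in> S \<longleftrightarrow> y \<in> T"
    "E dvd (a - c) \<Longrightarrow> (a \<in> S \<longleftrightarrow> a \<in> T) \<and> (a + 1 \<in> S \<longleftrightarrow> a + 1 \<in> T) \<or> addable_at S a \<and> removable_at T a"
  using assms in_block1D[of E c y] unfolding adds_nodes_def by blast+

lemma adds_nodesI:
  assumes "E \<ge> 2" "\<And>y. \<not> E dvd (y - c) \<Longrightarrow> \<not> E dvd (y - 1 - c) \<Longrightarrow> y \<in> S \<longleftrightarrow> y \<in> T"
    "\<And>a. E dvd (a - c) \<Longrightarrow> (a \<in> S \<longleftrightarrow> a \<in> T) \<and> (a + 1 \<in> S \<longleftrightarrow> a + 1 \<in> T) \<or> addable_at S a \<and> removable_at T a"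
  shows "adds_nodes E c S T"
proof -
  have "\<not> E dvd (y - c) \<and> \<not> E dvd (y - 1 - c)" if n: "\<not> in_block E c 1 y" for y
  proof -
    have "in_block E c 1 y" if "E dvd (y - c)" unfolding in_block_def by (rule exI[of _ y]) (use that in simp)
    moreover have "in_block E c 1 y" if "E dvd (y - 1 - c)" unfolding in_block_def by (rule exI[of _ "y - 1"]) (use that in simp)
    ultimately show ?thesis using n by blast
  qed
  thus ?thesis unfolding adds_nodes_def using assms(2,3) by blast
qed

text \<open>If one level \<open>b\<close> changes, flushness of both cores forces unchanged levels
  above \<open>b\<close> to be empty and those below to be full, so \<open>K\<close> is the image of
  \<open>J\<close> under \<open>pair_swap\<close>. No level holds two vacancies; hence the
  reflection preserves the order of the vacancies and their ranks, and carries
  \<open>tau_set E m J\<close> to \<open>tau_set E m K\<close>.\<close>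

lemma adds_nodes_tau_set:
  assumes E: "E \<ge> 2" and bd: "beta_like J" and fl: "flush E J" "flush E K" and le: "adds_nodes E c J K"
  shows "adds_nodes E c (tau_set E m J) (tau_set E m K)"
proof (cases "J = K")
  case True
  thus ?thesis by (intro adds_nodesI[OF E]) auto
next
  case False
  have E0: "E > 0" using E by simp
  let ?s = "pair_swap E c"
  have "\<exists>b. E dvd (b - c) \<and> addable_at J b \<and> removable_at K b"
  proof (rule ccontr)
    assume no: "\<nexists>b. E dvd (b - c) \<and> addable_at J b \<and> removable_at K b"
    have "y \<in> J \<longleftrightarrow> y \<in> K" for y
      by (rule pair_cases[of E y c]) (use adds_nodesD[OF le] no in blast)+
    thus False using False by blast
  qed
  then obtain b where b: "E dvd (b - c)" "b \<in> J" "b + 1 \<notin> J" "b \<notin> K" "b + 1 \<in> K"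
    by (auto simp: addable_at_def removable_at_def)
  have dn: "y \<in> S" if "flush E S" "z \<in> S" "E dvd (z - c)" "E dvd (y - c)" "y \<le> z" for y z S
    by (rule flush_down[OF that(1,2) cong_trans[OF that(3) cong_sym[OF that(4)]] that(5) E0])
  have dn1: "y + 1 \<in> S" if "flush E S" "z + 1 \<in> S" "E dvd (z - c)" "E dvd (y - c)" "y \<le> z" for y z S
  proof (rule flush_down[OF that(1,2) _ _ E0])
    show "E dvd (z + 1 - (y + 1))" using cong_trans[OF that(3) cong_sym[OF that(4)]] by simp
  qed (use that in simp)
  have lvl: "(a \<in> K \<longleftrightarrow> a + 1 \<in> J) \<and> (a + 1 \<in> K \<longleftrightarrow> a \<in> J) \<and> (a + 1 \<in> J \<longrightarrow> a \<in> J)" if a: "E dvd (a - c)" for a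
  proof (cases "addable_at J a \<and> removable_at K a")
    case False
    hence eq: "a \<in> J \<longleftrightarrow> a \<in> K" "a + 1 \<in> J \<longleftrightarrow> a + 1 \<in> K" using adds_nodesD(2)[OF le a] by auto
    have "a \<in> J \<longleftrightarrow> a + 1 \<in> J"
    proof (cases "b \<le> a")
      case True
      have "a \<notin> K" "a + 1 \<notin> J" using dn[OF fl(2) _ a b(1) True] dn1[OF fl(1) _ a b(1) True] b by auto
      thus ?thesis using eq by simp
    next
      case False
      hence "a \<in> J" "a + 1 \<in> K" using dn[OF fl(1) b(2,1) a] dn1[OF fl(2) b(5,1) a] by auto
      thus ?thesis using eq by simp
    qed
    thus ?thesis using eq by simp
  qed (auto simp: addable_at_def removable_at_def)
  have KJ: "y \<in> K \<longleftrightarrow> ?s y \<in> J" for y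
  proof (rule pair_cases[of E y c])
    assume "E dvd (y - c)" thus ?thesis using lvl[of y] by (simp add: pair_swap_left[OF E])
  next
    fix a assume "E dvd (a - c)" "y = a + 1"
    thus ?thesis using lvl[of a] by (simp add: pair_swap_right[OF E])
  next
    assume "\<not> E dvd (y - c)" "\<not> E dvd (y - 1 - c)"
    thus ?thesis using adds_nodesD(1)[OF le] by (simp add: pair_swap_out)
  qed
  have VV: "y \<in> vacancies E K \<longleftrightarrow> ?s y \<in> vacancies E J" for y
    by (simp add: vacancies_def KJ pair_swap_shift)
  \<comment> \<open>Up to the changed level \<open>b\<close> the left position is a bead; above
    \<open>b\<close>, the position \<open>a + 1 - E\<close> cannot be one.\<close>
  have nb: "\<not> (a \<in> vacancies E J \<and> a + 1 \<in> vacancies E J)" if a: "E dvd (a - c)" for a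
  proof
    assume v: "a \<in> vacancies E J \<and> a + 1 \<in> vacancies E J"
    show False
    proof (cases "a \<le> b")
      case True
      thus False using dn[OF fl(1) b(2,1) a] v by (simp add: vacancies_def)
    next
      case False
      hence ba: "b \<le> a - E" using cong_gap[OF cong_trans[OF b(1) cong_sym[OF a]]] by simp
      have "a - E + 1 \<in> J" using v by (simp add: vacancies_def algebra_simps)
      from dn1[OF fl(1) this _ b(1) ba] show False using a b(3) by simp
    qed
  qed
  have nbK: "\<not> (a \<in> vacancies E K \<and> a + 1 \<in> vacancies E K)" if a: "E dvd (a - c)" for a
    using nb[OF a] VV[of a] VV[of "a + 1"] pair_swap_left[OF E a] pair_swap_right[OF E a] by auto
  have lt: "?s v < ?s w \<longleftrightarrow> v < w" if "v \<in> vacancies E K" "w \<in> vacancies E K" for v w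
  proof -
    have l: "?s v < ?s w" if "v < w" "v \<in> vacancies E K" "w \<in> vacancies E K" for v w
      by (rule pair_swap_less[OF E that(1)]) (use nbK that in blast)
    show ?thesis using l[of v w] l[of w v] that by (cases v w rule: linorder_cases) auto
  qed
  have rank: "card {w \<in> vacancies E K. y < w} = card {w \<in> vacancies E J. ?s y < w}" if y: "y \<in> vacancies E K" for y
  proof -
    have "{w \<in> vacancies E J. ?s y < w} = ?s ` {w \<in> vacancies E K. y < w}"
    proof (intro equalityI subsetI)
      fix w assume w: "w \<in> {w \<in> vacancies E J. ?s y < w}"
      have "?s w \<in> vacancies E K" using VV[of "?s w"] w by (simp add: pair_swap_swap[OF E])
      moreover have "y < ?s w" using lt[OF y calculation] w by (simp add: pair_swap_swap[OF E])
      ultimately show "w \<in> ?s ` {w \<in> vacancies E K. y < w}"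
        by (intro image_eqI[of _ _ "?s w"]) (simp_all add: pair_swap_swap[OF E])
    next
      fix w assume "w \<in> ?s ` {w \<in> vacancies E K. y < w}"
      then obtain v where v: "w = ?s v" "v \<in> vacancies E K" "y < v" by blast
      thus "w \<in> {w \<in> vacancies E J. ?s y < w}" using lt[OF y v(2)] VV[of v] by simp
    qed
    moreover have "inj_on ?s {w \<in> vacancies E K. y < w}"
      using pair_swap_swap[OF E, of c] by (intro inj_onI) metis
    ultimately show ?thesis by (simp add: card_image)
  qed
  have tt: "y \<in> tau_set E m K \<longleftrightarrow> ?s y \<in> tau_set E m J" for y
    using KJ[of y] VV[of y] rank[of y] unfolding tau_set_def by auto
  have noR: "a \<in> tau_set E m J" if a: "E dvd (a - c)" "a + 1 \<in> tau_set E m J" for a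
  proof (rule ccontr)
    assume na: "a \<notin> tau_set E m J"
    hence aJ: "a \<notin> J" by (simp add: tau_set_def)
    hence "a + 1 \<notin> J" using lvl[OF a(1)] by blast
    hence v: "a + 1 \<in> vacancies E J" using a(2) by (simp add: tau_set_def)
    have "a - E + 1 \<in> J" using v by (simp add: vacancies_def algebra_simps)
    hence "a - E \<in> J" using lvl[of "a - E"] a(1) by simp
    hence "a \<in> vacancies E J" using aJ by (simp add: vacancies_def)
    thus False using nb[OF a(1)] v by blast
  qed
  show ?thesis
  proof (rule adds_nodesI[OF E])
    show "y \<in> tau_set E m J \<longleftrightarrow> y \<in> tau_set E m K" if "\<not> E dvd (y - c)" "\<not> E dvd (y - 1 - c)" for y
      using tt[of y] pair_swap_out[OF that] by simp
    fix a assume a: "E dvd (a - c)"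
    have "a \<in> tau_set E m K \<longleftrightarrow> a + 1 \<in> tau_set E m J" "a + 1 \<in> tau_set E m K \<longleftrightarrow> a \<in> tau_set E m J"
      using tt[of a] tt[of "a + 1"] pair_swap_left[OF E a] pair_swap_right[OF E a] by simp_all
    thus "(a \<in> tau_set E m J \<longleftrightarrow> a \<in> tau_set E m K) \<and> (a + 1 \<in> tau_set E m J \<longleftrightarrow> a + 1 \<in> tau_set E m K) \<or>
        addable_at (tau_set E m J) a \<and> removable_at (tau_set E m K) a"
      using noR[OF a] unfolding addable_at_def removable_at_def by blast
  qed
qed

section \<open>Domination and adding nodes\<close>

lemma card_ge_Suc:
  assumes "beta_like J" shows "card (J \<inter> {y..}) = card (J \<inter> {y + 1..}) + of_bool (y \<in> J)" "finite (J \<inter> {y..})"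
proof -
  obtain N M where NM: "{..N} \<subseteq> J" "J \<subseteq> {..M}" using assms by (auto simp: beta_like_def)
  show fin: "finite (J \<inter> {y..})" for y by (rule finite_subset[of _ "{y..M}"]) (use NM in auto)
  have "J \<inter> {y..} = (if y \<in> J then insert y (J \<inter> {y + 1..}) else J \<inter> {y + 1..})"
    by (auto simp: order_le_less)
  thus "card (J \<inter> {y..}) = card (J \<inter> {y + 1..}) + of_bool (y \<in> J)" using fin[of "y + 1"] by simp
qed

text \<open>The map \<open>g\<close>, which lifts the moved beads by one, is a bijection from
  \<open>J\<close> to \<open>K\<close>. Only a bead going from \<open>y - 1\<close> to
  \<open>y\<close> affects the count.\<close>

lemma card_ge_adds_nodes:
  assumes E: "E \<ge> 2" and bd: "beta_like J" and le: "adds_nodes E c J K"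
  shows "card (K \<inter> {y..}) = card (J \<inter> {y..}) + of_bool (E dvd (y - 1 - c) \<and> addable_at J (y - 1) \<and> removable_at K (y - 1))"
proof -
  define mv where "mv x \<longleftrightarrow> E dvd (x - c) \<and> addable_at J x \<and> removable_at K x" for x
  define g where "g x = (if mv x then x + 1 else x)" for x
  define P where "P = J \<inter> {y..} \<union> (if mv (y - 1) then {y - 1} else {})"
  have gK: "g x \<in> K" if x: "x \<in> J" for x
  proof (cases "mv x")
    case True thus ?thesis by (simp add: g_def mv_def removable_at_def)
  next
    case nm: False
    have "x \<in> K"
    proof (rule pair_cases[of E x c])
      assume "E dvd (x - c)"
      thus ?thesis using adds_nodesD(2)[OF le, of x] nm x by (auto simp: mv_def)
    next
      fix a assume "E dvd (a - c)" "x = a + 1"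
      thus ?thesis using adds_nodesD(2)[OF le, of a] x by (auto simp: addable_at_def)
    qed (use adds_nodesD(1)[OF le] x in blast)
    thus ?thesis using nm by (simp add: g_def)
  qed
  have sur: "\<exists>x\<in>J. g x = z" if z: "z \<in> K" for z
  proof (cases "mv (z - 1)")
    case True
    thus ?thesis by (intro bexI[of _ "z - 1"]) (simp_all add: g_def mv_def addable_at_def)
  next
    case nm: False
    have nz: "\<not> mv z" using z by (simp add: mv_def removable_at_def)
    have "z \<in> J"
    proof (rule pair_cases[of E z c])
      assume "E dvd (z - c)"
      thus ?thesis using adds_nodesD(2)[OF le, of z] nz z by (auto simp: mv_def)
    next
      fix a assume "E dvd (a - c)" "z = a + 1"
      thus ?thesis using adds_nodesD(2)[OF le, of a] nm z by (auto simp: mv_def)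
    qed (use adds_nodesD(1)[OF le] z in blast)
    thus ?thesis using nz by (intro bexI[of _ z]) (simp_all add: g_def)
  qed
  have PJ: "P \<subseteq> J" by (auto simp: P_def mv_def addable_at_def)
  have inj: "inj_on g J"
  proof (rule inj_onI)
    fix u v assume "u \<in> J" "v \<in> J" "g u = g v"
    moreover have "u + 1 \<notin> J" if "mv u" for u using that by (simp add: mv_def addable_at_def)
    ultimately show "u = v" by (auto simp: g_def split: if_splits)
  qed
  have "K \<inter> {y..} = g ` P"
  proof (intro equalityI subsetI)
    fix z assume z: "z \<in> K \<inter> {y..}"
    then obtain x where x: "x \<in> J" "g x = z" using sur by blast
    have "x \<in> P"
    proof (cases "y \<le> x")
      case False
      hence "mv x" "x = y - 1" using x(2) z by (auto simp: g_def split: if_splits)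
      thus ?thesis by (simp add: P_def)
    qed (use x in \<open>simp add: P_def\<close>)
    thus "z \<in> g ` P" using x by blast
  next
    fix z assume "z \<in> g ` P"
    then obtain x where x: "x \<in> P" "z = g x" by blast
    have "y \<le> g x" using x(1) by (auto simp: P_def g_def split: if_splits)
    thus "z \<in> K \<inter> {y..}" using gK[of x] x PJ by auto
  qed
  hence "card (K \<inter> {y..}) = card P" using card_image[OF inj_on_subset[OF inj PJ]] by simp
  also have "\<dots> = card (J \<inter> {y..}) + of_bool (mv (y - 1))"
    using card_ge_Suc(2)[OF bd, of y] by (simp add: P_def)
  finally show ?thesis by (simp add: mv_def)
qed

text \<open>Where the count grows at \<open>y\<close>, \<open>J\<close> has a bead at
  \<open>y - 1\<close> and none at \<open>y\<close>. If \<open>y - 1\<close> is not in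
  \<open>K\<close>, the inequality at \<open>y - 1\<close> provides the extra unit; otherwise
  \<open>y\<close> is in \<open>K\<close> and the inequality at \<open>y + 1\<close> does.\<close>

lemma dominated_up:
  assumes E: "E \<ge> 2" and bd: "beta_like J" "beta_like K" and dom: "dominated J K" and le: "adds_nodes E c J J'"
    and K: "\<And>a. E dvd (a - c) \<Longrightarrow> a \<in> K \<Longrightarrow> a + 1 \<in> K"
  shows "dominated J' K"
  unfolding dominated_def
proof
  fix y
  have D: "card (J \<inter> {y..}) \<le> card (K \<inter> {y..})" for y using dom by (simp add: dominated_def)
  show "card (J' \<inter> {y..}) \<le> card (K \<inter> {y..})"
  proof (cases "E dvd (y - 1 - c) \<and> addable_at J (y - 1) \<and> removable_at J' (y - 1)")
    case False
    hence "card (J' \<inter> {y..}) = card (J \<inter> {y..})" using card_ge_adds_nodes[OF E bd(1) le, of y] by (simp only: of_bool_eq add_0_right)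
    thus ?thesis using D[of y] by simp
  next
    case True
    hence J': "card (J' \<inter> {y..}) = card (J \<inter> {y..}) + 1" using card_ge_adds_nodes[OF E bd(1) le, of y] by simp
    have J: "card (J \<inter> {y - 1..}) = card (J \<inter> {y..}) + 1" "card (J \<inter> {y..}) = card (J \<inter> {y + 1..})"
      using card_ge_Suc(1)[OF bd(1), of "y - 1"] card_ge_Suc(1)[OF bd(1), of y] True by (simp_all add: addable_at_def)
    show ?thesis
    proof (cases "y - 1 \<in> K")
      case False
      thus ?thesis using card_ge_Suc(1)[OF bd(2), of "y - 1"] D[of "y - 1"] J' J by simp
    next
      case y1: True
      have "y \<in> K" using K[of "y - 1"] True y1 by simp
      thus ?thesis using card_ge_Suc(1)[OF bd(2), of y] D[of "y + 1"] J' J by simp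
    qed
  qed
qed

text \<open>Dual to \<open>dominated_up\<close>: \<open>J\<close> lacks \<open>y\<close> or contains
  \<open>y - 1\<close> as well. At \<open>y - 1\<close> and \<open>y + 1\<close> the counts of
  \<open>K\<close> and \<open>K'\<close> agree, because the nodes entering there have other
  residues.\<close>

lemma dominated_down:
  assumes E: "E \<ge> 2" and bd: "beta_like J" "beta_like K" and dom: "dominated J K'" and le: "adds_nodes E c K K'"
    and J: "\<And>a. E dvd (a - c) \<Longrightarrow> a + 1 \<in> J \<Longrightarrow> a \<in> J"
  shows "dominated J K"
  unfolding dominated_def
proof
  fix y
  have D: "card (J \<inter> {y..}) \<le> card (K' \<inter> {y..})" for y using dom by (simp add: dominated_def)
  show "card (J \<inter> {y..}) \<le> card (K \<inter> {y..})"
  proof (cases "E dvd (y - 1 - c) \<and> addable_at K (y - 1) \<and> removable_at K' (y - 1)")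
    case False
    hence "card (K' \<inter> {y..}) = card (K \<inter> {y..})" using card_ge_adds_nodes[OF E bd(2) le, of y] by (simp only: of_bool_eq add_0_right)
    thus ?thesis using D[of y] by simp
  next
    case True
    have K: "card (K \<inter> {y - 1..}) = card (K \<inter> {y..}) + 1" "card (K \<inter> {y..}) = card (K \<inter> {y + 1..})"
      using card_ge_Suc(1)[OF bd(2), of "y - 1"] card_ge_Suc(1)[OF bd(2), of y] True by (simp_all add: addable_at_def)
    have n: "\<not> E dvd (y - 1 - 1 - c)" "\<not> E dvd (y + 1 - 1 - c)"
      using not_dvd_one[OF E, of "y - 1 - c"] True by (auto simp: algebra_simps)
    have K': "card (K' \<inter> {y - 1..}) = card (K \<inter> {y - 1..})" "card (K' \<inter> {y + 1..}) = card (K \<inter> {y + 1..})"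
      using card_ge_adds_nodes[OF E bd(2) le, of "y - 1"] card_ge_adds_nodes[OF E bd(2) le, of "y + 1"] n by simp_all
    show ?thesis
    proof (cases "y \<in> J")
      case False
      thus ?thesis using card_ge_Suc(1)[OF bd(1), of y] D[of "y + 1"] K K' by simp
    next
      case yJ: True
      have "y - 1 \<in> J" using J[of "y - 1"] True yJ by simp
      thus ?thesis using card_ge_Suc(1)[OF bd(1), of "y - 1"] D[of "y - 1"] K K' by simp
    qed
  qed
qed

lemma dominated_adds_nodes: "E \<ge> 2 \<Longrightarrow> beta_like J \<Longrightarrow> adds_nodes E c J K \<Longrightarrow> dominated J K"
  unfolding dominated_def using card_ge_adds_nodes by simp

lemma dominated_trans: "dominated J K \<Longrightarrow> dominated K L \<Longrightarrow> dominated J L"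
  unfolding dominated_def using order_trans by blast

section \<open>Signatures\<close>

lemma reduced_Cons: "reduced (p # s) = push_entry p (reduced s)"
  by (simp add: reduced_def)

lemma push_entry_cases:
  obtains "push_entry p s = p # s" "s = [] \<or> fst (hd s) = Removable \<or> fst p = Addable"
  | q where "s = q # push_entry p s" "fst p = Removable" "fst q = Addable"
  by (cases "(p, s)" rule: push_entry.cases) auto

lemma hd_reduced:
  assumes "reduced s = [] \<or> fst (hd (reduced s)) = Removable"
  shows "s = [] \<or> fst (hd s) = Removable"
proof (cases s)
  case (Cons p s')
  obtain k x where p: "p = (k, x)" by fastforce
  show ?thesis using assms unfolding Cons p reduced_Cons by (cases k) auto
qed simp

text \<open>A \<open>Removable\<close> right before \<open>p\<close>, or an \<open>Addable\<close>
  right after it, would either cancel against \<open>p\<close> or, with \<open>p\<close> in the way,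
  survive and contradict the extremal choice of \<open>p\<close>. The clause on \<open>r1\<close>
  carries the induction through the step where a new entry cancels the first survivor.\<close>

lemma reduced_split:
  assumes "reduced s = r1 @ p # r2"
    and "fst p = Addable \<and> (\<forall>q\<in>set r2. fst q = Removable) \<or>
      fst p = Removable \<and> (\<forall>q\<in>set r1. fst q = Addable)"
  shows "\<exists>u v. s = u @ p # v \<and> (u = [] \<or> fst (last u) = Addable) \<and>
    (v = [] \<or> fst (hd v) = Removable) \<and> (r1 \<noteq> [] \<longrightarrow> u \<noteq> [])"
  using assms
proof (induction s arbitrary: r1)
  case Nil
  thus ?case by (simp add: reduced_def)
next
  case (Cons q s)
  have eq: "push_entry q (reduced s) = r1 @ p # r2" using Cons.prems(1) by (simp add: reduced_Cons)
  show ?case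
  proof (rule push_entry_cases[of q "reduced s"])
    assume a: "push_entry q (reduced s) = q # reduced s"
      "reduced s = [] \<or> fst (hd (reduced s)) = Removable \<or> fst q = Addable"
    show ?thesis
    proof (cases r1)
      case Nil
      hence qp: "q = p" "reduced s = r2" using eq a by simp_all
      have "r2 = [] \<or> fst (hd r2) = Removable" using Cons.prems(2) a(2) qp by (cases r2) auto
      hence "s = [] \<or> fst (hd s) = Removable" using hd_reduced[of s] qp by simp
      thus ?thesis using Nil qp by (intro exI[of _ "[]"] exI[of _ s]) simp
    next
      case (Cons q' r1')
      hence r: "q' = q" "reduced s = r1' @ p # r2" using eq a by simp_all
      obtain u v where uv: "s = u @ p # v" "u = [] \<or> fst (last u) = Addable"
        "v = [] \<or> fst (hd v) = Removable" "r1' \<noteq> [] \<longrightarrow> u \<noteq> []"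
        using Cons.IH[OF r(2)] Cons.prems(2) Cons by auto
      have "fst q = Addable" if "u = []"
      proof -
        have "hd (reduced s) = p" "reduced s \<noteq> []" using r(2) uv(4) that by simp_all
        thus ?thesis using a(2) Cons.prems(2) Cons r(1) by auto
      qed
      thus ?thesis using uv Cons by (intro exI[of _ "q # u"] exI[of _ v]) auto
    qed
  next
    fix q' assume a: "reduced s = q' # push_entry q (reduced s)" "fst q' = Addable"
    have r: "reduced s = (q' # r1) @ p # r2" using a(1) eq by simp
    obtain u v where uv: "s = u @ p # v" "fst (last u) = Addable" "u \<noteq> []" "v = [] \<or> fst (hd v) = Removable"
      using Cons.IH[OF r] Cons.prems(2) a(2) by auto
    thus ?thesis by (intro exI[of _ "q # u"] exI[of _ v]) auto
  qed
qed

lemma reduced_last: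
  assumes "s \<noteq> []" "fst (last s) = Removable"
  shows "reduced s \<noteq> [] \<and> fst (last (reduced s)) = Removable"
  using assms
proof (induction s)
  case (Cons q s)
  show ?case
  proof (cases "s = []")
    case True
    thus ?thesis using Cons.prems by (cases q) (simp add: reduced_def)
  next
    case False
    hence ih: "reduced s \<noteq> [] \<and> fst (last (reduced s)) = Removable" using Cons by simp
    show ?thesis
    proof (rule push_entry_cases[of q "reduced s"])
      assume "push_entry q (reduced s) = q # reduced s"
      thus ?thesis using ih by (simp add: reduced_Cons)
    next
      fix q' assume a: "reduced s = q' # push_entry q (reduced s)" "fst q' = Addable"
      have "push_entry q (reduced s) \<noteq> []"
      proof
        assume "push_entry q (reduced s) = []"
        hence "last (reduced s) = q'" using a(1) by (metis last.simps)
        thus False using ih a(2) by simp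
      qed
      moreover from this have "last (reduced s) = last (push_entry q (reduced s))" using a(1) by (metis last_ConsR)
      ultimately show ?thesis using ih by (simp add: reduced_Cons)
    qed
  qed
qed simp

lemma f_op_split:
  assumes "f_op e m i b = Some b'"
  obtains u r v where "tensor_signature e m i b = u @ (Addable, r) # v"
    "u = [] \<or> fst (last u) = Addable" "v = [] \<or> fst (hd v) = Removable" "b' = add_node r b"
proof -
  let ?R = "reduced (tensor_signature e m i b)"
  let ?A = "filter (\<lambda>p. fst p = Addable) ?R"
  have ne: "?A \<noteq> []" and b': "b' = add_node (snd (last ?A)) b"
    using assms by (auto simp: f_op_def Let_def split: if_splits)
  define p where "p = last ?A"
  have "rev ?A = p # rev (butlast ?A)" using ne by (metis p_def append_butlast_last_id rev_eq_Cons_iff rev_rev_ident)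
  hence "filter (\<lambda>p. fst p = Addable) (rev ?R) = p # rev (butlast ?A)" by (simp add: rev_filter)
  then obtain us vs where uv: "rev ?R = us @ p # vs" "\<forall>q\<in>set us. fst q \<noteq> Addable" "fst p = Addable"
    unfolding filter_eq_Cons_iff by blast
  have "?R = rev vs @ p # rev us" using uv(1) by (metis rev_append rev_rev_ident rev.simps(2) append.assoc append_Cons append_Nil)
  moreover have "\<forall>q\<in>set (rev us). fst q = Removable" using uv(2) node_kind.exhaust by auto
  ultimately obtain u v where "tensor_signature e m i b = u @ p # v" "u = [] \<or> fst (last u) = Addable"
    "v = [] \<or> fst (hd v) = Removable" using reduced_split[of "tensor_signature e m i b" "rev vs" p "rev us"] uv(3) by blast
  moreover have "p = (Addable, snd p)" using uv(3) by (metis prod.collapse)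
  ultimately show thesis using that[of u "snd p" v] b' unfolding p_def by metis
qed

lemma e_op_split:
  assumes "e_op e m i b = Some b'"
  obtains u r v where "tensor_signature e m i b = u @ (Removable, r) # v"
    "u = [] \<or> fst (last u) = Addable" "v = [] \<or> fst (hd v) = Removable" "b' = remove_node r b"
proof -
  let ?R = "reduced (tensor_signature e m i b)"
  let ?A = "filter (\<lambda>p. fst p = Removable) ?R"
  have ne: "?A \<noteq> []" and b': "b' = remove_node (snd (hd ?A)) b"
    using assms by (auto simp: e_op_def Let_def split: if_splits)
  define p where "p = hd ?A"
  have "?A = p # tl ?A" using ne by (simp add: p_def)
  then obtain us vs where uv: "?R = us @ p # vs" "\<forall>q\<in>set us. fst q \<noteq> Removable" "fst p = Removable"
    unfolding filter_eq_Cons_iff by blast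
  have "\<forall>q\<in>set us. fst q = Addable" using uv(2) node_kind.exhaust by auto
  then obtain u v where "tensor_signature e m i b = u @ p # v" "u = [] \<or> fst (last u) = Addable"
    "v = [] \<or> fst (hd v) = Removable" using reduced_split[OF uv(1)] uv(3) by blast
  moreover have "p = (Removable, snd p)" using uv(3) by (metis prod.collapse)
  ultimately show thesis using that[of u "snd p" v] b' unfolding p_def by metis
qed

lemma e_op_last:
  assumes "tensor_signature e m i b \<noteq> []" "fst (last (tensor_signature e m i b)) = Removable"
  shows "\<exists>b'. e_op e m i b = Some b'"
proof -
  let ?R = "reduced (tensor_signature e m i b)"
  have R: "?R \<noteq> []" "fst (last ?R) = Removable" using reduced_last[OF assms] by auto
  hence "last ?R \<in> set (filter (\<lambda>p. fst p = Removable) ?R)" by simp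
  hence "filter (\<lambda>p. fst p = Removable) ?R \<noteq> []" by (metis list.set(1) emptyE)
  thus ?thesis by (simp add: e_op_def Let_def)
qed

section \<open>Signatures as decreasing sequences of levels\<close>

text \<open>The level of an entry: the position \<open>x\<close> such that the node moves a bead between \<open>x\<close> and \<open>x + 1\<close>.\<close>
definition level :: "part \<Rightarrow> node_kind \<times> nat \<Rightarrow> int" where
  "level lam p = (if fst p = Addable then bead lam (snd p) else bead lam (snd p) - 1)"

definition kind_at :: "node_kind \<Rightarrow> int set \<Rightarrow> int \<Rightarrow> bool" where
  "kind_at k J x = (if k = Addable then addable_at J x else removable_at J x)"

text \<open>The node that would extend row \<open>a\<close> has residue
  \<open>bead lam a + c\<close> modulo \<open>e\<close>, so in charge-0 coordinates residue
  \<open>i\<close> is the class of \<open>i - c\<close>.\<close>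

lemma addable_iff:
  assumes lam: "is_partition lam" and i: "0 \<le> i" "i < int e"
  shows "addable e c i lam a \<longleftrightarrow> int e dvd (bead lam a - (i - c)) \<and> addable_at (beta_set 0 lam) (bead lam a)"
proof -
  have "residue e c a (lam a) = i \<longleftrightarrow> int e dvd (bead lam a - (i - c))"
  proof -
    have "residue e c a (lam a) = i \<longleftrightarrow> (c - int a + int (lam a)) mod int e = i mod int e"
      using i by (simp add: residue_def)
    also have "\<dots> \<longleftrightarrow> int e dvd (c - int a + int (lam a) - i)" by (rule mod_eq_dvd_iff)
    finally show ?thesis by (simp add: bead_def algebra_simps)
  qed
  moreover have "(a = 0 \<or> lam a < lam (a - 1)) \<longleftrightarrow> addable_at (beta_set 0 lam) (bead lam a)"
  proof -
    have "bead lam a + 1 \<in> beta_set 0 lam \<longleftrightarrow> a \<noteq> 0 \<and> lam (a - 1) \<le> lam a"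
    proof
      assume "bead lam a + 1 \<in> beta_set 0 lam"
      then obtain k where k: "bead lam a + 1 = bead lam k" by (auto simp: beta_set_0)
      have "k < a" using bead_less_iff[OF lam, of a k] k by simp
      moreover have "\<not> k < a - 1"
      proof
        assume "k < a - 1"
        hence "bead lam (a - 1) < bead lam k" "bead lam a < bead lam (a - 1)" by (simp_all add: bead_less[OF lam])
        thus False using k by simp
      qed
      ultimately have "a \<noteq> 0" "k = a - 1" by simp_all
      thus "a \<noteq> 0 \<and> lam (a - 1) \<le> lam a" using k by (auto simp: bead_def)
    next
      assume a: "a \<noteq> 0 \<and> lam (a - 1) \<le> lam a"
      have "lam a \<le> lam (a - 1)" using lam by (simp add: is_partition_def antimonoD)
      hence "bead lam a + 1 = bead lam (a - 1)" using a by (simp add: bead_def)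
      thus "bead lam a + 1 \<in> beta_set 0 lam" by (simp add: beta_set_0)
    qed
    thus ?thesis by (auto simp: addable_at_def beta_set_0)
  qed
  ultimately show ?thesis unfolding addable_def by blast
qed

lemma removable_iff:
  assumes lam: "is_partition lam" and i: "0 \<le> i" "i < int e"
  shows "removable e c i lam a \<longleftrightarrow>
    int e dvd (bead lam a - 1 - (i - c)) \<and> removable_at (beta_set 0 lam) (bead lam a - 1)"
proof -
  have "bead lam a - 1 \<in> beta_set 0 lam \<longleftrightarrow> lam a \<le> lam (Suc a)"
  proof
    assume "bead lam a - 1 \<in> beta_set 0 lam"
    then obtain k where k: "bead lam a - 1 = bead lam k" by (auto simp: beta_set_0)
    have "a < k" using bead_less_iff[OF lam, of k a] k by simp
    moreover have "\<not> Suc a < k"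
    proof
      assume "Suc a < k"
      hence "bead lam k < bead lam (Suc a)" "bead lam (Suc a) < bead lam a" by (simp_all add: bead_less[OF lam])
      thus False using k by simp
    qed
    ultimately have "k = Suc a" by simp
    thus "lam a \<le> lam (Suc a)" using k by (auto simp: bead_def)
  next
    assume a: "lam a \<le> lam (Suc a)"
    have "lam (Suc a) \<le> lam a" using lam by (simp add: is_partition_def antimonoD)
    hence "bead lam a - 1 = bead lam (Suc a)" using a by (simp add: bead_def)
    thus "bead lam a - 1 \<in> beta_set 0 lam" by (simp add: beta_set_0)
  qed
  hence r: "lam (Suc a) < lam a \<longleftrightarrow> removable_at (beta_set 0 lam) (bead lam a - 1)"
    by (auto simp: removable_at_def beta_set_0)
  moreover have "residue e c a (lam a - 1) = i \<longleftrightarrow> int e dvd (bead lam a - 1 - (i - c))" if "lam (Suc a) < lam a"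
  proof -
    have "residue e c a (lam a - 1) = i \<longleftrightarrow> (c - int a + int (lam a - 1)) mod int e = i mod int e"
      using i by (simp add: residue_def)
    also have "\<dots> \<longleftrightarrow> int e dvd (c - int a + int (lam a - 1) - i)" by (rule mod_eq_dvd_iff)
    finally show ?thesis using that by (simp add: bead_def algebra_simps of_nat_diff)
  qed
  ultimately show ?thesis unfolding removable_def by blast
qed

lemma signature_set:
  assumes lam: "is_partition lam" and i: "0 \<le> i" "i < int e"
  shows "p \<in> set (signature e c i lam) \<longleftrightarrow>
    int e dvd (level lam p - (i - c)) \<and> kind_at (fst p) (beta_set 0 lam) (level lam p)"
proof -
  obtain k a where p: "p = (k, a)" by fastforce
  have row: "a < Suc (card {k. lam k \<noteq> 0})" if "addable e c i lam a \<or> removable e c i lam a"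
  proof (cases "addable e c i lam a")
    case True
    hence "a = 0 \<or> lam (a - 1) \<noteq> 0" by (auto simp: addable_def)
    thus ?thesis using part_support[OF lam, of "a - 1"] by auto
  next
    case False
    hence "lam a \<noteq> 0" using that by (auto simp: removable_def)
    thus ?thesis using part_support[OF lam, of a] by simp
  qed
  have "p \<in> set (signature e c i lam) \<longleftrightarrow> (if k = Addable then addable e c i lam a else removable e c i lam a)"
    using row unfolding p signature_def by (cases k) (auto simp del: upt_Suc split: if_splits)
  thus ?thesis unfolding p
    using addable_iff[OF lam i, of c a] removable_iff[OF lam i, of c a] by (simp add: level_def kind_at_def)
qed

text \<open>Beads decrease from row to row. The level of a removable row is one less than its bead,
  but that position is vacant, so the following beads lie strictly below it.\<close>

lemma signature_sorted:
  assumes e: "e \<ge> 2" and lam: "is_partition lam" and i: "0 \<le> i" "i < int e"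
  shows "sorted_wrt (\<lambda>p q. level lam q < level lam p) (signature e c i lam)"
proof -
  let ?f = "\<lambda>a. (if addable e c i lam a then [(Addable, a)] else []) @
      (if removable e c i lam a then [(Removable, a)] else [])"
  have one: "\<not> (addable e c i lam a \<and> removable e c i lam a)" for a
  proof
    assume "addable e c i lam a \<and> removable e c i lam a"
    hence "int e dvd (bead lam a - (i - c))" "int e dvd (bead lam a - 1 - (i - c))"
      by (auto simp: addable_iff[OF lam i] removable_iff[OF lam i])
    from dvd_diff[OF this] have "int e dvd 1" by simp
    thus False using e by simp
  qed
  have "sorted_wrt (\<lambda>p q. level lam q < level lam p) (concat (map ?f [0..<n]))" for n
  proof (induction n)
    case (Suc n)
    have "level lam q < level lam p" if p: "p \<in> set (concat (map ?f [0..<n]))" and q: "q \<in> set (?f n)" for p q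
    proof -
      obtain a where a: "a < n" "p \<in> set (?f a)" using p by auto
      have lt: "bead lam n < bead lam a" by (rule bead_less[OF lam a(1)])
      show ?thesis
      proof (cases "fst p = Addable")
        case True
        hence "level lam p = bead lam a" using a(2) by (auto simp: level_def split: if_splits)
        moreover have "level lam q \<le> bead lam n" using q by (auto simp: level_def split: if_splits)
        ultimately show ?thesis using lt by simp
      next
        case False
        hence "level lam p = bead lam a - 1" "removable e c i lam a"
          using a(2) by (auto simp: level_def split: if_splits)
        moreover from this have "bead lam a - 1 \<noteq> bead lam n"
          by (auto simp: removable_iff[OF lam i] removable_at_def beta_set_0)
        moreover have "level lam q \<le> bead lam n" using q by (auto simp: level_def split: if_splits)
        ultimately show ?thesis using lt by simp
      qed
    qed
    moreover have "sorted_wrt (\<lambda>p q. level lam q < level lam p) (?f n)" using one[of n] by auto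
    ultimately show ?case using Suc.IH by (simp add: sorted_wrt_append)
  qed simp
  thus ?thesis unfolding signature_def by blast
qed

lemma kind_at_bead:
  assumes "kind_at k (beta_set 0 lam) x" obtains a where "level lam (k, a) = x"
proof -
  have "(if k = Addable then x else x + 1) \<in> beta_set 0 lam"
    using assms by (auto simp: kind_at_def addable_at_def removable_at_def)
  then obtain a where "(if k = Addable then x else x + 1) = bead lam a" by (auto simp: beta_set_0)
  hence "level lam (k, a) = x" by (auto simp: level_def split: if_splits)
  thus thesis by (rule that)
qed

lemma sorted_wrt_last_le:
  assumes "sorted_wrt (\<lambda>p q. f q < (f p :: int)) u" "p \<in> set u" shows "f (last u) \<le> f p"
  using assms by (induction u) (auto simp: order_less_imp_le)

lemma sorted_wrt_hd_ge:
  assumes "sorted_wrt (\<lambda>p q. f q < (f p :: int)) u" "p \<in> set u" shows "f p \<le> f (hd u)"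
  using assms by (cases u) (auto simp: order_less_imp_le)

text \<open>\<open>u\<close> lists the non-neutral levels above \<open>x\<close> and
  \<open>v\<close> those below, in decreasing order, so \<open>last u\<close> and
  \<open>hd v\<close> are the nearest ones. The claims for non-empty \<open>u\<close> and
  \<open>v\<close> serve in contraposition: if all levels above are empty, \<open>p\<close> is the
  first entry, and if all below are full, the last.\<close>

lemma signature_above:
  assumes e: "e \<ge> 2" and lam: "is_partition lam" and i: "0 \<le> i" "i < int e"
    and sig: "signature e c i lam = u @ p # v" and x: "x = level lam p"
  shows "u = [] \<or> fst (last u) = Addable \<Longrightarrow> above_ok (int e) x (beta_set 0 lam)"
    and "u \<noteq> [] \<Longrightarrow> \<exists>a>x. int e dvd (a - x) \<and> \<not> (a \<notin> beta_set 0 lam \<and> a + 1 \<notin> beta_set 0 lam)"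
    and "v = [] \<or> fst (hd v) = Removable \<Longrightarrow> below_ok (int e) x (beta_set 0 lam)"
    and "v \<noteq> [] \<Longrightarrow> \<exists>a<x. int e dvd (a - x) \<and> \<not> (a \<in> beta_set 0 lam \<and> a + 1 \<in> beta_set 0 lam)"
proof -
  let ?J = "beta_set 0 lam"
  have st: "sorted_wrt (\<lambda>p q. level lam q < level lam p) (u @ p # v)"
    using signature_sorted[OF e lam i, of c] sig by simp
  have su: "sorted_wrt (\<lambda>p q. level lam q < level lam p) u" "\<And>q. q \<in> set u \<Longrightarrow> x < level lam q"
    and sv: "sorted_wrt (\<lambda>p q. level lam q < level lam p) v" "\<And>q. q \<in> set v \<Longrightarrow> level lam q < x"
    using st unfolding x by (auto simp: sorted_wrt_append)
  have S: "q \<in> set u \<or> q = p \<or> q \<in> set v \<longleftrightarrow> int e dvd (level lam q - (i - c)) \<and> kind_at (fst q) ?J (level lam q)" for q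
    using signature_set[OF lam i, of q c] sig by auto
  have xc: "int e dvd (x - (i - c))" using S[of p] x by simp
  have cl: "int e dvd (a - x) \<longleftrightarrow> int e dvd (a - (i - c))" for a
    using cong_trans[OF _ xc, of a] cong_trans[OF _ cong_sym[OF xc], of a] by blast
  have ex: "\<exists>q. level lam q = a \<and> fst q = k \<and> (a > x \<longrightarrow> q \<in> set u) \<and> (a < x \<longrightarrow> q \<in> set v)"
    if d: "int e dvd (a - x)" and ka: "kind_at k ?J a" for a k
  proof -
    obtain b where b: "level lam (k, b) = a" using kind_at_bead[OF ka] by blast
    hence "(k, b) \<in> set u \<or> (k, b) = p \<or> (k, b) \<in> set v" using S[of "(k, b)"] d ka cl[of a] by simp
    thus ?thesis using b su(2)[of "(k, b)"] sv(2)[of "(k, b)"] x by (intro exI[of _ "(k, b)"]) auto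
  qed
  show "above_ok (int e) x ?J" if "u = [] \<or> fst (last u) = Addable"
    unfolding above_ok_def
  proof (intro allI impI)
    fix a assume a: "x < a" "int e dvd (a - x)" "removable_at ?J a"
    obtain q where q: "level lam q = a" "q \<in> set u"
      using ex[of a Removable] a by (auto simp: kind_at_def)
    have "u \<noteq> []" using q(2) by auto
    hence l: "last u \<in> set u" "fst (last u) = Addable" using that by simp_all
    define b where "b = level lam (last u)"
    have "x < b" "b \<le> a" "addable_at ?J b" "int e dvd (b - x)"
      using su(2)[OF l(1)] sorted_wrt_last_le[OF su(1) q(2)] S[of "last u"] l q(1) cl[of b]
      by (auto simp: b_def kind_at_def)
    moreover from this a have "b \<noteq> a" by (auto simp: addable_at_def removable_at_def)
    ultimately show "\<exists>b. x < b \<and> b < a \<and> int e dvd (b - x) \<and> addable_at ?J b" by (intro exI[of _ b]) simp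
  qed
  show "below_ok (int e) x ?J" if "v = [] \<or> fst (hd v) = Removable"
    unfolding below_ok_def
  proof (intro allI impI)
    fix a assume a: "a < x" "int e dvd (a - x)" "addable_at ?J a"
    obtain q where q: "level lam q = a" "q \<in> set v"
      using ex[of a Addable] a by (auto simp: kind_at_def)
    have "v \<noteq> []" using q(2) by auto
    hence l: "hd v \<in> set v" "fst (hd v) = Removable" using that by simp_all
    define b where "b = level lam (hd v)"
    have "b < x" "a \<le> b" "removable_at ?J b" "int e dvd (b - x)"
      using sv(2)[OF l(1)] sorted_wrt_hd_ge[OF sv(1) q(2)] S[of "hd v"] l q(1) cl[of b]
      by (auto simp: b_def kind_at_def)
    moreover from this a have "b \<noteq> a" by (auto simp: addable_at_def removable_at_def)
    ultimately show "\<exists>b. a < b \<and> b < x \<and> int e dvd (b - x) \<and> removable_at ?J b" by (intro exI[of _ b]) simp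
  qed
  have neut: "int e dvd (level lam q - x) \<and> \<not> (level lam q \<notin> ?J \<and> level lam q + 1 \<notin> ?J) \<and>
      \<not> (level lam q \<in> ?J \<and> level lam q + 1 \<in> ?J)" if "q \<in> set u \<or> q \<in> set v" for q
    using S[of q] that cl[of "level lam q"] by (auto simp: kind_at_def addable_at_def removable_at_def split: if_splits)
  show "\<exists>a>x. int e dvd (a - x) \<and> \<not> (a \<notin> ?J \<and> a + 1 \<notin> ?J)" if "u \<noteq> []"
    using neut[of "hd u"] su(2)[of "hd u"] that by (intro exI[of _ "level lam (hd u)"]) simp
  show "\<exists>a<x. int e dvd (a - x) \<and> \<not> (a \<in> ?J \<and> a + 1 \<in> ?J)" if "v \<noteq> []"
    using neut[of "hd v"] sv(2)[of "hd v"] that by (intro exI[of _ "level lam (hd v)"]) simp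
qed

lemma signature_ends:
  assumes e: "e \<ge> 2" and lam: "is_partition lam" and i: "0 \<le> i" "i < int e"
    and s: "s = signature e c i lam"
  shows "s = [] \<or> fst (hd s) = Removable \<Longrightarrow> top_ok (int e) (i - c) (beta_set 0 lam)"
    and "s = [] \<or> fst (last s) = Addable \<Longrightarrow> bot_ok (int e) (i - c) (beta_set 0 lam)"
proof -
  let ?J = "beta_set 0 lam"
  have st: "sorted_wrt (\<lambda>p q. level lam q < level lam p) s"
    using signature_sorted[OF e lam i, of c] s by simp
  have S: "q \<in> set s \<longleftrightarrow> int e dvd (level lam q - (i - c)) \<and> kind_at (fst q) ?J (level lam q)" for q
    using signature_set[OF lam i, of q c] s by auto
  have ex: "\<exists>q \<in> set s. level lam q = a" if d: "int e dvd (a - (i - c))" and ka: "kind_at k ?J a" for a k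
  proof -
    obtain b where b: "level lam (k, b) = a" using kind_at_bead[OF ka] by blast
    thus ?thesis using S[of "(k, b)"] d ka by (intro bexI[of _ "(k, b)"]) auto
  qed
  show "top_ok (int e) (i - c) ?J" if "s = [] \<or> fst (hd s) = Removable"
    unfolding top_ok_def
  proof (intro allI impI)
    fix a assume a: "int e dvd (a - (i - c))" "addable_at ?J a"
    obtain q where q: "level lam q = a" "q \<in> set s" using ex[of a Addable] a by (auto simp: kind_at_def)
    have "s \<noteq> []" using q(2) by auto
    hence l: "hd s \<in> set s" "fst (hd s) = Removable" using that by simp_all
    have "a \<le> level lam (hd s)" "removable_at ?J (level lam (hd s))" "int e dvd (level lam (hd s) - (i - c))"
      using sorted_wrt_hd_ge[OF st q(2)] S[of "hd s"] l q(1) by (auto simp: kind_at_def)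
    moreover from this a have "level lam (hd s) \<noteq> a" by (auto simp: addable_at_def removable_at_def)
    ultimately show "\<exists>b>a. int e dvd (b - (i - c)) \<and> removable_at ?J b" by (intro exI[of _ "level lam (hd s)"]) simp
  qed
  show "bot_ok (int e) (i - c) ?J" if "s = [] \<or> fst (last s) = Addable"
    unfolding bot_ok_def
  proof (intro allI impI)
    fix a assume a: "int e dvd (a - (i - c))" "removable_at ?J a"
    obtain q where q: "level lam q = a" "q \<in> set s" using ex[of a Removable] a by (auto simp: kind_at_def)
    have "s \<noteq> []" using q(2) by auto
    hence l: "last s \<in> set s" "fst (last s) = Addable" using that by simp_all
    have "level lam (last s) \<le> a" "addable_at ?J (level lam (last s))" "int e dvd (level lam (last s) - (i - c))"
      using sorted_wrt_last_le[OF st q(2)] S[of "last s"] l q(1) by (auto simp: kind_at_def)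
    moreover from this a have "level lam (last s) \<noteq> a" by (auto simp: addable_at_def removable_at_def)
    ultimately show "\<exists>b<a. int e dvd (b - (i - c)) \<and> addable_at ?J b" by (intro exI[of _ "level lam (last s)"]) simp
  qed
qed

text \<open>The signature of \<mu> is written first. An entry that is first in the part of
  \<open>lam\<close> therefore has the last entry of \<mu> as predecessor, and one that is last in
  the part of \<mu> has the first entry of \<open>lam\<close> as successor; this is how one factor
  constrains the other.\<close>

lemma tensor_split:
  assumes e: "e \<ge> 2" and part: "is_partition lam" "is_partition \<mu>" and i: "0 \<le> i" "i < int e"
    and ts: "tensor_signature e m i (lam, \<mu>) = u @ (k, r) # v"
    and uv: "u = [] \<or> fst (last u) = Addable" "v = [] \<or> fst (hd v) = Removable"
  obtains (left) a x where "r = Inl a" "x = level lam (k, a)" "int e dvd (x - i)" "kind_at k (beta_set 0 lam) x"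
      "above_ok (int e) x (beta_set 0 lam)" "below_ok (int e) x (beta_set 0 lam)"
      "(\<forall>b>x. int e dvd (b - x) \<longrightarrow> b \<notin> beta_set 0 lam \<and> b + 1 \<notin> beta_set 0 lam) \<longrightarrow>
        bot_ok (int e) (i - int m) (beta_set 0 \<mu>)"
    | (right) a x where "r = Inr a" "x = level \<mu> (k, a)" "int e dvd (x - (i - int m))" "kind_at k (beta_set 0 \<mu>) x"
      "above_ok (int e) x (beta_set 0 \<mu>)" "below_ok (int e) x (beta_set 0 \<mu>)"
      "(\<forall>b<x. int e dvd (b - x) \<longrightarrow> b \<in> beta_set 0 \<mu> \<and> b + 1 \<in> beta_set 0 \<mu>) \<longrightarrow>
        top_ok (int e) i (beta_set 0 lam)"
proof -
  let ?sm = "signature e (int m) i \<mu>" and ?sl = "signature e 0 i lam"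
  have eq: "map (map_prod id Inr) ?sm @ map (map_prod id Inl) ?sl = u @ (k, r) # v"
    using ts by (simp add: tensor_signature_def)
  consider (M) v' where "map (map_prod id Inr) ?sm = u @ (k, r) # v'" "v = v' @ map (map_prod id Inl) ?sl"
    | (L) u' where "u = map (map_prod id Inr) ?sm @ u'" "map (map_prod id Inl) ?sl = u' @ (k, r) # v"
    using eq unfolding append_eq_append_conv2 append_eq_Cons_conv by auto
  thus thesis
  proof cases
    case M
    obtain u1 p v1 where s: "?sm = u1 @ p # v1" "u = map (map_prod id Inr) u1" "(k, r) = map_prod id Inr p"
        "v' = map (map_prod id Inr) v1"
      using M(1) unfolding map_eq_append_conv map_eq_Cons_conv by auto
    obtain a where p: "p = (k, a)" "r = Inr a" using s(3) by (cases p) auto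
    define x where "x = level \<mu> (k, a)"
    have u1: "u1 = [] \<or> fst (last u1) = Addable" using uv(1) s(2) by (cases "u1 = []") (auto simp: last_map)
    have v1: "v1 = [] \<or> fst (hd v1) = Removable" using uv(2) M(2) s(4) by (cases v1) auto
    have top: "top_ok (int e) i (beta_set 0 lam)" if "v1 = []"
    proof -
      have "?sl = [] \<or> fst (hd ?sl) = Removable" using that s(4) M(2) uv(2) by (cases ?sl) auto
      thus ?thesis using signature_ends(1)[OF e part(1) i refl, of 0] by simp
    qed
    have x: "int e dvd (x - (i - int m))" "kind_at k (beta_set 0 \<mu>) x"
      using signature_set[OF part(2) i, of p "int m"] s(1) unfolding p(1) x_def by auto
    note ab = signature_above[OF e part(2) i s(1)[unfolded p(1)] x_def]
    show thesis
      by (rule right[OF p(2) x_def x ab(1)[OF u1] ab(3)[OF v1]]) (use ab(4) top in blast)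
  next
    case L
    obtain u1 p v1 where s: "?sl = u1 @ p # v1" "u' = map (map_prod id Inl) u1" "(k, r) = map_prod id Inl p"
        "v = map (map_prod id Inl) v1"
      using L(2) unfolding map_eq_append_conv map_eq_Cons_conv by auto
    obtain a where p: "p = (k, a)" "r = Inl a" using s(3) by (cases p) auto
    define x where "x = level lam (k, a)"
    have u1: "u1 = [] \<or> fst (last u1) = Addable" using uv(1) s(2) L(1) by (cases "u1 = []") (auto simp: last_map)
    have v1: "v1 = [] \<or> fst (hd v1) = Removable" using uv(2) s(4) by (cases v1) auto
    have bot: "bot_ok (int e) (i - int m) (beta_set 0 \<mu>)" if "u1 = []"
    proof -
      have "?sm = [] \<or> fst (last ?sm) = Addable" using that s(2) L(1) uv(1) by (cases "?sm = []") (auto simp: last_map)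
      thus ?thesis using signature_ends(2)[OF e part(2) i refl, of "int m"] by simp
    qed
    have x: "int e dvd (x - i)" "kind_at k (beta_set 0 lam) x"
      using signature_set[OF part(1) i, of p 0] s(1) unfolding p(1) x_def by auto
    note ab = signature_above[OF e part(1) i s(1)[unfolded p(1)] x_def]
    show thesis
      by (rule left[OF p(2) x_def x ab(1)[OF u1] ab(3)[OF v1]]) (use ab(2) bot in blast)
  qed
qed

text \<open>\<open>i\<close> is the residue of the last node of the last non-empty row. The residue
  of the addable node below differs from it by \<open>lam (n - 1)\<close>, which by restrictedness
  is not divisible by \<open>e\<close>, so no addable entry follows.\<close>

lemma last_signature:
  assumes lam: "e_restricted e lam" and ne: "lam \<noteq> empty_part" and n: "n = card {k. lam k \<noteq> 0}"
    and i: "i = (c - int n + int (lam (n - 1))) mod int e"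
  shows "n > 0" "lam (n - 1) > 0" "signature e c i lam \<noteq> []" "fst (last (signature e c i lam)) = Removable"
proof -
  have part: "is_partition lam" and rs: "lam k - lam (Suc k) < e" for k using lam by (auto simp: e_restricted_def)
  have sup: "lam k \<noteq> 0 \<longleftrightarrow> k < n" for k
    unfolding n by (rule part_support[OF part])
  obtain k where "lam k \<noteq> 0" using ne by (auto simp: empty_part_def)
  thus n0: "n > 0" using sup[of k] by simp
  thus pos: "lam (n - 1) > 0" using sup[of "n - 1"] by simp
  have z: "lam n = 0" using sup[of n] by simp
  have lt: "lam (n - 1) < e" using rs[of "n - 1"] n0 z by simp
  have "removable e c i lam (n - 1)"
    using n0 pos z by (simp add: removable_def residue_def i of_nat_diff algebra_simps)
  moreover have "\<not> removable e c i lam n" using z by (simp add: removable_def)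
  moreover have "\<not> addable e c i lam n"
  proof
    assume "addable e c i lam n"
    hence "(c - int n) mod int e = (c - int n + int (lam (n - 1))) mod int e"
      using z by (simp add: addable_def residue_def i)
    hence "int e dvd int (lam (n - 1))" unfolding mod_eq_dvd_iff by simp
    thus False using pos lt by (simp add: nat_dvd_not_less)
  qed
  moreover have "[0..<Suc n] = [0..<n - 1] @ [n - 1, n]"
    using n0 upt_Suc[of 0 n] upt_Suc[of 0 "n - 1"] by simp
  ultimately have "\<exists>xs. signature e c i lam = xs @ [(Removable, n - 1)]"
    unfolding signature_def n[symmetric] by simp
  thus "signature e c i lam \<noteq> []" "fst (last (signature e c i lam)) = Removable" by auto
qed

section \<open>Invariance along the edges of the crystal\<close>

text \<open>The inclusion as a comparison of bead counts, with both sets in charge \<open>m\<close>,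
  the charge belonging to \<open>tau_set\<close>.\<close>

definition fits :: "nat \<Rightarrow> nat \<Rightarrow> part \<times> part \<Rightarrow> bool" where
  "fits e m b \<longleftrightarrow> dominated (beta_set (int m) (roof e (snd b))) (tau_set (int e) m (beta_set 0 (base e (fst b))))"

lemma fits_iff:
  assumes e: "e \<ge> 2" "m \<le> e - 1" and b: "(lam, \<mu>) \<in> B_fund e \<times> B_fund e"
  shows "fits e m (lam, \<mu>) \<longleftrightarrow> sub_diagram (roof e \<mu>) (tau e m (base e lam))"
proof -
  have e0: "e > 0" "m \<le> e" using e by auto
  have part: "is_partition lam" "e_restricted e \<mu>" using b by (auto simp: B_fund_def e_restricted_def)
  note bs = base_spec[OF e0(1) part(1)] and rs = roof_spec[OF e0(1) part(2)]
  have core: "U_set e (beta_set 0 (base e lam)) = {}" using bs(2) by (simp add: is_base_def)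
  note t = tau_spec[OF e0 bs(1) core]
  show ?thesis unfolding fits_def sub_diagram_iff[OF rs(1) t(1), of "int m"] t(2) by simp
qed

lemma move_levels:
  assumes "E \<ge> 2" "E dvd (a - x)" "a \<noteq> x"
  shows "a \<in> J - {x} \<union> {x + 1} \<longleftrightarrow> a \<in> J" "a + 1 \<in> J - {x} \<union> {x + 1} \<longleftrightarrow> a + 1 \<in> (J :: int set)"
proof -
  have "a \<noteq> x + 1" "a + 1 \<noteq> x" using assms by auto
  thus "a \<in> J - {x} \<union> {x + 1} \<longleftrightarrow> a \<in> J" "a + 1 \<in> J - {x} \<union> {x + 1} \<longleftrightarrow> a + 1 \<in> J" using assms(3) by auto
qed

text \<open>The conditions do not see level \<open>x\<close>, so a removal can be treated as the
  reverse of an addition.\<close>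

lemma ok_move:
  assumes E: "E \<ge> 2"
  shows "above_ok E x (J - {x} \<union> {x + 1}) \<longleftrightarrow> above_ok E x J" "below_ok E x (J - {x} \<union> {x + 1}) \<longleftrightarrow> below_ok E x J"
proof -
  let ?J = "J - {x} \<union> {x + 1}"
  have A: "addable_at ?J a \<longleftrightarrow> addable_at J a" and R: "removable_at ?J a \<longleftrightarrow> removable_at J a" if "E dvd (a - x)" "a \<noteq> x" for a
    unfolding addable_at_def removable_at_def by (simp_all only: move_levels[OF E that])
  show "above_ok E x ?J \<longleftrightarrow> above_ok E x J" unfolding above_ok_def
    using A R by (metis order_less_irrefl)
  show "below_ok E x ?J \<longleftrightarrow> below_ok E x J" unfolding below_ok_def
    using A R by (metis order_less_irrefl)
qed

lemma beta_like_beta_set: "e_restricted e lam \<Longrightarrow> beta_like (beta_set c lam)"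
  using charged_beta_like[OF charged_beta_set] by (simp add: e_restricted_def)

lemma beta_like_tau_set:
  assumes e: "e \<ge> 2" "m \<le> e - 1" and lam: "is_partition lam" and core: "U_set e (beta_set 0 lam) = {}"
  shows "beta_like (tau_set (int e) m (beta_set 0 lam))"
proof -
  have "e > 0" "m \<le> e" using e by auto
  from tau_spec[OF this lam core] show ?thesis using charged_beta_like[OF charged_beta_set] by metis
qed

text \<open>If the roof changes, all levels below \<open>x\<close> are full and \<open>x\<close> is
  addable. So \<open>bot_ok\<close> holds, the roof of \<mu> has no removable level, and level
  equivalence turns into addition of nodes. By \<open>top\<close> the other side has no addable
  level of this residue, so the inclusion survives the addition.\<close>

lemma fits_edge_right:
  assumes e: "e \<ge> 2" "m \<le> e - 1" and lam: "e_restricted e lam" and mu: "e_restricted e \<mu>" "e_restricted e \<mu>'"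
    and x: "x \<in> beta_set 0 \<mu>" "x + 1 \<notin> beta_set 0 \<mu>" "beta_set 0 \<mu>' = beta_set 0 \<mu> - {x} \<union> {x + 1}"
    and ok: "int e dvd (x - (i - int m))" "above_ok (int e) x (beta_set 0 \<mu>)" "below_ok (int e) x (beta_set 0 \<mu>)"
    and top: "(\<forall>b<x. int e dvd (b - x) \<longrightarrow> b \<in> beta_set 0 \<mu> \<and> b + 1 \<in> beta_set 0 \<mu>) \<longrightarrow>
      top_ok (int e) i (beta_set 0 lam)"
  shows "fits e m (lam, \<mu>) \<longleftrightarrow> fits e m (lam, \<mu>')"
proof -
  define E where "E = int e"
  have E: "E \<ge> 2" using e by (simp add: E_def)
  have e0: "e > 0" using e by simp
  let ?J = "beta_set 0 \<mu>" and ?J' = "beta_set 0 \<mu>'" and ?K = "beta_set 0 (roof e \<mu>)" and ?K' = "beta_set 0 (roof e \<mu>')"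
  let ?L = "beta_set 0 (base e lam)"
  let ?T = "tau_set E m ?L"
  have lp: "is_partition lam" using lam by (simp add: e_restricted_def)
  note bs = base_spec[OF e0 lp] and rs = roof_spec[OF e0 mu(1)] and rs' = roof_spec[OF e0 mu(2)]
  have core: "U_set e ?L = {}" using bs(2) by (simp add: is_base_def)
  have rr: "restricted E ?J" "restricted E (?J - {x} \<union> {x + 1})"
    using restricted_beta_set[OF mu(1)] restricted_beta_set[OF mu(2)] unfolding E_def x(3) by simp_all
  have "?K = ?K' \<or> (\<forall>a<x. E dvd (a - x) \<longrightarrow> a \<in> ?J \<and> a + 1 \<in> ?J) \<and> level_equiv E x ?K ?K'"
    by (rule roof_edge[OF e(1) E_def beta_like_beta_set[OF mu(1)] rr x(1,2) ok(3,2)[folded E_def] rs(2) rs'(2)[unfolded x(3)]])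
  thus ?thesis
  proof
    assume "?K = ?K'"
    hence "beta_set (int m) (roof e \<mu>) = beta_set (int m) (roof e \<mu>')"
      using in_beta_set[of _ "int m" "roof e \<mu>"] in_beta_set[of _ "int m" "roof e \<mu>'"] by blast
    thus ?thesis by (simp add: fits_def)
  next
    assume a: "(\<forall>a<x. E dvd (a - x) \<longrightarrow> a \<in> ?J \<and> a + 1 \<in> ?J) \<and> level_equiv E x ?K ?K'"
    have topl: "top_ok (int e) i (beta_set 0 lam)" using top a unfolding E_def by blast
    have bot: "bot_ok (int e) x ?J" unfolding bot_ok_def
    proof (intro allI impI)
      fix b assume b: "int e dvd (b - x)" "removable_at ?J b"
      have "x < b" using a b x(1) unfolding E_def removable_at_def by (metis linorder_neqE)
      thus "\<exists>c<b. int e dvd (c - x) \<and> addable_at ?J c" using x by (intro exI[of _ x]) (simp add: addable_at_def)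
    qed
    have lc: "b \<in> ?K" if "int e dvd (b - x)" "b + 1 \<in> ?K" for b
      by (rule roof_left_closed[OF e(1) beta_like_beta_set[OF mu(1)] rr(1)[unfolded E_def] bot rs(2) that])
    let ?S = "beta_set (int m) (roof e \<mu>)" and ?S' = "beta_set (int m) (roof e \<mu>')"
    \<comment> \<open>Passing from charge 0 to charge \<open>m\<close> turns the class of
      \<open>x\<close>, which is that of \<open>i - int m\<close>, into the class of
      \<open>i\<close>.\<close>
    have cong: "E dvd (b - i) \<longleftrightarrow> E dvd (b - int m - x)" for b
    proof -
      have "b - i = b - int m - x + (x - (i - int m))" by simp
      thus ?thesis using dvd_add_left_iff[OF ok(1), of "b - int m - x"] unfolding E_def by metis
    qed
    have le: "adds_nodes E i ?S ?S'"
    proof (rule adds_nodesI[OF E])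
      fix y assume y: "\<not> E dvd (y - i)" "\<not> E dvd (y - 1 - i)"
      have "\<not> E dvd (y - int m - x)" using y(1) cong[of y] by blast
      moreover have "\<not> E dvd (y - int m - 1 - x)" using y(2) cong[of "y - 1"] by (simp add: algebra_simps)
      ultimately show "y \<in> ?S \<longleftrightarrow> y \<in> ?S'"
        using level_equivD(1)[of E x ?K ?K' "y - int m"] a in_beta_set[of y] by blast
    next
      fix y assume y: "E dvd (y - i)"
      have d: "E dvd (y - int m - x)" using y cong by blast
      have s: "y + 1 - int m = y - int m + 1" by simp
      have "of_bool (y \<in> ?S) + of_bool (y + 1 \<in> ?S) = (of_bool (y \<in> ?S') + of_bool (y + 1 \<in> ?S') :: int)"
        using level_equivD(2)[of E x ?K ?K' "y - int m"] a d unfolding in_beta_set[of y] in_beta_set[of "y + 1"] s by blast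
      moreover have "y \<in> ?S" if "y + 1 \<in> ?S"
        using lc[of "y - int m"] d that unfolding in_beta_set[of y] in_beta_set[of "y + 1"] s E_def by blast
      ultimately show "(y \<in> ?S \<longleftrightarrow> y \<in> ?S') \<and> (y + 1 \<in> ?S \<longleftrightarrow> y + 1 \<in> ?S') \<or> addable_at ?S y \<and> removable_at ?S' y"
        unfolding addable_at_def removable_at_def by (auto simp: of_bool_def split: if_splits)
    qed
    have bS: "beta_like ?S" using charged_beta_like[OF charged_beta_set[OF rs(1)]] .
    have bL: "beta_like ?L" using charged_beta_like[OF charged_beta_set[OF bs(1)]] .
    have bT: "beta_like ?T" unfolding E_def by (rule beta_like_tau_set[OF e bs(1) core])
    obtain N M where NM: "{..N} \<subseteq> beta_set 0 lam" "beta_set 0 lam \<subseteq> {..M}"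
      using beta_like_beta_set[OF lam, of 0] by (auto simp: beta_like_def)
    have T: "y + 1 \<in> ?T" if "E dvd (y - i)" "y \<in> ?T" for y
      by (rule tau_set_right_closed[OF bL _ that]) (rule base_right_closed[OF e(1) NM topl bs(2) _ E_def])
    show ?thesis unfolding fits_def fst_conv snd_conv E_def[symmetric]
    proof
      assume "dominated ?S ?T" thus "dominated ?S' ?T" by (rule dominated_up[OF E bS bT _ le T])
    next
      assume "dominated ?S' ?T" thus "dominated ?S ?T" by (rule dominated_trans[OF dominated_adds_nodes[OF E bS le]])
    qed
  qed
qed

text \<open>If the base changes, \<open>tau_set\<close> gains nodes of residue \<open>i\<close>. By
  \<open>bot\<close> the roof of \<mu> has no removable one, so taking these nodes away again cannot
  destroy the inclusion.\<close>

lemma fits_edge_left: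
  assumes e: "e \<ge> 2" "m \<le> e - 1" and mu: "e_restricted e \<mu>" and lam: "e_restricted e lam" "e_restricted e lam'"
    and x: "x \<in> beta_set 0 lam" "x + 1 \<notin> beta_set 0 lam" "beta_set 0 lam' = beta_set 0 lam - {x} \<union> {x + 1}"
    and ok: "int e dvd (x - i)" "above_ok (int e) x (beta_set 0 lam)" "below_ok (int e) x (beta_set 0 lam)"
    and bot: "(\<forall>b>x. int e dvd (b - x) \<longrightarrow> b \<notin> beta_set 0 lam \<and> b + 1 \<notin> beta_set 0 lam) \<longrightarrow>
      bot_ok (int e) (i - int m) (beta_set 0 \<mu>)"
  shows "fits e m (lam, \<mu>) \<longleftrightarrow> fits e m (lam', \<mu>)"
proof -
  define E where "E = int e"
  have E: "E \<ge> 2" using e by (simp add: E_def)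
  have e0: "e > 0" using e by simp
  let ?J = "beta_set 0 lam" and ?J' = "beta_set 0 lam'" and ?L = "beta_set 0 (base e lam)" and ?L' = "beta_set 0 (base e lam')"
  let ?T = "tau_set E m ?L" and ?T' = "tau_set E m ?L'"
  let ?S = "beta_set (int m) (roof e \<mu>)"
  have lp: "is_partition lam" "is_partition lam'" using lam by (auto simp: e_restricted_def)
  note bs = base_spec[OF e0 lp(1)] and bs' = base_spec[OF e0 lp(2)] and rs = roof_spec[OF e0 mu]
  obtain N M where NM: "{..N} \<subseteq> ?J" "?J \<subseteq> {..M}" using beta_like_beta_set[OF lam(1), of 0] by (auto simp: beta_like_def)
  have "?L = ?L' \<or> (\<forall>a>x. int e dvd (a - x) \<longrightarrow> a \<notin> ?J \<and> a + 1 \<notin> ?J) \<and> adds_nodes (int e) x ?L ?L'"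
    by (rule base_edge[OF e(1) NM x(1,2) ok(3,2) bs(2) bs'(2)[unfolded x(3)]])
  thus ?thesis
  proof
    assume "?L = ?L'"
    thus ?thesis by (simp add: fits_def)
  next
    assume a: "(\<forall>a>x. int e dvd (a - x) \<longrightarrow> a \<notin> ?J \<and> a + 1 \<notin> ?J) \<and> adds_nodes (int e) x ?L ?L'"
    have botm: "bot_ok (int e) (i - int m) (beta_set 0 \<mu>)" using bot a by blast
    have core: "U_set e ?L = {}" "U_set e ?L' = {}" using bs(2) bs'(2) by (simp_all add: is_base_def)
    have bL: "beta_like ?L" using charged_beta_like[OF charged_beta_set[OF bs(1)]] .
    have le: "adds_nodes E x ?T ?T'"
      by (rule adds_nodes_tau_set[OF E bL]) (use core a in \<open>simp_all add: U_set_empty_iff E_def\<close>)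
    have bS: "beta_like ?S" using charged_beta_like[OF charged_beta_set[OF rs(1)]] .
    have bT: "beta_like ?T" unfolding E_def by (rule beta_like_tau_set[OF e bs(1) core(1)])
    have S: "y \<in> ?S" if y: "E dvd (y - x)" "y + 1 \<in> ?S" for y
    proof -
      have "y - int m - (i - int m) = y - x + (x - i)" by simp
      hence d: "int e dvd (y - int m - (i - int m))" using y(1) ok(1) unfolding E_def by (metis dvd_add)
      have "y - int m + 1 \<in> beta_set 0 (roof e \<mu>)" using y(2) in_beta_set[of "y + 1"] by (simp add: algebra_simps)
      thus ?thesis unfolding in_beta_set[of y]
        by (rule roof_left_closed[OF e(1) beta_like_beta_set[OF mu] restricted_beta_set[OF mu] botm rs(2) d])
    qed
    show ?thesis unfolding fits_def fst_conv snd_conv E_def[symmetric]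
    proof
      assume "dominated ?S ?T" thus "dominated ?S ?T'" by (rule dominated_trans[OF _ dominated_adds_nodes[OF E bT le]])
    next
      assume "dominated ?S ?T'" thus "dominated ?S ?T" by (rule dominated_down[OF E bS bT _ le S])
    qed
  qed
qed

lemma beta_set_add:
  assumes "is_partition lam"
  shows "beta_set 0 (lam(a := lam a + 1)) = beta_set 0 lam - {bead lam a} \<union> {bead lam a + 1}"
proof -
  have b: "bead (lam(a := lam a + 1)) k = (if k = a then bead lam a + 1 else bead lam k)" for k
    by (simp add: bead_def)
  have "range (bead (lam(a := lam a + 1))) = bead lam ` (UNIV - {a}) \<union> {bead lam a + 1}"
    unfolding b[abs_def] by auto
  also have "bead lam ` (UNIV - {a}) = range (bead lam) - {bead lam a}"
    using bead_inj[OF assms] by auto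
  finally show ?thesis unfolding beta_set_0 .
qed

lemma remove_row:
  assumes lam: "is_partition lam" and R: "removable_at (beta_set 0 lam) x" and x: "x = bead lam a - 1"
    and lam': "lam' = lam(a := lam a - 1)"
  shows "lam a > 0" "is_partition lam'" "lam = lam'(a := lam' a + 1)" "x = bead lam' a"
    "beta_set 0 lam = beta_set 0 lam' - {x} \<union> {x + 1}" "x \<in> beta_set 0 lam'" "x + 1 \<notin> beta_set 0 lam'"
proof -
  have le: "lam l \<le> lam k" if "k \<le> l" for k l using lam that by (simp add: antimonoD is_partition_def)
  have lt: "lam (Suc a) < lam a"
  proof (rule ccontr)
    assume "\<not> lam (Suc a) < lam a"
    hence "bead lam (Suc a) = x" using le[of a "Suc a"] x by (simp add: bead_def)
    thus False using R by (auto simp: removable_at_def beta_set_0)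
  qed
  thus pos: "lam a > 0" by simp
  have "lam' l \<le> lam' k" if kl: "k \<le> l" for k l
  proof -
    have "lam l < lam a" if "a < l" using le[of "Suc a" l] lt that by simp
    thus ?thesis using le[OF kl] kl unfolding lam' by (cases "k = a"; cases "l = a") auto
  qed
  moreover have "finite {k. lam' k \<noteq> 0}"
    by (rule finite_subset[of _ "{k. lam k \<noteq> 0}"]) (use lam in \<open>auto simp: lam' is_partition_def split: if_splits\<close>)
  ultimately show p: "is_partition lam'" by (simp add: is_partition_def antimono_def)
  show eq: "lam = lam'(a := lam' a + 1)" using pos by (simp add: lam')
  show xb: "x = bead lam' a" using pos by (simp add: x lam' bead_def of_nat_diff)
  show B: "beta_set 0 lam = beta_set 0 lam' - {x} \<union> {x + 1}" using beta_set_add[OF p, of a] eq xb by metis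
  show "x \<in> beta_set 0 lam'" by (simp add: xb beta_set_0)
  show "x + 1 \<notin> beta_set 0 lam'"
  proof
    assume "x + 1 \<in> beta_set 0 lam'"
    then obtain k where k: "x + 1 = bead lam' k" by (auto simp: beta_set_0)
    have "k \<noteq> a" using k xb by auto
    hence "bead lam k = bead lam a" using k x by (simp add: bead_def lam')
    thus False using bead_inj[OF lam] \<open>k \<noteq> a\<close> by blast
  qed
qed

text \<open>Lowering the bead \<open>x + 1\<close> to \<open>x\<close> can only hurt a bead
  \<open>z = x + 1 + E\<close>. If \<open>z - 1\<close> were vacant, \<open>x + E\<close> would be a
  removable level with no level of the class between it and \<open>x\<close>, against
  \<open>above_ok\<close>.\<close>

lemma e_restricted_remove:
  assumes e: "e \<ge> 2" and lam: "e_restricted e lam" and R: "removable_at (beta_set 0 lam) x"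
    and lam': "is_partition lam'" "beta_set 0 lam = beta_set 0 lam' - {x} \<union> {x + 1}"
      "x \<in> beta_set 0 lam'" "x + 1 \<notin> beta_set 0 lam'"
    and ok: "above_ok (int e) x (beta_set 0 lam)"
  shows "e_restricted e lam'"
proof (rule e_restricted_beta_set[OF lam'(1)])
  define E where "E = int e"
  have E: "E \<ge> 2" using e by (simp add: E_def)
  let ?J = "beta_set 0 lam" and ?J' = "beta_set 0 lam'"
  have rs: "\<exists>y\<in>?J. z - E \<le> y \<and> y < z" if "z \<in> ?J" for z
    using restricted_beta_set[OF lam] that unfolding restricted_def E_def by blast
  have mem: "y \<in> ?J' \<longleftrightarrow> y \<noteq> x + 1 \<and> (y \<in> ?J \<or> y = x)" for y using lam'(2-4) by auto
  show "restricted (int e) ?J'" unfolding restricted_def E_def[symmetric]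
  proof
    fix z assume z: "z \<in> ?J'"
    show "\<exists>y\<in>?J'. z - E \<le> y \<and> y < z"
    proof (cases "z = x")
      case True
      have "x + 1 \<in> ?J" "x \<notin> ?J" using R by (auto simp: removable_at_def)
      then obtain y where y: "y \<in> ?J" "x + 1 - E \<le> y" "y < x + 1" using rs[of "x + 1"] by auto
      have "y \<noteq> x" using y(1) \<open>x \<notin> ?J\<close> by blast
      hence "z - E \<le> y \<and> y < z" using y True by simp
      moreover have "y \<in> ?J'" using y mem by simp
      ultimately show ?thesis by blast
    next
      case False
      hence zJ: "z \<in> ?J" "z \<noteq> x + 1" using z mem by auto
      obtain y where y: "y \<in> ?J" "z - E \<le> y" "y < z" using rs[OF zJ(1)] by blast
      show ?thesis
      proof (cases "y = x + 1")
        case no: False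
        thus ?thesis using y mem by blast
      next
        case yx: True
        show ?thesis
        proof (cases "z - E \<le> x")
          case True
          thus ?thesis using y yx lam'(3) by (intro bexI[of _ x]) simp_all
        next
          case False
          hence zE: "z = x + 1 + E" using y yx by simp
          have "z - 1 \<in> ?J"
          proof (rule ccontr)
            assume "z - 1 \<notin> ?J"
            hence "removable_at ?J (x + E)" using zJ zE by (simp add: removable_at_def add.commute add.left_commute)
            moreover have "x < x + E" "int e dvd (x + E - x)" using E by (simp_all add: E_def)
            ultimately obtain b where b: "x < b" "b < x + E" "E dvd (b - x)"
              using ok unfolding above_ok_def E_def by blast
            show False using cong_gap[of E b x] b cong_gap[OF b(3)] zdvd_not_zless[of "b - x" E] by simp
          qed
          moreover have "z - 1 \<noteq> x + 1" using zE E by simp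
          ultimately have "z - 1 \<in> ?J'" using mem by simp
          thus ?thesis using E by (intro bexI[of _ "z - 1"]) simp_all
        qed
      qed
    qed
  qed
qed (use e in simp)

lemma fits_crystal_edge:
  assumes e: "e \<ge> 2" "m \<le> e - 1" and edge: "crystal_edge e m b b'"
  shows "fits e m b \<longleftrightarrow> fits e m b'"
proof -
  obtain lam \<mu> lam' \<mu>' where b: "b = (lam, \<mu>)" "b' = (lam', \<mu>')" by fastforce
  have E: "int e \<ge> 2" using e by simp
  have rs: "e_restricted e lam" "e_restricted e \<mu>" "e_restricted e lam'" "e_restricted e \<mu>'"
    using edge by (auto simp: crystal_edge_def b B_fund_def)
  hence part: "is_partition lam" "is_partition \<mu>" by (auto simp: e_restricted_def)
  obtain i where i: "0 \<le> i" "i < int e" and op: "f_op e m i b = Some b' \<or> e_op e m i b = Some b'"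
    using edge by (auto simp: crystal_edge_def)
  from op show ?thesis
  proof
    assume "f_op e m i b = Some b'"
    then obtain u r v where f: "tensor_signature e m i (lam, \<mu>) = u @ (Addable, r) # v"
        "u = [] \<or> fst (last u) = Addable" "v = [] \<or> fst (hd v) = Removable" "b' = add_node r b"
      unfolding b(1) by (rule f_op_split)
    show ?thesis
    proof (rule tensor_split[OF e(1) part i f(1-3)])
      fix a x assume *: "r = Inl a" "x = level lam (Addable, a)" "int e dvd (x - i)" "kind_at Addable (beta_set 0 lam) x"
        "above_ok (int e) x (beta_set 0 lam)" "below_ok (int e) x (beta_set 0 lam)"
        "(\<forall>b>x. int e dvd (b - x) \<longrightarrow> b \<notin> beta_set 0 lam \<and> b + 1 \<notin> beta_set 0 lam) \<longrightarrow>
          bot_ok (int e) (i - int m) (beta_set 0 \<mu>)"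
      have n: "lam' = lam(a := lam a + 1)" "\<mu>' = \<mu>" using f(4) b *(1) by auto
      have x: "x \<in> beta_set 0 lam" "x + 1 \<notin> beta_set 0 lam" "beta_set 0 lam' = beta_set 0 lam - {x} \<union> {x + 1}"
        using *(2,4) beta_set_add[OF part(1), of a] n by (simp_all add: level_def kind_at_def addable_at_def)
      show ?thesis unfolding b n(2) by (rule fits_edge_left[OF e rs(2,1,3) x *(3,5,6,7)])
    next
      fix a x assume *: "r = Inr a" "x = level \<mu> (Addable, a)" "int e dvd (x - (i - int m))" "kind_at Addable (beta_set 0 \<mu>) x"
        "above_ok (int e) x (beta_set 0 \<mu>)" "below_ok (int e) x (beta_set 0 \<mu>)"
        "(\<forall>b<x. int e dvd (b - x) \<longrightarrow> b \<in> beta_set 0 \<mu> \<and> b + 1 \<in> beta_set 0 \<mu>) \<longrightarrow>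
          top_ok (int e) i (beta_set 0 lam)"
      have n: "\<mu>' = \<mu>(a := \<mu> a + 1)" "lam' = lam" using f(4) b *(1) by auto
      have x: "x \<in> beta_set 0 \<mu>" "x + 1 \<notin> beta_set 0 \<mu>" "beta_set 0 \<mu>' = beta_set 0 \<mu> - {x} \<union> {x + 1}"
        using *(2,4) beta_set_add[OF part(2), of a] n by (simp_all add: level_def kind_at_def addable_at_def)
      show ?thesis unfolding b n(2) by (rule fits_edge_right[OF e rs(1,2,4) x *(3,5,6,7)])
    qed
  next
    assume "e_op e m i b = Some b'"
    then obtain u r v where f: "tensor_signature e m i (lam, \<mu>) = u @ (Removable, r) # v"
        "u = [] \<or> fst (last u) = Addable" "v = [] \<or> fst (hd v) = Removable" "b' = remove_node r b"
      unfolding b(1) by (rule e_op_split)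
    show ?thesis
    proof (rule tensor_split[OF e(1) part i f(1-3)])
      fix a x assume *: "r = Inl a" "x = level lam (Removable, a)" "int e dvd (x - i)" "kind_at Removable (beta_set 0 lam) x"
        "above_ok (int e) x (beta_set 0 lam)" "below_ok (int e) x (beta_set 0 lam)"
        "(\<forall>b>x. int e dvd (b - x) \<longrightarrow> b \<notin> beta_set 0 lam \<and> b + 1 \<notin> beta_set 0 lam) \<longrightarrow>
          bot_ok (int e) (i - int m) (beta_set 0 \<mu>)"
      have n: "lam' = lam(a := lam a - 1)" "\<mu>' = \<mu>" using f(4) b *(1) by auto
      have R: "removable_at (beta_set 0 lam) x" "x = bead lam a - 1" using *(2,4) by (simp_all add: kind_at_def level_def)
      note x = remove_row[OF part(1) R n(1)]
      have ok: "above_ok (int e) x (beta_set 0 lam')" "below_ok (int e) x (beta_set 0 lam')"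
        using *(5,6) ok_move[OF E, of x "beta_set 0 lam'"] unfolding x(5) by simp_all
      have bot: "(\<forall>b>x. int e dvd (b - x) \<longrightarrow> b \<notin> beta_set 0 lam' \<and> b + 1 \<notin> beta_set 0 lam') \<longrightarrow>
          bot_ok (int e) (i - int m) (beta_set 0 \<mu>)"
        using *(7) move_levels[OF E, of _ x "beta_set 0 lam'"] unfolding x(5) by (metis order_less_irrefl)
      show ?thesis unfolding b n(2) by (rule fits_edge_left[OF e rs(2,3,1) x(6,7,5) *(3) ok bot, symmetric])
    next
      fix a x assume *: "r = Inr a" "x = level \<mu> (Removable, a)" "int e dvd (x - (i - int m))" "kind_at Removable (beta_set 0 \<mu>) x"
        "above_ok (int e) x (beta_set 0 \<mu>)" "below_ok (int e) x (beta_set 0 \<mu>)"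
        "(\<forall>b<x. int e dvd (b - x) \<longrightarrow> b \<in> beta_set 0 \<mu> \<and> b + 1 \<in> beta_set 0 \<mu>) \<longrightarrow>
          top_ok (int e) i (beta_set 0 lam)"
      have n: "\<mu>' = \<mu>(a := \<mu> a - 1)" "lam' = lam" using f(4) b *(1) by auto
      have R: "removable_at (beta_set 0 \<mu>) x" "x = bead \<mu> a - 1" using *(2,4) by (simp_all add: kind_at_def level_def)
      note x = remove_row[OF part(2) R n(1)]
      have ok: "above_ok (int e) x (beta_set 0 \<mu>')" "below_ok (int e) x (beta_set 0 \<mu>')"
        using *(5,6) ok_move[OF E, of x "beta_set 0 \<mu>'"] unfolding x(5) by simp_all
      have top: "(\<forall>b<x. int e dvd (b - x) \<longrightarrow> b \<in> beta_set 0 \<mu>' \<and> b + 1 \<in> beta_set 0 \<mu>') \<longrightarrow>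
          top_ok (int e) i (beta_set 0 lam)"
        using *(7) move_levels[OF E, of _ x "beta_set 0 \<mu>'"] unfolding x(5) by (metis order_less_irrefl)
      show ?thesis unfolding b n(2) by (rule fits_edge_right[OF e rs(1,4,2) x(6,7,5) *(3) ok top, symmetric])
    qed
  qed
qed

section \<open>Descent along the operators \<open>e_op\<close>\<close>

definition part_size :: "part \<Rightarrow> nat" where
  "part_size lam = sum lam {k. lam k \<noteq> 0}"

lemma part_size_remove:
  assumes "is_partition lam" "lam a > 0" shows "part_size (lam(a := lam a - 1)) < part_size lam"
proof -
  let ?l = "lam(a := lam a - 1)" and ?A = "{k. lam k \<noteq> 0}"
  have fin: "finite ?A" using assms(1) by (simp add: is_partition_def)
  have "part_size ?l = sum ?l ?A" unfolding part_size_def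
    by (rule sum.mono_neutral_left[OF fin]) (auto split: if_splits)
  also have "\<dots> < sum lam ?A"
    by (rule sum_strict_mono_ex1[OF fin]) (use assms(2) in \<open>auto intro!: bexI[of _ a]\<close>)
  finally show ?thesis by (simp add: part_size_def)
qed

lemma e_op_edge:
  assumes e: "e \<ge> 2" and b: "(lam, \<mu>) \<in> B_fund e \<times> B_fund e" and i: "0 \<le> i" "i < int e"
    and op: "e_op e m i (lam, \<mu>) = Some b'"
  shows "crystal_edge e m (lam, \<mu>) b'" "part_size (fst b') + part_size (snd b') < part_size lam + part_size \<mu>"
proof -
  have rs: "e_restricted e lam" "e_restricted e \<mu>" using b by (auto simp: B_fund_def)
  hence part: "is_partition lam" "is_partition \<mu>" by (auto simp: e_restricted_def)
  obtain u r v where f: "tensor_signature e m i (lam, \<mu>) = u @ (Removable, r) # v"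
      "u = [] \<or> fst (last u) = Addable" "v = [] \<or> fst (hd v) = Removable" "b' = remove_node r (lam, \<mu>)"
    using op by (rule e_op_split)
  have "b' \<in> B_fund e \<times> B_fund e \<and> part_size (fst b') + part_size (snd b') < part_size lam + part_size \<mu>"
  proof (rule tensor_split[OF e part i f(1-3)])
    fix a x assume *: "r = Inl a" "x = level lam (Removable, a)" "kind_at Removable (beta_set 0 lam) x"
      "above_ok (int e) x (beta_set 0 lam)"
    have b': "b' = (lam(a := lam a - 1), \<mu>)" using f(4) *(1) by simp
    have R: "removable_at (beta_set 0 lam) x" "x = bead lam a - 1" using *(2,3) by (simp_all add: kind_at_def level_def)
    note x = remove_row[OF part(1) R refl]
    show ?thesis using e_restricted_remove[OF e rs(1) R(1) x(2,5,6,7) *(4)] rs(2) part_size_remove[OF part(1) x(1)]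
      by (simp add: b' B_fund_def)
  next
    fix a x assume *: "r = Inr a" "x = level \<mu> (Removable, a)" "kind_at Removable (beta_set 0 \<mu>) x"
      "above_ok (int e) x (beta_set 0 \<mu>)"
    have b': "b' = (lam, \<mu>(a := \<mu> a - 1))" using f(4) *(1) by simp
    have R: "removable_at (beta_set 0 \<mu>) x" "x = bead \<mu> a - 1" using *(2,3) by (simp_all add: kind_at_def level_def)
    note x = remove_row[OF part(2) R refl]
    show ?thesis using e_restricted_remove[OF e rs(2) R(1) x(2,5,6,7) *(4)] rs(1) part_size_remove[OF part(2) x(1)]
      by (simp add: b' B_fund_def)
  qed
  thus "crystal_edge e m (lam, \<mu>) b'" "part_size (fst b') + part_size (snd b') < part_size lam + part_size \<mu>"
    using b i op unfolding crystal_edge_def by auto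
qed

section \<open>Highest weight elements\<close>

lemma empty_part_facts:
  "is_partition empty_part" "beta_set 0 empty_part = {..0}" "e > 0 \<Longrightarrow> e_restricted e empty_part"
  "U_set e {..0} = {}"
proof -
  show p: "is_partition empty_part" by (simp add: is_partition_def empty_part_def antimono_def)
  show "e > 0 \<Longrightarrow> e_restricted e empty_part" using p by (simp add: e_restricted_def empty_part_def)
  have "x \<in> range (\<lambda>k. - int k)" if "x \<le> 0" for x
    by (rule image_eqI[of _ _ "nat (- x)"]) (use that in simp_all)
  thus "beta_set 0 empty_part = {..0}" unfolding beta_set_def empty_part_def by auto
  show "U_set e {..0} = {}" by (auto simp: U_set_def)
qed

lemma base_empty: assumes "e > 0" shows "base e empty_part = empty_part"
proof -
  note bs = base_spec[OF assms empty_part_facts(1)]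
  have "is_base e {..0} {..0}" unfolding is_base_def using empty_part_facts(4) by (intro conjI exI[of _ 0]) simp_all
  hence "beta_set 0 (base e empty_part) = beta_set 0 empty_part"
    using bs(2) is_base_unique unfolding empty_part_facts(2) by blast
  thus ?thesis by (rule beta_set_inj[OF bs(1) empty_part_facts(1)])
qed

lemma roof_empty: assumes "e > 0" shows "roof e empty_part = empty_part"
proof -
  note rs = roof_spec[OF assms empty_part_facts(3)[OF assms]]
  have "is_roof e {..0} {..0}" unfolding is_roof_def using empty_part_facts(4) by (intro conjI exI[of _ 0]) simp_all
  hence "beta_set 0 (roof e empty_part) = beta_set 0 empty_part"
    using rs(2) is_roof_unique unfolding empty_part_facts(2) by blast
  thus ?thesis by (rule beta_set_inj[OF rs(1) empty_part_facts(1)])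
qed

text \<open>The vacancies of \<open>{..0}\<close> are \<open>1\<close> to \<open>e\<close>. The
  \<open>m\<close> largest of them are consecutive beads above a gap of length \<open>e - m\<close>,
  which is the rectangle.\<close>

lemma tau_empty:
  assumes "e > 0" "m \<le> e"
  shows "tau e m empty_part = (\<lambda>k. if k < m then e - m else 0)"
proof (rule beta_set_inj)
  let ?nu = "\<lambda>k. if k < m then e - m else 0"
  note t = tau_spec[OF assms empty_part_facts(1)] empty_part_facts(2,4)
  show "is_partition (tau e m empty_part)" using t by simp
  have "finite {k. ?nu k \<noteq> 0}" by (rule finite_subset[of _ "{..<m}"]) (auto split: if_splits)
  thus "is_partition ?nu" by (simp add: is_partition_def antimono_def)
  have V: "vacancies (int e) {..0} = {1..int e}" by (auto simp: vacancies_def)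
  have r: "card {w \<in> {1..int e}. x < w} < m \<longleftrightarrow> int e - int m < x" if "x \<in> {1..int e}" for x
  proof -
    have "{w \<in> {1..int e}. x < w} = {x + 1..int e}" using that by auto
    thus ?thesis using that by (simp add: zless_nat_eq_int_zless nat_less_iff) linarith
  qed
  have T: "tau_set (int e) m {..0} = {..0} \<union> {int e - int m + 1..int e}"
    unfolding tau_set_def V using r assms by auto
  have N: "beta_set (int m) ?nu = {..0} \<union> {int e - int m + 1..int e}"
  proof (intro equalityI subsetI)
    fix x assume "x \<in> beta_set (int m) ?nu"
    then obtain k where "x = int (?nu k) + int m - int k" by (auto simp: beta_set_def)
    thus "x \<in> {..0} \<union> {int e - int m + 1..int e}" using assms by (auto split: if_splits)
  next
    fix x assume x: "x \<in> {..0} \<union> {int e - int m + 1..int e}"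
    show "x \<in> beta_set (int m) ?nu"
    proof (cases "x \<le> 0")
      case True
      thus ?thesis unfolding beta_set_def by (intro image_eqI[of _ _ "nat (int m - x)"]) auto
    next
      case False
      thus ?thesis unfolding beta_set_def using x assms by (intro image_eqI[of _ _ "nat (int e - x)"]) auto
    qed
  qed
  show "beta_set (int m) (tau e m empty_part) = beta_set (int m) ?nu" using t T N by simp
qed

lemma dominated_move:
  assumes bd: "beta_like J" and p: "p \<in> J" "q \<notin> J" "p < q" shows "dominated J (J - {p} \<union> {q})"
  unfolding dominated_def
proof
  fix y
  have fin: "finite (J \<inter> {y..})" by (rule card_ge_Suc(2)[OF bd])
  show "card (J \<inter> {y..}) \<le> card ((J - {p} \<union> {q}) \<inter> {y..})"
  proof (cases "y \<le> p")
    case True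
    hence "(J - {p} \<union> {q}) \<inter> {y..} = insert q (J \<inter> {y..} - {p})" using p by auto
    thus ?thesis using True p fin by (simp add: card_Suc_Diff1 card_insert_if)
  next
    case False
    show ?thesis
    proof (rule card_mono)
      show "finite ((J - {p} \<union> {q}) \<inter> {y..})" by (rule finite_subset[of _ "insert q (J \<inter> {y..})"]) (use fin in auto)
    qed (use False in auto)
  qed
qed

text \<open>Every step of \<open>up\<close> moves a bead to a higher free position.\<close>

lemma dominated_roof:
  assumes e: "e > 0" and J: "beta_like J" "restricted (int e) J" and roof: "is_roof e J K"
  shows "dominated J K"
proof -
  have "dominated J ((up_beta e ^^ n) J)" for n
  proof (induction n)
    case 0
    show ?case by (simp add: dominated_def)
  next
    case (Suc n)
    let ?K = "(up_beta e ^^ n) J"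
    have K: "beta_like ?K" "restricted (int e) ?K" using up_iter_pres[OF e J, of n] by simp_all
    have "dominated ?K (up_beta e ?K)"
    proof (cases "U_set e ?K = {}")
      case True thus ?thesis by (simp add: up_beta_def dominated_def)
    next
      case False
      obtain p q where pq: "is_pq (int e) ?K p q" "up_beta e ?K = ?K - {p} \<union> {q}"
        using up_betaE[OF e K False] by blast
      show ?thesis unfolding pq(2) by (rule dominated_move[OF K(1)]) (use pq(1) in \<open>auto simp: is_pq_def\<close>)
    qed
    thus ?case using dominated_trans[OF Suc.IH] by simp
  qed
  thus ?thesis using roof by (auto simp: is_roof_def)
qed

lemma sub_diagram_roof:
  assumes "e > 0" "e_restricted e \<mu>" shows "sub_diagram \<mu> (roof e \<mu>)"
proof -
  have p: "is_partition \<mu>" using assms(2) by (simp add: e_restricted_def)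
  note rs = roof_spec[OF assms]
  show ?thesis unfolding sub_diagram_iff[OF p rs(1), of 0]
    by (rule dominated_roof[OF assms(1) beta_like_beta_set[OF assms(2)] restricted_beta_set[OF assms(2)] rs(2)])
qed

lemma highest_weight:
  assumes e: "e \<ge> 2" "m \<le> e - 1" and b: "(lam, \<mu>) \<in> B_fund e \<times> B_fund e"
    and sub: "sub_diagram (roof e \<mu>) (tau e m (base e lam))"
    and hw: "\<And>i b'. 0 \<le> i \<Longrightarrow> i < int e \<Longrightarrow> e_op e m i (lam, \<mu>) \<noteq> Some b'"
  shows "lam = empty_part" "\<mu> = empty_part"
proof -
  have e0: "e > 0" "m \<le> e" using e by auto
  have rs: "e_restricted e lam" "e_restricted e \<mu>" using b by (auto simp: B_fund_def)
  have no: False if "tensor_signature e m i (lam, \<mu>) \<noteq> []" "fst (last (tensor_signature e m i (lam, \<mu>))) = Removable"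
    "0 \<le> i" "i < int e" for i
    using e_op_last[OF that(1,2)] hw[OF that(3,4)] by metis
  show lam: "lam = empty_part"
  proof (rule ccontr)
    assume "lam \<noteq> empty_part"
    define n where "n = card {k. lam k \<noteq> 0}"
    \<comment> \<open>The residue of the last removable node of \<open>lam\<close>. As
      \<open>lam\<close> is read last, its entry ends the tensor signature, so nothing can cancel it
      and \<open>e_op\<close> is defined.\<close>
    define i where "i = (0 - int n + int (lam (n - 1))) mod int e"
    note l = last_signature[OF rs(1) \<open>lam \<noteq> empty_part\<close> n_def i_def]
    show False by (rule no[of i]) (use l(3,4) e0 in \<open>simp_all add: tensor_signature_def last_map, simp_all add: i_def\<close>)
  qed
  show "\<mu> = empty_part"
  proof (rule ccontr)
    assume ne: "\<mu> \<noteq> empty_part"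
    define n where "n = card {k. \<mu> k \<noteq> 0}"
    define i where "i = (int m - int n + int (\<mu> (n - 1))) mod int e"
    note l = last_signature[OF rs(2) ne n_def i_def]
    have "\<mu> (n - 1) \<le> roof e \<mu> (n - 1)"
      using sub_diagram_roof[OF e0(1) rs(2)] unfolding sub_diagram_def by blast
    also have "\<dots> \<le> tau e m empty_part (n - 1)"
      using sub unfolding lam base_empty[OF e0(1)] sub_diagram_def by blast
    finally have "\<mu> (n - 1) \<le> (if n - 1 < m then e - m else 0)" unfolding tau_empty[OF e0] .
    hence nm: "n \<le> m" "\<mu> (n - 1) \<le> e - m" using l(1,2) by (auto split: if_splits)
    \<comment> \<open>The lower bound uses \<open>n \<le> m\<close> and that the last part is
      positive, the upper one that it is at most \<open>e - m\<close> and \<open>n > 0\<close>. So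
      \<open>i\<close> is not 0, the only residue of an addable node of the empty
      \<open>lam\<close>, and the tensor signature is that of \<mu>.\<close>
    hence "0 < int m - int n + int (\<mu> (n - 1))" "int m - int n + int (\<mu> (n - 1)) < int e" using l(1,2) e0 by auto
    hence "i \<noteq> 0" by (simp add: i_def)
    hence "\<not> addable e 0 i empty_part 0" by (simp add: addable_def residue_def empty_part_def)
    hence "signature e 0 i lam = []" unfolding lam signature_def by (simp add: empty_part_def removable_def)
    hence ts: "tensor_signature e m i (lam, \<mu>) = map (map_prod id Inr) (signature e (int m) i \<mu>)"
      by (simp add: tensor_signature_def)
    show False by (rule no[of i]) (use l(3,4) e0 in \<open>simp_all add: ts last_map, simp_all add: i_def\<close>)
  qed
qed

theorem theorem9p5:
  fixes e m :: nat and lam \<mu> :: part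
  assumes "e \<ge> 2" and "m \<le> e - 1"
    and "(lam, \<mu>) \<in> B_fund e \<times> B_fund e"
  shows "(lam, \<mu>) \<in> B_sum e m \<longleftrightarrow> sub_diagram (roof e \<mu>) (tau e m (base e lam))"
proof -
  note e = assms(1,2)
  have e0: "e > 0" using e by simp
  have fits0: "fits e m (empty_part, empty_part)"
  proof -
    have "sub_diagram (roof e empty_part) (tau e m (base e empty_part))"
      unfolding roof_empty[OF e0] sub_diagram_def by (simp add: empty_part_def)
    thus ?thesis using fits_iff[OF e] empty_part_facts(3)[OF e0] by (simp add: B_fund_def)
  qed
  have "fits e m b" if "equivclp (crystal_edge e m) (empty_part, empty_part) b" for b
    using that
  proof (induction rule: equivclp_induct)
    case (step y z)
    thus ?case using fits_crystal_edge[OF e] by blast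
  qed (rule fits0)
  \<comment> \<open>Induction on the size: an edge given by \<open>e_op\<close> leads to a smaller
    pair that still fits, and a pair to which no operator applies is empty.\<close>
  moreover have "fits e m b \<Longrightarrow> b \<in> B_fund e \<times> B_fund e \<Longrightarrow> equivclp (crystal_edge e m) (empty_part, empty_part) b" for b
  proof (induction "part_size (fst b) + part_size (snd b)" arbitrary: b rule: less_induct)
    case less
    obtain l \<nu> where b: "b = (l, \<nu>)" by fastforce
    show ?case
    proof (cases "\<exists>i b'. 0 \<le> i \<and> i < int e \<and> e_op e m i (l, \<nu>) = Some b'")
      case True
      then obtain i b' where i: "0 \<le> i" "i < int e" "e_op e m i (l, \<nu>) = Some b'" by blast
      note ed = e_op_edge[OF e(1) less.prems(2)[unfolded b] i]
      have "b' \<in> B_fund e \<times> B_fund e" using ed(1) by (simp add: crystal_edge_def)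
      moreover have "fits e m b'" using fits_crystal_edge[OF e ed(1)] less.prems(1) b by simp
      ultimately have "equivclp (crystal_edge e m) (empty_part, empty_part) b'"
        using less.hyps[of b'] ed(2) b by simp
      thus ?thesis using ed(1) unfolding b by (metis equivclp_into_equivclp)
    next
      case False
      have "sub_diagram (roof e \<nu>) (tau e m (base e l))" using fits_iff[OF e] less.prems b by simp
      from highest_weight[OF e less.prems(2)[unfolded b] this] False have "b = (empty_part, empty_part)"
        unfolding b by blast
      thus ?thesis by simp
    qed
  qed
  ultimately show ?thesis using fits_iff[OF assms] assms(3) unfolding B_sum_def by blast
qed

end
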